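(* The $*$-algebra $L(Z_2)/S(Z_2)$ admits two inequivalent $*$-algebra norms.
   Context: The scalar field is either $\mathbb{R}$ or $\mathbb{C}$. The Kalton--Peck space $Z_2$ is the twisted sum $\ell_2\oplus_{\Omega}\ell_2$, where $\Omega=\Omega_2$ is the quasi-linear map given on finitely supported vectors by $\Omega(x)(n)=x(n)\log\frac{\|x\|_2}{|x(n)|}$ (with value $0$ where $x(n)=0$); i.e. $Z_2$ is the space of pairs $(x,y)$ of sequences with $y\in\ell_2$, $x-\Omega y\in\ell_2$, with quasi-norm $\|(x,y)\|=\|x-\Omega y\|_2+\|y\|_2$, which is equivalent to a Banach space norm. $L(Z_2)$ is the algebra of bounded linear operators on $Z_2$ and $S(Z_2)$ the closed ideal of strictly singular operators (operators whose restriction to any infinite dimensional closed subspace is not an isomorphism onto its range). The continuous form $\omega((x,y),(x',y'))=\langle x,y'\rangle-\langle y,x'\rangle$ (with the $\ell_2$ inner product, on finitely supported vectors, extended by continuity) is a symplectic form on $Z_2$ (bilinear and alternating in the real case; sesquilinear with $\omega(u,v)=-\overline{\omega(v,u)}$ in the complex case; inducing an isomorphism onto the dual, respectively conjugate dual). The involution $*$ on $L(Z_2)$ is defined by $\omega(Tu,v)=\omega(u,T^*v)$ for all $u,v\in Z_2$. An operator is strictly singular if and only if its adjoint $T^*$ is, so $*$ induces an involution on $L(Z_2)/S(Z_2)$. An algebra norm is a (not necessarily complete) submultiplicative norm; a $*$-algebra norm is an algebra norm for which the involution is an isometry. Two norms are equivalent if each is dominated by a constant multiple of the other. *)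

theory Defs
  imports Complex_Main "HOL-Algebra.QuotRing" "HOL-Algebra.Module"
begin

section \<open>Scalars\<close>

text \<open>The axiom \<open>scalar_cnj_norm\<close> determines the conjugation. With additivity it also makes every
  \<open>x + scalar_cnj x\<close> real, so every element is algebraic of degree at most 2 over the reals:
  up to isomorphism the two instances below are the only ones.\<close>

class real_or_complex = real_normed_field +
  fixes scalar_cnj :: "'a \<Rightarrow> 'a"
  assumes scalar_cnj_add: "scalar_cnj (x + y) = scalar_cnj x + scalar_cnj y"
    and scalar_cnj_norm: "x * scalar_cnj x = (norm x)\<^sup>2 *\<^sub>R 1"

instantiation real :: real_or_complex
begin
definition scalar_cnj_real :: "real \<Rightarrow> real" where "scalar_cnj_real x = x"
instance by standard (simp_all add: scalar_cnj_real_def power2_eq_square)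
end

instantiation complex :: real_or_complex
begin
definition scalar_cnj_complex :: "complex \<Rightarrow> complex" where "scalar_cnj_complex = cnj"
instance by standard
  (simp_all add: scalar_cnj_complex_def complex_norm_square scaleR_conv_of_real del: of_real_power)
end


section \<open>The sequence space and the Kalton-Peck map\<close>

definition ell2 :: "(nat \<Rightarrow> 'k::real_normed_field) set" where
  "ell2 = {x. summable (\<lambda>n. (norm (x n))\<^sup>2)}"

definition norm2 :: "(nat \<Rightarrow> 'k::real_normed_field) \<Rightarrow> real" where
  "norm2 x = sqrt (\<Sum>n. (norm (x n))\<^sup>2)"

definition inner2 :: "(nat \<Rightarrow> 'k) \<Rightarrow> (nat \<Rightarrow> 'k) \<Rightarrow> 'k::real_or_complex" where
  "inner2 x y = (\<Sum>n. x n * scalar_cnj (y n))"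

definition Omega :: "(nat \<Rightarrow> 'k) \<Rightarrow> nat \<Rightarrow> 'k::real_normed_field" where
  "Omega x n = (if x n = 0 then 0 else x n * of_real (ln (norm2 x / norm (x n))))"

definition Z2_carrier :: "((nat \<Rightarrow> 'k) \<times> (nat \<Rightarrow> 'k::real_normed_field)) set" where
  "Z2_carrier = {(x, y). y \<in> ell2 \<and> (\<lambda>n. x n - Omega y n) \<in> ell2}"

lemma ell2_add:
  assumes "x \<in> ell2" "y \<in> ell2"
  shows "(\<lambda>n. x n + y n) \<in> ell2"
proof -
  have s: "summable (\<lambda>n. 2 * (norm (x n))\<^sup>2 + 2 * (norm (y n))\<^sup>2)"
    using assms by (intro summable_add summable_mult) (auto simp: ell2_def)
  have "(norm (x n + y n))\<^sup>2 \<le> 2 * (norm (x n))\<^sup>2 + 2 * (norm (y n))\<^sup>2" for n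
  proof -
    have "(norm (x n + y n))\<^sup>2 \<le> (norm (x n) + norm (y n))\<^sup>2"
      by (intro power_mono norm_triangle_ineq norm_ge_zero)
    also have "\<dots> \<le> 2 * (norm (x n))\<^sup>2 + 2 * (norm (y n))\<^sup>2"
      using zero_le_power2[of "norm (x n) - norm (y n)"]
      by (simp add: power2_eq_square algebra_simps)
    finally show ?thesis .
  qed
  then have "summable (\<lambda>n. (norm (x n + y n))\<^sup>2)"
    by (intro summable_comparison_test'[OF s, of 0]) simp
  then show ?thesis by (simp add: ell2_def)
qed

lemma ell2_scale: "x \<in> ell2 \<Longrightarrow> (\<lambda>n. c * x n) \<in> ell2"
  by (auto simp: ell2_def norm_mult power_mult_distrib intro: summable_mult)

lemma ell2_bounded:
  assumes "x \<in> ell2" "\<And>n. norm (y n) \<le> norm (x n)"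
  shows "y \<in> ell2"
proof -
  have "summable (\<lambda>n. (norm (x n))\<^sup>2)" using assms(1) by (simp add: ell2_def)
  then have "summable (\<lambda>n. (norm (y n))\<^sup>2)"
    by (rule summable_comparison_test'[of _ 0]) (simp add: assms(2) power_mono)
  then show ?thesis by (simp add: ell2_def)
qed

lemma ell2_norm_bounded:
  fixes x y z :: "nat \<Rightarrow> 'k::real_normed_field"
  assumes "x \<in> ell2" "y \<in> ell2" "\<And>n. norm (z n) \<le> norm (x n) + norm (y n)"
  shows "z \<in> ell2"
proof -
  have "(\<lambda>n. of_real (norm (x n)) :: 'k) \<in> ell2" "(\<lambda>n. of_real (norm (y n)) :: 'k) \<in> ell2"
    using assms(1,2) by (auto simp: ell2_def)
  then have "(\<lambda>n. of_real (norm (x n)) + of_real (norm (y n)) :: 'k) \<in> ell2"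
    by (rule ell2_add)
  then show ?thesis
    by (rule ell2_bounded) (use assms(3) in \<open>simp flip: of_real_add\<close>)
qed

lemma norm2_pos:
  assumes "x \<in> ell2" "x n \<noteq> 0"
  shows "norm2 x > 0"
  using suminf_pos2[of "\<lambda>n. (norm (x n))\<^sup>2" n] assms by (simp add: norm2_def ell2_def)

lemma Omega_alt:
  assumes "x \<in> ell2"
  shows "Omega x n = x n * of_real (ln (norm2 x)) - x n * of_real (ln (norm (x n)))"
  using norm2_pos[OF assms, of n] by (auto simp: Omega_def ln_div algebra_simps)

lemma abs_mult_ln_le:
  fixes r :: real
  assumes "0 \<le> r" "r \<le> 2"
  shows "\<bar>r * ln r\<bar> \<le> 2"
proof (cases "r = 0")
  case False
  then have r: "r > 0" using assms by simp
  have "r * ln r \<le> r * (r - 1)"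
    using r ln_le_minus_one[OF r] by (intro mult_left_mono) auto
  also have "\<dots> \<le> 2 * 1"
  proof (cases "r \<ge> 1")
    case True
    then show ?thesis using assms by (intro mult_mono) auto
  next
    case False
    then have "r * (r - 1) \<le> 0" using r by (intro mult_nonneg_nonpos) auto
    then show ?thesis by simp
  qed
  finally have 1: "r * ln r \<le> 2" by simp
  have "r * ln (1 / r) \<le> r * (1 / r - 1)"
    using r ln_le_minus_one[of "1 / r"] by (intro mult_left_mono) auto
  also have "\<dots> \<le> 2" using r by (simp add: right_diff_distrib)
  finally have "- (r * ln r) \<le> 2" using r by (simp add: ln_div)
  with 1 show ?thesis by linarith
qed simp

lemma quasi_additive_aux:
  fixes s t :: "'k::real_normed_field"
  assumes "norm t \<le> norm s"
  shows "norm ((s + t) * of_real (ln (norm (s + t))) - s * of_real (ln (norm s))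
            - t * of_real (ln (norm t))) \<le> 4 * norm s"
proof (cases "s = 0")
  case True
  with assms show ?thesis by simp
next
  case False
  have *: "norm (a * of_real (ln (norm a)) - a * of_real (ln (norm s))) \<le> 2 * norm s"
    if "norm a \<le> 2 * norm s" for a :: 'k
  proof (cases "a = 0")
    case a: False
    let ?r = "norm a / norm s"
    have "norm (a * of_real (ln (norm a)) - a * of_real (ln (norm s)))
        = norm (a * of_real (ln ?r))"
      using a False by (simp add: ln_div algebra_simps)
    also have "\<dots> = norm s * \<bar>?r * ln ?r\<bar>"
      using False by (simp add: norm_mult abs_mult)
    also have "\<dots> \<le> norm s * 2"
      using False that by (intro mult_left_mono abs_mult_ln_le) (auto simp: field_simps)
    finally show ?thesis by simp
  qed simp
  have "norm (s + t) \<le> 2 * norm s" using norm_triangle_ineq[of s t] assms by simp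
  from *[OF this]
  have 1: "norm ((s + t) * of_real (ln (norm (s + t))) - (s + t) * of_real (ln (norm s)))
      \<le> 2 * norm s" .
  have 2: "norm (t * of_real (ln (norm t)) - t * of_real (ln (norm s))) \<le> 2 * norm s"
    by (rule *) (use assms norm_ge_zero[of s] in linarith)
  have "norm (((s + t) * of_real (ln (norm (s + t))) - (s + t) * of_real (ln (norm s)))
      - (t * of_real (ln (norm t)) - t * of_real (ln (norm s)))) \<le> 2 * norm s + 2 * norm s"
    by (rule order_trans[OF norm_triangle_ineq4 add_mono[OF 1 2]])
  then show ?thesis by (simp add: algebra_simps)
qed

lemma quasi_additive:
  fixes s t :: "'k::real_normed_field"
  shows "norm ((s + t) * of_real (ln (norm (s + t))) - s * of_real (ln (norm s))
            - t * of_real (ln (norm t))) \<le> 4 * norm s + 4 * norm t"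
proof (cases "norm t \<le> norm s")
  case True
  then show ?thesis using quasi_additive_aux[OF True] norm_ge_zero[of t] by linarith
next
  case False
  then have "norm s \<le> norm t" by simp
  from quasi_additive_aux[OF this]
  have "norm ((s + t) * of_real (ln (norm (s + t))) - s * of_real (ln (norm s))
            - t * of_real (ln (norm t))) \<le> 4 * norm t"
    by (simp add: add.commute diff_diff_eq)
  then show ?thesis using norm_ge_zero[of s] by linarith
qed

lemma Omega_quasi_additive:
  fixes x y :: "nat \<Rightarrow> 'k::real_normed_field"
  assumes x: "x \<in> ell2" and y: "y \<in> ell2"
  shows "(\<lambda>n. Omega x n + Omega y n - Omega (\<lambda>n. x n + y n) n) \<in> ell2"
proof -
  let ?d = "\<lambda>n. (x n + y n) * of_real (ln (norm (x n + y n))) - x n * of_real (ln (norm (x n)))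
            - y n * of_real (ln (norm (y n)))"
  define a where "a = ln (norm2 x) - ln (norm2 (\<lambda>n. x n + y n))"
  define b where "b = ln (norm2 y) - ln (norm2 (\<lambda>n. x n + y n))"
  have "(\<lambda>n. 4 * x n) \<in> ell2" "(\<lambda>n. 4 * y n) \<in> ell2" using x y by (auto intro: ell2_scale)
  then have d: "?d \<in> ell2"
    by (rule ell2_norm_bounded) (use quasi_additive in \<open>simp add: norm_mult\<close>)
  have "(\<lambda>n. ?d n + (of_real a * x n + of_real b * y n)) \<in> ell2"
    by (intro ell2_add d ell2_scale x y)
  moreover have "Omega x n + Omega y n - Omega (\<lambda>n. x n + y n) n
      = ?d n + (of_real a * x n + of_real b * y n)" for n
    unfolding Omega_alt[OF x] Omega_alt[OF y] Omega_alt[OF ell2_add[OF x y]] a_def b_def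
    by (simp add: algebra_simps)
  ultimately show ?thesis by simp
qed

lemma norm2_scale:
  assumes "x \<in> ell2"
  shows "norm2 (\<lambda>n. c * x n) = norm c * norm2 x"
  using assms by (simp add: norm2_def norm_mult power_mult_distrib suminf_mult ell2_def
      real_sqrt_mult)

lemma Omega_scale:
  assumes "x \<in> ell2"
  shows "Omega (\<lambda>n. c * x n) n = c * Omega x n"
  using norm2_scale[OF assms, of c] by (auto simp: Omega_def norm_mult)

lemma Z2_carrier_add:
  assumes "(x, y) \<in> Z2_carrier" "(x', y') \<in> Z2_carrier"
  shows "(\<lambda>n. x n + x' n, \<lambda>n. y n + y' n) \<in> Z2_carrier"
proof -
  have y: "y \<in> ell2" "y' \<in> ell2" using assms by (auto simp: Z2_carrier_def)
  have "(\<lambda>n. ((x n - Omega y n) + (x' n - Omega y' n))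
      + (Omega y n + Omega y' n - Omega (\<lambda>n. y n + y' n) n)) \<in> ell2"
    using assms by (intro ell2_add Omega_quasi_additive) (auto simp: Z2_carrier_def)
  then show ?thesis using ell2_add[OF y] by (simp add: Z2_carrier_def algebra_simps)
qed

lemma Z2_carrier_scale:
  assumes "(x, y) \<in> Z2_carrier"
  shows "(\<lambda>n. c * x n, \<lambda>n. c * y n) \<in> Z2_carrier"
proof -
  have y: "y \<in> ell2" and xy: "(\<lambda>n. x n - Omega y n) \<in> ell2"
    using assms by (auto simp: Z2_carrier_def)
  have "(\<lambda>n. c * (x n - Omega y n)) \<in> ell2" by (rule ell2_scale[OF xy])
  then show ?thesis
    using ell2_scale[OF y, of c] by (simp add: Z2_carrier_def Omega_scale[OF y] algebra_simps)
qed

lemma Z2_carrier_zero: "(\<lambda>_. 0, \<lambda>_. 0) \<in> Z2_carrier"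
  by (simp add: Z2_carrier_def ell2_def Omega_def)


section \<open>The Kalton-Peck space\<close>

typedef (overloaded) ('k::real_normed_field) Z2 = "Z2_carrier :: ((nat \<Rightarrow> 'k) \<times> (nat \<Rightarrow> 'k)) set"
  morphisms Z2_coords Z2_of
  using Z2_carrier_zero by blast

setup_lifting type_definition_Z2

instantiation Z2 :: (real_normed_field) ab_group_add
begin

lift_definition zero_Z2 :: "'a Z2" is "(\<lambda>_. 0, \<lambda>_. 0)"
  by (rule Z2_carrier_zero)

lift_definition plus_Z2 :: "'a Z2 \<Rightarrow> 'a Z2 \<Rightarrow> 'a Z2" is
  "\<lambda>(x, y) (x', y'). (\<lambda>n. x n + x' n, \<lambda>n. y n + y' n)"
  using Z2_carrier_add by auto

lift_definition uminus_Z2 :: "'a Z2 \<Rightarrow> 'a Z2" is "\<lambda>(x, y). (\<lambda>n. - x n, \<lambda>n. - y n)"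
  using Z2_carrier_scale[where c = "-1"] by auto

definition minus_Z2 :: "'a Z2 \<Rightarrow> 'a Z2 \<Rightarrow> 'a Z2" where "minus_Z2 u v = u + - v"

instance
  by standard (unfold minus_Z2_def, (transfer; auto simp: algebra_simps)+)

end

lift_definition Z2_scale :: "'k::real_normed_field \<Rightarrow> 'k Z2 \<Rightarrow> 'k Z2" is
  "\<lambda>c (x, y). (\<lambda>n. c * x n, \<lambda>n. c * y n)"
  using Z2_carrier_scale by auto

global_interpretation Z2: vector_space "Z2_scale :: 'k::real_normed_field \<Rightarrow> 'k Z2 \<Rightarrow> 'k Z2"
  by standard (transfer; auto simp: algebra_simps)+

definition Z2_qnorm :: "'k::real_normed_field Z2 \<Rightarrow> real" where
  "Z2_qnorm u = (let (x, y) = Z2_coords u in norm2 (\<lambda>n. x n - Omega y n) + norm2 y)"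

text \<open>Quasi-norm balls need not be open, but they are neighbourhoods of their centre.\<close>

instantiation Z2 :: (real_normed_field) topological_space
begin

definition open_Z2 :: "'a Z2 set \<Rightarrow> bool" where
  "open_Z2 U \<longleftrightarrow> (\<forall>u\<in>U. \<exists>e>0. \<forall>v. Z2_qnorm (v - u) < e \<longrightarrow> v \<in> U)"

instance
proof
  show "open (UNIV :: 'a Z2 set)" unfolding open_Z2_def by (auto intro: exI[of _ 1])
next
  fix S T :: "'a Z2 set"
  assume S: "open S" and T: "open T"
  show "open (S \<inter> T)" unfolding open_Z2_def
  proof
    fix u assume "u \<in> S \<inter> T"
    then have "u \<in> S" "u \<in> T" by auto
    from bspec[OF S[unfolded open_Z2_def] \<open>u \<in> S\<close>] obtain d
      where "d > 0" "\<forall>v. Z2_qnorm (v - u) < d \<longrightarrow> v \<in> S" by blast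
    moreover from bspec[OF T[unfolded open_Z2_def] \<open>u \<in> T\<close>] obtain e
      where "e > 0" "\<forall>v. Z2_qnorm (v - u) < e \<longrightarrow> v \<in> T" by blast
    ultimately show "\<exists>e>0. \<forall>v. Z2_qnorm (v - u) < e \<longrightarrow> v \<in> S \<inter> T"
      by (intro exI[of _ "min d e"]) auto
  qed
next
  fix K :: "'a Z2 set set"
  assume "\<forall>S\<in>K. open S"
  then show "open (\<Union>K)" unfolding open_Z2_def by (meson UnionE UnionI)
qed

end


section \<open>Bounded and strictly singular operators\<close>

definition Z2_operators :: "('k::real_normed_field Z2 \<Rightarrow> 'k Z2) set" where
  "Z2_operators = {T. Vector_Spaces.linear Z2_scale Z2_scale T
     \<and> (\<exists>C. \<forall>u. Z2_qnorm (T u) \<le> C * Z2_qnorm u)}"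

definition isomorphic_on :: "('k::real_normed_field Z2 \<Rightarrow> 'k Z2) \<Rightarrow> 'k Z2 set \<Rightarrow> bool" where
  "isomorphic_on T M \<longleftrightarrow> inj_on T M
     \<and> (\<exists>C. \<forall>u\<in>M. Z2_qnorm (T u) \<le> C * Z2_qnorm u)
     \<and> (\<exists>C. \<forall>v\<in>T ` M. Z2_qnorm (inv_into M T v) \<le> C * Z2_qnorm v)"

definition strictly_singular :: "('k::real_normed_field Z2 \<Rightarrow> 'k Z2) \<Rightarrow> bool" where
  "strictly_singular T \<longleftrightarrow>
     (\<forall>M. Z2.subspace M \<and> closed M \<and> \<not> (\<exists>B. finite B \<and> M \<subseteq> Z2.span B)
        \<longrightarrow> \<not> isomorphic_on T M)"

definition Z2_strictly_singular_operators :: "('k::real_normed_field Z2 \<Rightarrow> 'k Z2) set" where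
  "Z2_strictly_singular_operators = {T \<in> Z2_operators. strictly_singular T}"


section \<open>The symplectic form and the involution\<close>

definition Z2_finitely_supported :: "'k::real_normed_field Z2 set" where
  "Z2_finitely_supported =
     {u. finite {n. fst (Z2_coords u) n \<noteq> 0} \<and> finite {n. snd (Z2_coords u) n \<noteq> 0}}"

text \<open>The finitely supported vectors are dense, so the continuous extension is unique.\<close>

definition Z2_omega :: "'k Z2 \<Rightarrow> 'k Z2 \<Rightarrow> 'k::real_or_complex" where
  "Z2_omega = (THE w. continuous_on UNIV (\<lambda>(u, v). w u v)
     \<and> (\<forall>u\<in>Z2_finitely_supported. \<forall>v\<in>Z2_finitely_supported.
          w u v = inner2 (fst (Z2_coords u)) (snd (Z2_coords v))
                - inner2 (snd (Z2_coords u)) (fst (Z2_coords v))))"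

definition Z2_star :: "('k Z2 \<Rightarrow> 'k Z2) \<Rightarrow> 'k Z2 \<Rightarrow> 'k::real_or_complex Z2" where
  "Z2_star T = (THE T'. T' \<in> Z2_operators \<and> (\<forall>u v. Z2_omega (T u) v = Z2_omega u (T' v)))"


section \<open>Algebras with involution, quotients and norms\<close>

record ('k, 'a) star_algebra = "('k, 'a) module" +
  star :: "'a \<Rightarrow> 'a"

definition quotient_star_algebra :: "('k, 'a) star_algebra \<Rightarrow> 'a set \<Rightarrow> ('k, 'a set) star_algebra"
  where "quotient_star_algebra A I =
    \<lparr>carrier = carrier (A Quot I), mult = mult (A Quot I), one = one (A Quot I),
     zero = zero (A Quot I), add = add (A Quot I),
     smult = (\<lambda>c X. \<Union>a\<in>X. I +>\<^bsub>A\<^esub> (c \<odot>\<^bsub>A\<^esub> a)),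
     star = (\<lambda>X. \<Union>a\<in>X. I +>\<^bsub>A\<^esub> star A a)\<rparr>"

definition algebra_norm :: "('k::real_normed_field, 'a) star_algebra \<Rightarrow> ('a \<Rightarrow> real) \<Rightarrow> bool" where
  "algebra_norm A N \<longleftrightarrow>
     (\<forall>a\<in>carrier A. 0 \<le> N a) \<and>
     (\<forall>a\<in>carrier A. N a = 0 \<longleftrightarrow> a = \<zero>\<^bsub>A\<^esub>) \<and>
     (\<forall>a\<in>carrier A. \<forall>b\<in>carrier A. N (a \<oplus>\<^bsub>A\<^esub> b) \<le> N a + N b) \<and>
     (\<forall>c. \<forall>a\<in>carrier A. N (c \<odot>\<^bsub>A\<^esub> a) = norm c * N a) \<and>
     (\<forall>a\<in>carrier A. \<forall>b\<in>carrier A. N (a \<otimes>\<^bsub>A\<^esub> b) \<le> N a * N b)"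

definition star_algebra_norm :: "('k::real_normed_field, 'a) star_algebra \<Rightarrow> ('a \<Rightarrow> real) \<Rightarrow> bool"
  where "star_algebra_norm A N \<longleftrightarrow>
     algebra_norm A N \<and> (\<forall>a\<in>carrier A. N (star A a) = N a)"

definition equivalent_norms :: "('k, 'a) star_algebra \<Rightarrow> ('a \<Rightarrow> real) \<Rightarrow> ('a \<Rightarrow> real) \<Rightarrow> bool" where
  "equivalent_norms A N N' \<longleftrightarrow>
     (\<exists>C. \<forall>a\<in>carrier A. N a \<le> C * N' a) \<and> (\<exists>C. \<forall>a\<in>carrier A. N' a \<le> C * N a)"

definition Z2_operator_algebra :: "('k::real_or_complex, 'k Z2 \<Rightarrow> 'k Z2) star_algebra" where
  "Z2_operator_algebra =
    \<lparr>carrier = Z2_operators, mult = (\<circ>), one = id, zero = (\<lambda>_. 0), add = (\<lambda>S T u. S u + T u),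
     smult = (\<lambda>c T u. Z2_scale c (T u)), star = Z2_star\<rparr>"

definition Z2_quotient_algebra :: "('k::real_or_complex, ('k Z2 \<Rightarrow> 'k Z2) set) star_algebra" where
  "Z2_quotient_algebra =
     quotient_star_algebra Z2_operator_algebra Z2_strictly_singular_operators"

end

(*
Write Z2 as a twisted sum, j x = (x, 0) and q (x, y) = y.  Because the twist produces a factor
log N on sums of N disjoint blocks, q is strictly singular; quantitatively, for every bounded T the
compression q T j is compact, and an operator is strictly singular iff T j is compact.  Hence the
essential norm of T j is a submultiplicative seminorm whose kernel is the ideal of strictly singular
operators.  Symmetrising it with respect to the involution gives the smaller *-algebra norm on the
quotient; the larger one is the symmetrised quotient norm.  To separate them take the block diagonal
operator (x, y) |-> (B x, B y) with copies of a normalised Hadamard matrix of size d = 2^m.  It is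
self-adjoint and B is an isometry, so its essential size is 1.  But B carries unit vectors to vectors
with flat coordinates, on which the Kalton-Peck map is multiplication by (log d) / 2, and back; a trace
argument shows that no strictly singular perturbation removes this defect, so the quotient norm is
at least (log d) / 8.
*)

theory Submission
  imports Defs "HOL-Analysis.L2_Norm" "HOL-Library.Disjoint_Sets"
begin

section \<open>Conjugation\<close>

text \<open>Two obstacles shape the proof. The quasi-norm satisfies the triangle inequality only up
  to a constant, so operators are measured in the equivalent norm dual to the symplectic form, for
  which \<open>Zj\<close> is isometric. And compactness is expressed by coordinates: smallness on
  tails replaces the distance to compact operators, coordinatewise limits replace weak limits.
  Submultiplicativity rests on one fact: for \<open>x\<close> far out, \<open>T (Zj x)\<close> lies
  almost in the range of \<open>Zj\<close>, because its \<open>Zy\<close> part is small; there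
  \<open>S\<close> obeys its own essential bound. The passage to the adjoint rests on another: a
  pairing with \<open>Zj x\<close> sees only the \<open>Zy\<close> part of the other vector. The
  number (log d) / 2 is the logarithm of sqrt d: a flat unit vector on \<open>d\<close> coordinates
  has entries of modulus 1 / sqrt d, while the twist of a unit coordinate vector is 0. So
  \<open>Zw (B e)\<close> and the image of \<open>Zw e\<close> differ by (log d) / 2 times
  \<open>Zj (B e)\<close>. The trace enters as a double sum over the symmetric matrix: a linear
  perturbation contributes the same amount to both halves of an antisymmetric expression and
  cancels.\<close>

lemma scalar_cnj_0 [simp]: "scalar_cnj 0 = (0 :: 'k::real_or_complex)"
  using scalar_cnj_add[of 0 "0::'k"] by simp

text \<open>Off 0 the axiom \<open>scalar_cnj_norm\<close> can be solved for the conjugate, so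
  multiplicativity, isometry and involutivity below are field computations.\<close>

lemma scalar_cnj_nz: "x \<noteq> 0 \<Longrightarrow> scalar_cnj x = (norm x)\<^sup>2 *\<^sub>R inverse x" for x :: "'k::real_or_complex"
  using arg_cong[OF scalar_cnj_norm[of x], of "\<lambda>z. inverse x * z"]
  by (simp add: scaleR_conv_of_real mult.assoc[symmetric] mult.commute)

lemma scalar_cnj_mult: "scalar_cnj (x * y) = scalar_cnj x * scalar_cnj (y :: 'k::real_or_complex)"
  by (cases "x = 0"; cases "y = 0")
    (auto simp: scalar_cnj_nz norm_mult power_mult_distrib nonzero_inverse_mult_distrib)

lemma scalar_cnj_of_real [simp]: "scalar_cnj (of_real r) = (of_real r :: 'k::real_or_complex)"
  by (cases "r = 0") (auto simp: scalar_cnj_nz scaleR_conv_of_real power2_eq_square field_simps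
      simp flip: of_real_inverse of_real_mult)

lemma scalar_cnj_1 [simp]: "scalar_cnj 1 = (1 :: 'k::real_or_complex)"
  using scalar_cnj_of_real[of 1] by (simp del: scalar_cnj_of_real)

lemma norm_scalar_cnj [simp]: "norm (scalar_cnj x) = norm (x :: 'k::real_or_complex)"
  by (cases "x = 0") (auto simp: scalar_cnj_nz norm_inverse power2_eq_square)

lemma scalar_cnj_cnj [simp]: "scalar_cnj (scalar_cnj x) = (x :: 'k::real_or_complex)"
proof (cases "x = 0")
  case False
  then have "scalar_cnj x \<noteq> 0" using norm_scalar_cnj[of x] by fastforce
  then show ?thesis using False
    by (simp add: scalar_cnj_nz[of "scalar_cnj x"])
      (simp add: scalar_cnj_nz scaleR_conv_of_real field_simps)
qed simp

lemma scalar_cnj_minus [simp]: "scalar_cnj (- x) = - scalar_cnj (x :: 'k::real_or_complex)"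
  using scalar_cnj_add[of x "- x"] by (simp add: add_eq_0_iff)

lemma scalar_cnj_diff: "scalar_cnj (x - y) = scalar_cnj x - scalar_cnj (y :: 'k::real_or_complex)"
  using scalar_cnj_add[of x "- y"] by simp

lemma bounded_linear_scalar_cnj: "bounded_linear (scalar_cnj :: 'k::real_or_complex \<Rightarrow> 'k)"
  by (rule bounded_linear_intro[of _ 1])
    (auto simp: scalar_cnj_add scaleR_conv_of_real scalar_cnj_mult)

section \<open>Square-summable sequences\<close>

lemma ell2_0 [simp]: "(\<lambda>_. 0) \<in> ell2"
  by (simp add: ell2_def)

lemma norm2_0 [simp]: "norm2 (\<lambda>_. 0) = 0"
  by (simp add: norm2_def)

lemma norm2_L2_set:
  assumes "x \<in> ell2" "finite A"
  shows "L2_set (\<lambda>n. norm (x n)) A \<le> norm2 x"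
  using assms unfolding norm2_def L2_set_def ell2_def
  by (intro real_sqrt_le_mono sum_le_suminf) auto

lemma norm2_nonneg: "x \<in> ell2 \<Longrightarrow> 0 \<le> norm2 x"
  by (simp add: norm2_def ell2_def suminf_nonneg)

lemma norm2_squared: "x \<in> ell2 \<Longrightarrow> (norm2 x)\<^sup>2 = (\<Sum>n. (norm (x n))\<^sup>2)"
  by (simp add: norm2_def ell2_def suminf_nonneg)

lemma norm_le_norm2: "x \<in> ell2 \<Longrightarrow> norm (x n) \<le> norm2 x"
  using norm2_L2_set[of x "{n}"] by simp

text \<open>Estimates are made on finite sections, where \<open>L2_set\<close> offers Minkowski and
  Cauchy-Schwarz; a bound uniform in the section passes to the series.\<close>

lemma
  assumes "\<And>n. L2_set (\<lambda>i. norm (x i)) {..<n} \<le> K"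
  shows ell2_if_bounded: "x \<in> ell2" and norm2_le: "norm2 x \<le> K"
proof -
  have K: "0 \<le> K" using assms[of 0] by simp
  have b: "(\<Sum>i<n. (norm (x i))\<^sup>2) \<le> K\<^sup>2" for n
    using power_mono[OF assms[of n], of 2] by (simp add: L2_set_def sum_nonneg)
  then have s: "summable (\<lambda>n. (norm (x n))\<^sup>2)"
    by (intro summableI_nonneg_bounded) auto
  then show "x \<in> ell2" by (simp add: ell2_def)
  have "(\<Sum>n. (norm (x n))\<^sup>2) \<le> K\<^sup>2" using s b by (intro suminf_le_const) auto
  then show "norm2 x \<le> K" unfolding norm2_def using K by (simp add: real_le_lsqrt)
qed

lemma norm2_mono:
  assumes "y \<in> ell2" "\<And>n. norm (x n) \<le> norm (y n)"
  shows "norm2 x \<le> norm2 y"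
proof (rule norm2_le)
  fix n
  have "L2_set (\<lambda>i. norm (x i)) {..<n} \<le> L2_set (\<lambda>i. norm (y i)) {..<n}"
    by (intro L2_set_mono assms(2)) auto
  also have "\<dots> \<le> norm2 y" by (intro norm2_L2_set assms(1)) auto
  finally show "L2_set (\<lambda>i. norm (x i)) {..<n} \<le> norm2 y" .
qed

lemma norm2_triangle:
  assumes "x \<in> ell2" "y \<in> ell2"
  shows "norm2 (\<lambda>n. x n + y n) \<le> norm2 x + norm2 y"
proof (rule norm2_le)
  fix n
  have "L2_set (\<lambda>i. norm (x i + y i)) {..<n} \<le> L2_set (\<lambda>i. norm (x i) + norm (y i)) {..<n}"
    by (intro L2_set_mono norm_triangle_ineq) auto
  also have "\<dots> \<le> norm2 x + norm2 y"
    by (intro order_trans[OF L2_set_triangle_ineq] add_mono norm2_L2_set assms) auto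
  finally show "L2_set (\<lambda>i. norm (x i + y i)) {..<n} \<le> norm2 x + norm2 y" .
qed

lemma norm2_eq_0_iff: "x \<in> ell2 \<Longrightarrow> norm2 x = 0 \<longleftrightarrow> (\<forall>n. x n = 0)"
  using norm2_pos by (fastforce simp: norm2_def)

lemma ell2_uminus: "x \<in> ell2 \<Longrightarrow> (\<lambda>n. - x n) \<in> ell2"
  by (simp add: ell2_def)

lemma norm2_uminus: "norm2 (\<lambda>n. - x n) = norm2 x"
  by (simp add: norm2_def)

lemma ell2_diff: "x \<in> ell2 \<Longrightarrow> y \<in> ell2 \<Longrightarrow> (\<lambda>n. x n - y n) \<in> ell2"
  using ell2_add[OF _ ell2_uminus, of x y] by simp

lemma norm2_triangle_diff:
  "x \<in> ell2 \<Longrightarrow> y \<in> ell2 \<Longrightarrow> norm2 (\<lambda>n. x n - y n) \<le> norm2 x + norm2 y"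
  using norm2_triangle[OF _ ell2_uminus, of x y] by (simp add: norm2_uminus)

lemma ell2_sum: "(\<And>i. i \<in> F \<Longrightarrow> x i \<in> ell2) \<Longrightarrow> (\<lambda>n. \<Sum>i\<in>F. x i n) \<in> ell2"
  by (induction F rule: infinite_finite_induct) (auto intro: ell2_add)

lemma
  assumes "x \<in> ell2" "y \<in> ell2"
  shows summable_norm_mult_ell2: "summable (\<lambda>n. norm (x n) * norm (y n))"
    and suminf_norm_mult_ell2: "(\<Sum>n. norm (x n) * norm (y n)) \<le> norm2 x * norm2 y"
proof -
  have b: "(\<Sum>i<n. norm (x i) * norm (y i)) \<le> norm2 x * norm2 y" for n
  proof -
    have "(\<Sum>i<n. norm (x i) * norm (y i))
        \<le> L2_set (\<lambda>i. norm (x i)) {..<n} * L2_set (\<lambda>i. norm (y i)) {..<n}"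
      using L2_set_mult_ineq[of "\<lambda>i. norm (x i)" "\<lambda>i. norm (y i)" "{..<n}"] by simp
    also have "\<dots> \<le> norm2 x * norm2 y"
      by (intro mult_mono norm2_L2_set norm2_nonneg assms) (auto simp: L2_set_nonneg)
    finally show ?thesis .
  qed
  then show s: "summable (\<lambda>n. norm (x n) * norm (y n))"
    by (intro summableI_nonneg_bounded) auto
  show "(\<Sum>n. norm (x n) * norm (y n)) \<le> norm2 x * norm2 y"
    using s b by (intro suminf_le_const) auto
qed

definition restr :: "nat set \<Rightarrow> (nat \<Rightarrow> 'a::zero) \<Rightarrow> nat \<Rightarrow> 'a" where
  "restr A x n = (if n \<in> A then x n else 0)"

lemma ell2_restr: "x \<in> ell2 \<Longrightarrow> restr A x \<in> ell2"
  by (erule ell2_bounded) (simp add: restr_def)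

lemma norm2_restr_le: "x \<in> ell2 \<Longrightarrow> norm2 (restr A x) \<le> norm2 x"
  by (erule norm2_mono) (simp add: restr_def)

lemma ell2_finite_support:
  assumes "finite {n. x n \<noteq> 0}"
  shows "x \<in> ell2"
proof -
  have "(\<lambda>n. (norm (x n))\<^sup>2) sums (\<Sum>n\<in>{n. x n \<noteq> 0}. (norm (x n))\<^sup>2)"
    by (rule sums_finite[OF assms]) auto
  then show ?thesis by (auto simp: ell2_def sums_iff)
qed

lemma norm2_tail_tendsto:
  assumes "x \<in> ell2"
  shows "(\<lambda>n. norm2 (restr {n..} x)) \<longlonglongrightarrow> 0"
proof -
  let ?f = "\<lambda>n. (norm (x n))\<^sup>2"
  have s: "summable ?f" using assms by (simp add: ell2_def)
  have "(\<lambda>n. sqrt (\<Sum>i. ?f (i + n))) \<longlonglongrightarrow> sqrt 0"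
  proof (intro tendsto_real_sqrt)
    show "(\<lambda>n. \<Sum>i. ?f (i + n)) \<longlonglongrightarrow> 0"
      using suminf_exist_split[OF _ s] by (auto simp: LIMSEQ_iff)
  qed
  moreover have "norm2 (restr {n..} x) = sqrt (\<Sum>i. ?f (i + n))" for n
  proof -
    have s': "summable (\<lambda>k. (norm (restr {n..} x k))\<^sup>2)"
      using ell2_restr[OF assms] by (simp add: ell2_def)
    have "(\<Sum>k. (norm (restr {n..} x k))\<^sup>2) = (\<Sum>i. (norm (restr {n..} x (i + n)))\<^sup>2)
        + (\<Sum>i<n. (norm (restr {n..} x i))\<^sup>2)"
      by (rule suminf_split_initial_segment[OF s'])
    also have "\<dots> = (\<Sum>i. ?f (i + n))" by (simp add: restr_def)
    finally show ?thesis by (simp add: norm2_def)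
  qed
  ultimately show ?thesis by simp
qed

text \<open>At each coordinate at most one summand is nonzero, so the squares already add up before
  summation over \<open>n\<close>.\<close>

lemma norm2_disjoint_sum:
  fixes x :: "'i \<Rightarrow> nat \<Rightarrow> 'k::real_normed_field"
  assumes F: "finite F" and x: "\<And>i. i \<in> F \<Longrightarrow> x i \<in> ell2"
    and A: "disjoint_family_on A F" and supp: "\<And>i n. i \<in> F \<Longrightarrow> n \<notin> A i \<Longrightarrow> x i n = 0"
  shows "(norm2 (\<lambda>n. \<Sum>i\<in>F. x i n))\<^sup>2 = (\<Sum>i\<in>F. (norm2 (x i))\<^sup>2)"
proof -
  have *: "(norm (\<Sum>i\<in>F. x i n))\<^sup>2 = (\<Sum>i\<in>F. (norm (x i n))\<^sup>2)" for n
  proof (cases "\<exists>i\<in>F. n \<in> A i")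
    case True
    then obtain i where i: "i \<in> F" "n \<in> A i" by auto
    have "x j n = 0" if "j \<in> F - {i}" for j
      using A i that supp[of j n] by (auto simp: disjoint_family_on_def)
    then show ?thesis using F i by (simp add: sum.remove)
  qed (auto simp: supp)
  have "(\<Sum>n. \<Sum>i\<in>F. (norm (x i n))\<^sup>2) = (\<Sum>i\<in>F. \<Sum>n. (norm (x i n))\<^sup>2)"
    using x by (intro suminf_sum) (auto simp: ell2_def)
  moreover have "(\<lambda>n. \<Sum>i\<in>F. x i n) \<in> ell2" by (rule ell2_sum[OF x])
  ultimately show ?thesis using x by (simp add: norm2_squared *)
qed


section \<open>Vectors of the Kalton-Peck space\<close>

definition Zx :: "'k::real_normed_field Z2 \<Rightarrow> nat \<Rightarrow> 'k" where "Zx u = fst (Z2_coords u)"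
definition Zy :: "'k::real_normed_field Z2 \<Rightarrow> nat \<Rightarrow> 'k" where "Zy u = snd (Z2_coords u)"
text \<open>The first component with the twist removed; it is what the quasi-norm measures next to
  \<open>Zy\<close>. It is homogeneous but not additive, so sums have to be estimated through the
  defect of \<open>Omega\<close>.\<close>

definition Zd :: "'k::real_normed_field Z2 \<Rightarrow> nat \<Rightarrow> 'k" where
  "Zd u n = Zx u n - Omega (Zy u) n"

lemma Z2_eqI: "(\<And>n. Zx u n = Zx v n) \<Longrightarrow> (\<And>n. Zy u n = Zy v n) \<Longrightarrow> u = v"
  by (simp add: Zx_def Zy_def Z2_coords_inject[symmetric] prod_eq_iff ext)

lemma Zy_ell2: "Zy u \<in> ell2" and Zd_ell2: "Zd u \<in> ell2"
proof -
  have "(Zx u, Zy u) \<in> Z2_carrier" using Z2_coords[of u] by (simp add: Zx_def Zy_def)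
  then show "Zy u \<in> ell2" "Zd u \<in> ell2" by (auto simp: Z2_carrier_def Zd_def[abs_def])
qed

lemma Zx_eq: "Zx u n = Zd u n + Omega (Zy u) n"
  by (simp add: Zd_def)

lemma Zx_0 [simp]: "Zx 0 n = 0" and Zy_0 [simp]: "Zy 0 n = 0"
  by (auto simp: Zx_def Zy_def zero_Z2.rep_eq)

lemma Zx_add [simp]: "Zx (u + v) n = Zx u n + Zx v n"
  and Zy_add [simp]: "Zy (u + v) n = Zy u n + Zy v n"
  by (auto simp: Zx_def Zy_def plus_Z2.rep_eq split: prod.splits)

lemma Zx_minus [simp]: "Zx (- u) n = - Zx u n" and Zy_minus [simp]: "Zy (- u) n = - Zy u n"
  by (auto simp: Zx_def Zy_def uminus_Z2.rep_eq split: prod.splits)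

lemma Zx_diff [simp]: "Zx (u - v) n = Zx u n - Zx v n"
  and Zy_diff [simp]: "Zy (u - v) n = Zy u n - Zy v n"
  using Zx_add[of u "- v" n] Zy_add[of u "- v" n] by auto

lemma Zx_scale [simp]: "Zx (Z2_scale c u) n = c * Zx u n"
  and Zy_scale [simp]: "Zy (Z2_scale c u) n = c * Zy u n"
  by (auto simp: Zx_def Zy_def Z2_scale.rep_eq split: prod.splits)

lemma Zx_sum [simp]: "Zx (\<Sum>i\<in>F. u i) n = (\<Sum>i\<in>F. Zx (u i) n)"
  and Zy_sum [simp]: "Zy (\<Sum>i\<in>F. u i) n = (\<Sum>i\<in>F. Zy (u i) n)"
  by (induction F rule: infinite_finite_induct; simp)+

lemma Z2_qnorm_eq: "Z2_qnorm u = norm2 (Zd u) + norm2 (Zy u)"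
  by (simp add: Z2_qnorm_def Zd_def[abs_def] Zx_def Zy_def case_prod_unfold Let_def)

lemma Omega_0 [simp]: "Omega (\<lambda>_. 0) = (\<lambda>_. 0)"
  by (auto simp: Omega_def)

lemma Omega_eq_0: "x n = 0 \<Longrightarrow> Omega x n = 0"
  by (simp add: Omega_def)

lemma Zd_scale: "Zd (Z2_scale c u) = (\<lambda>n. c * Zd u n)"
proof -
  have "Zy (Z2_scale c u) = (\<lambda>n. c * Zy u n)" by auto
  then show ?thesis by (auto simp: Zd_def Omega_scale[OF Zy_ell2] algebra_simps)
qed

lemma Z2_qnorm_scale: "Z2_qnorm (Z2_scale c u) = norm c * Z2_qnorm u"
proof -
  have "Zy (Z2_scale c u) = (\<lambda>n. c * Zy u n)" by auto
  then show ?thesis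
    by (simp add: Z2_qnorm_eq Zd_scale norm2_scale Zd_ell2 Zy_ell2 algebra_simps)
qed

lemma Z2_qnorm_nonneg: "0 \<le> Z2_qnorm u"
  by (simp add: Z2_qnorm_eq norm2_nonneg Zd_ell2 Zy_ell2)

lemma Z2_qnorm_0 [simp]: "Z2_qnorm 0 = 0"
  using Z2_qnorm_scale[of 0 0] by simp

lemma Z2_qnorm_eq_0_iff [simp]: "Z2_qnorm u = 0 \<longleftrightarrow> u = 0"
proof
  assume "Z2_qnorm u = 0"
  then have "norm2 (Zd u) = 0" "norm2 (Zy u) = 0"
    using norm2_nonneg[OF Zd_ell2, of u] norm2_nonneg[OF Zy_ell2, of u]
    by (auto simp: Z2_qnorm_eq add_nonneg_eq_0_iff)
  then have "Zd u n = 0" "Zy u n = 0" for n by (auto simp: norm2_eq_0_iff Zd_ell2 Zy_ell2)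
  then show "u = 0" by (intro Z2_eqI) (auto simp: Zx_eq[of u] Omega_eq_0)
qed simp

lemma Z2_qnorm_minus [simp]: "Z2_qnorm (- u) = Z2_qnorm u"
  using Z2_qnorm_scale[of "-1" u] by simp

text \<open>\<open>Zj\<close> is the linear embedding of ell2 onto the kernel of the quotient map
  \<open>Zy\<close>; \<open>Zw\<close>, below, is the homogeneous but nonlinear section of that map
  with \<open>Zd (Zw y) = 0\<close>.\<close>

definition Zj :: "(nat \<Rightarrow> 'k::real_normed_field) \<Rightarrow> 'k Z2" where "Zj x = Z2_of (x, \<lambda>_. 0)"
definition Zw :: "(nat \<Rightarrow> 'k::real_normed_field) \<Rightarrow> 'k Z2" where "Zw y = Z2_of (Omega y, y)"

lemma Zj_coords [simp]:
  assumes "x \<in> ell2"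
  shows "Zx (Zj x) = x" "Zy (Zj x) = (\<lambda>_. 0)" "Zd (Zj x) = x"
  using assms
  by (auto simp: Zj_def Zx_def Zy_def Zd_def[abs_def] Z2_of_inverse Z2_carrier_def)

lemma Zw_coords [simp]:
  assumes "y \<in> ell2"
  shows "Zx (Zw y) = Omega y" "Zy (Zw y) = y" "Zd (Zw y) = (\<lambda>_. 0)"
  using assms
  by (auto simp: Zw_def Zx_def Zy_def Zd_def[abs_def] Z2_of_inverse Z2_carrier_def)

lemma Z2_decompose: "u = Zj (Zd u) + Zw (Zy u)"
  by (rule Z2_eqI) (auto simp: Zd_ell2 Zy_ell2 Zx_eq[of u])

lemma Z2_qnorm_Zj: "x \<in> ell2 \<Longrightarrow> Z2_qnorm (Zj x) = norm2 x"
  and Z2_qnorm_Zw: "y \<in> ell2 \<Longrightarrow> Z2_qnorm (Zw y) = norm2 y"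
  by (auto simp: Z2_qnorm_eq)

lemma Zj_scale: "x \<in> ell2 \<Longrightarrow> Zj (\<lambda>n. c * x n) = Z2_scale c (Zj x)"
  by (rule Z2_eqI; simp add: ell2_scale)

lemma Zj_sum:
  "(\<And>i. i \<in> F \<Longrightarrow> x i \<in> ell2) \<Longrightarrow> Zj (\<lambda>n. \<Sum>i\<in>F. x i n) = (\<Sum>i\<in>F. Zj (x i))"
  by (rule Z2_eqI; simp add: ell2_sum)

definition Zunit :: "nat \<Rightarrow> nat \<Rightarrow> 'k::real_normed_field" where
  "Zunit n k = (if k = n then 1 else 0)"

lemma Zunit_ell2 [simp]: "Zunit n \<in> ell2"
  by (rule ell2_finite_support) (simp add: Zunit_def)

lemma norm2_Zunit [simp]: "norm2 (Zunit n :: nat \<Rightarrow> 'k::real_normed_field) = 1"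
proof -
  have "(norm (Zunit n k :: 'k))\<^sup>2 = (if k = n then 1 else 0)" for k by (simp add: Zunit_def)
  moreover have "(\<lambda>k. if k = n then 1 else 0) sums (1::real)"
    using sums_single[of n "\<lambda>_. 1::real"] .
  ultimately show ?thesis by (simp add: norm2_def sums_iff)
qed

text \<open>The norm and the only nonzero modulus are both 1, so the logarithm vanishes. Hence
  \<open>Zw (Zunit n)\<close> is a plain coordinate vector and, with \<open>Zj (Zunit n)\<close>,
  can serve as a basis.\<close>

lemma Omega_Zunit [simp]: "Omega (Zunit n) k = 0"
  by (simp add: Omega_def) (simp add: Zunit_def)


section \<open>The symplectic form\<close>

lemma mult_abs_ln_diff_le:
  fixes s t :: real
  assumes "s > 0" "t > 0"
  shows "s * t * \<bar>ln s - ln t\<bar> \<le> s\<^sup>2 + t\<^sup>2"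
proof -
  have *: "s * t * (ln t - ln s) \<le> t\<^sup>2" if "s > 0" "t > 0" for s t :: real
  proof -
    have "ln t - ln s \<le> t / s" using ln_le_minus_one[of "t / s"] that by (simp add: ln_div)
    then have "s * t * (ln t - ln s) \<le> s * t * (t / s)" using that by (intro mult_left_mono) auto
    then show ?thesis using that by (simp add: power2_eq_square)
  qed
  show ?thesis
    using *[OF assms] *[OF assms(2,1)] assms
    by (auto simp: abs_if mult.commute[of t s] algebra_simps intro: order_trans)
qed

text \<open>In the difference the two logarithms combine to that of the ratio of the normalised
  moduli, however small each modulus is; \<open>mult_abs_ln_diff_le\<close> then bounds the term by
  summable squares.\<close>

lemma Omega_duality_term:
  fixes y z :: "nat \<Rightarrow> 'k::real_or_complex"
  assumes y: "y \<in> ell2" and z: "z \<in> ell2"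
  shows "norm (Omega y n * scalar_cnj (z n) - y n * scalar_cnj (Omega z n))
    \<le> norm2 y * norm2 z * ((norm (y n) / norm2 y)\<^sup>2 + (norm (z n) / norm2 z)\<^sup>2)"
proof (cases "y n = 0 \<or> z n = 0")
  case True
  then show ?thesis using y z by (auto simp: Omega_def norm2_nonneg)
next
  case False
  define s t where "s = norm (y n) / norm2 y" and "t = norm (z n) / norm2 z"
  have p: "norm2 y > 0" "norm2 z > 0" using False norm2_pos y z by auto
  then have st: "s > 0" "t > 0" using False by (auto simp: s_def t_def)
  have "Omega y n = y n * of_real (- ln s)" "Omega z n = z n * of_real (- ln t)"
    using False p by (simp_all add: Omega_def s_def t_def ln_div)
  then have "Omega y n * scalar_cnj (z n) - y n * scalar_cnj (Omega z n)
      = y n * scalar_cnj (z n) * of_real (ln t - ln s)"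
    by (simp add: scalar_cnj_mult algebra_simps)
  then have "norm (Omega y n * scalar_cnj (z n) - y n * scalar_cnj (Omega z n))
      = norm2 y * norm2 z * (s * t * \<bar>ln s - ln t\<bar>)"
    using p by (simp only: norm_mult norm_of_real) (simp add: s_def t_def abs_minus_commute)
  also have "\<dots> \<le> norm2 y * norm2 z * (s\<^sup>2 + t\<^sup>2)"
    using p mult_abs_ln_diff_le[OF st] by (intro mult_left_mono) auto
  finally show ?thesis by (simp add: s_def t_def)
qed

lemma
  fixes y z :: "nat \<Rightarrow> 'k::{real_or_complex,banach}"
  assumes y: "y \<in> ell2" and z: "z \<in> ell2"
  shows Omega_duality_summable:
      "summable (\<lambda>n. norm (Omega y n * scalar_cnj (z n) - y n * scalar_cnj (Omega z n)))"
    and Omega_duality: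
      "(\<Sum>n. norm (Omega y n * scalar_cnj (z n) - y n * scalar_cnj (Omega z n)))
        \<le> 2 * norm2 y * norm2 z"
proof -
  let ?g = "\<lambda>n. norm2 y * norm2 z * ((norm (y n))\<^sup>2 / (norm2 y)\<^sup>2 + (norm (z n))\<^sup>2 / (norm2 z)\<^sup>2)"
  have sy: "(\<lambda>n. (norm (y n))\<^sup>2) sums (norm2 y)\<^sup>2" and sz: "(\<lambda>n. (norm (z n))\<^sup>2) sums (norm2 z)\<^sup>2"
    using y z by (auto simp: norm2_squared ell2_def summable_sums)
  have g: "?g sums (norm2 y * norm2 z
      * ((norm2 y)\<^sup>2 / (norm2 y)\<^sup>2 + (norm2 z)\<^sup>2 / (norm2 z)\<^sup>2))"
    by (intro sums_mult sums_add sums_divide sy sz)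
  have le: "norm (Omega y n * scalar_cnj (z n) - y n * scalar_cnj (Omega z n)) \<le> ?g n" for n
    using Omega_duality_term[OF y z, of n] by (simp add: power_divide)
  show s: "summable (\<lambda>n. norm (Omega y n * scalar_cnj (z n) - y n * scalar_cnj (Omega z n)))"
    by (rule summable_comparison_test'[OF sums_summable[OF g], of 0]) (use le in simp)
  have "(\<Sum>n. norm (Omega y n * scalar_cnj (z n) - y n * scalar_cnj (Omega z n))) \<le> suminf ?g"
    by (rule suminf_le[OF le s sums_summable[OF g]])
  also have "\<dots> = norm2 y * norm2 z * ((norm2 y)\<^sup>2 / (norm2 y)\<^sup>2 + (norm2 z)\<^sup>2 / (norm2 z)\<^sup>2)"
    using sums_unique[OF g] by simp
  also have "\<dots> \<le> 2 * norm2 y * norm2 z"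
    by (cases "norm2 y = 0"; cases "norm2 z = 0") auto
  finally show "(\<Sum>n. norm (Omega y n * scalar_cnj (z n) - y n * scalar_cnj (Omega z n)))
        \<le> 2 * norm2 y * norm2 z" .
qed

text \<open>The products are subtracted coordinate by coordinate before summation, because outside
  the finitely supported vectors the two series of the form may diverge separately.\<close>

definition Zterm :: "'k Z2 \<Rightarrow> 'k Z2 \<Rightarrow> nat \<Rightarrow> 'k::real_or_complex" where
  "Zterm u v n = Zx u n * scalar_cnj (Zy v n) - Zy u n * scalar_cnj (Zx v n)"

definition Zform :: "'k Z2 \<Rightarrow> 'k Z2 \<Rightarrow> 'k::real_or_complex" where
  "Zform u v = (\<Sum>n. Zterm u v n)"

lemma
  fixes u v :: "'k::{real_or_complex,banach} Z2"
  shows Zterm_norm_summable: "summable (\<lambda>n. norm (Zterm u v n))"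
    and Zterm_norm_suminf: "(\<Sum>n. norm (Zterm u v n)) \<le> norm2 (Zd u) * norm2 (Zy v)
      + norm2 (Zy u) * norm2 (Zd v) + 2 * norm2 (Zy u) * norm2 (Zy v)"
proof -
  let ?c = "\<lambda>n. norm (Omega (Zy u) n * scalar_cnj (Zy v n) - Zy u n * scalar_cnj (Omega (Zy v) n))"
  let ?g = "\<lambda>n. norm (Zd u n) * norm (Zy v n) + norm (Zy u n) * norm (Zd v n) + ?c n"
  note s = summable_norm_mult_ell2[OF Zd_ell2 Zy_ell2, of u v]
    summable_norm_mult_ell2[OF Zy_ell2 Zd_ell2, of u v]
    Omega_duality_summable[OF Zy_ell2 Zy_ell2, of u v]
  have g: "summable ?g" by (intro summable_add s)
  have le: "norm (Zterm u v n) \<le> ?g n" for n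
  proof -
    have "Zterm u v n = Zd u n * scalar_cnj (Zy v n) + - (Zy u n * scalar_cnj (Zd v n))
        + (Omega (Zy u) n * scalar_cnj (Zy v n) - Zy u n * scalar_cnj (Omega (Zy v) n))"
      by (simp add: Zterm_def Zx_eq scalar_cnj_add algebra_simps)
    also have "norm \<dots> \<le> norm (Zd u n * scalar_cnj (Zy v n)) + norm (- (Zy u n * scalar_cnj (Zd v n)))
        + ?c n" by (intro norm_triangle_mono order_refl)
    finally show ?thesis by (simp add: norm_mult)
  qed
  show s': "summable (\<lambda>n. norm (Zterm u v n))"
    by (rule summable_comparison_test'[OF g, of 0]) (use le in simp)
  have "(\<Sum>n. norm (Zterm u v n)) \<le> suminf ?g" by (rule suminf_le[OF le s' g])
  also have "\<dots> = (\<Sum>n. norm (Zd u n) * norm (Zy v n)) + (\<Sum>n. norm (Zy u n) * norm (Zd v n))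
      + suminf ?c"
    by (simp add: suminf_add[symmetric] s summable_add)
  also have "\<dots> \<le> norm2 (Zd u) * norm2 (Zy v) + norm2 (Zy u) * norm2 (Zd v)
      + 2 * norm2 (Zy u) * norm2 (Zy v)"
    by (intro add_mono suminf_norm_mult_ell2 Omega_duality Zd_ell2 Zy_ell2)
  finally show "(\<Sum>n. norm (Zterm u v n)) \<le> norm2 (Zd u) * norm2 (Zy v)
      + norm2 (Zy u) * norm2 (Zd v) + 2 * norm2 (Zy u) * norm2 (Zy v)" .
qed

lemma Zform_sums: "Zterm u v sums Zform u (v :: 'k::{real_or_complex,banach} Z2)"
  using summable_norm_cancel[OF Zterm_norm_summable] by (auto simp: Zform_def summable_sums)

lemma Zform_eqI: "Zterm u v sums z \<Longrightarrow> Zform u v = z"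
  by (simp add: Zform_def sums_iff)

lemma norm_Zform_le_norm2:
  fixes u v :: "'k::{real_or_complex,banach} Z2"
  shows "norm (Zform u v) \<le> norm2 (Zd u) * norm2 (Zy v)
      + norm2 (Zy u) * norm2 (Zd v) + 2 * norm2 (Zy u) * norm2 (Zy v)"
  using order_trans[OF summable_norm[OF Zterm_norm_summable] Zterm_norm_suminf]
  by (simp add: Zform_def)

lemma norm_Zform_le_qnorm:
  fixes u v :: "'k::{real_or_complex,banach} Z2"
  shows "norm (Zform u v) \<le> 2 * Z2_qnorm u * Z2_qnorm v"
proof -
  have "0 \<le> norm2 (Zd u) * norm2 (Zd v)" "0 \<le> norm2 (Zd u) * norm2 (Zy v)"
    "0 \<le> norm2 (Zy u) * norm2 (Zd v)"
    by (auto intro!: mult_nonneg_nonneg norm2_nonneg Zd_ell2 Zy_ell2)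
  then show ?thesis using norm_Zform_le_norm2[of u v] by (simp add: Z2_qnorm_eq algebra_simps)
qed

lemma Zform_add_left: "Zform (u + u') v = Zform u v + Zform u' (v :: 'k::{real_or_complex,banach} Z2)"
proof (rule Zform_eqI)
  have "Zterm (u + u') v = (\<lambda>n. Zterm u v n + Zterm u' v n)"
    by (auto simp: Zterm_def algebra_simps)
  then show "Zterm (u + u') v sums (Zform u v + Zform u' v)"
    by (simp add: sums_add Zform_sums)
qed

lemma Zform_scale_left: "Zform (Z2_scale c u) v = c * Zform u (v :: 'k::{real_or_complex,banach} Z2)"
proof (rule Zform_eqI)
  have "Zterm (Z2_scale c u) v = (\<lambda>n. c * Zterm u v n)"
    by (auto simp: Zterm_def algebra_simps)
  then show "Zterm (Z2_scale c u) v sums (c * Zform u v)"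
    by (simp add: sums_mult Zform_sums)
qed

lemma Zform_skew: "Zform v u = - scalar_cnj (Zform u (v :: 'k::{real_or_complex,banach} Z2))"
proof (rule Zform_eqI)
  have "Zterm v u = (\<lambda>n. - scalar_cnj (Zterm u v n))"
    by (auto simp: Zterm_def scalar_cnj_mult scalar_cnj_diff mult.commute)
  then show "Zterm v u sums (- scalar_cnj (Zform u v))"
    by (simp add: sums_minus bounded_linear.sums[OF bounded_linear_scalar_cnj] Zform_sums)
qed

lemma norm_Zform_commute: "norm (Zform v u) = norm (Zform u (v :: 'k::{real_or_complex,banach} Z2))"
  by (simp add: Zform_skew[of v u])

context
  fixes u u' v v' :: "'k::{real_or_complex,banach} Z2"
begin

lemma Zform_add_right: "Zform u (v + v') = Zform u v + Zform u v'"
  by (simp add: Zform_skew[of u] Zform_add_left scalar_cnj_add)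

lemma Zform_scale_right: "Zform u (Z2_scale c v) = scalar_cnj c * Zform u v"
  by (simp add: Zform_skew[of u] Zform_scale_left scalar_cnj_mult)

lemma Zform_minus_left [simp]: "Zform (- u) v = - Zform u v"
  using Zform_scale_left[of "-1" u v] by simp

lemma Zform_minus_right [simp]: "Zform u (- v) = - Zform u v"
  using Zform_scale_right[of "-1"] by simp

lemma Zform_0_left [simp]: "Zform 0 v = 0"
  using Zform_scale_left[of 0 0 v] by simp

lemma Zform_0_right [simp]: "Zform u 0 = 0"
  using Zform_scale_right[of 0] by simp

end

lemma Zform_diff_left: "Zform (u - u') v = Zform u v - Zform u' (v :: 'k::{real_or_complex,banach} Z2)"
  using Zform_add_left[of u "- u'" v] by simp

lemma Zform_diff_right: "Zform u (v - v') = Zform u v - Zform u (v' :: 'k::{real_or_complex,banach} Z2)"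
  using Zform_add_right[of u v "- v'"] by simp

lemma Zform_sum_left:
  "Zform (\<Sum>i\<in>F. u i) v = (\<Sum>i\<in>F. Zform (u i) (v :: 'k::{real_or_complex,banach} Z2))"
  by (induction F rule: infinite_finite_induct) (auto simp: Zform_add_left)

lemma Zform_sum_right:
  "Zform v (\<Sum>i\<in>F. u i) = (\<Sum>i\<in>F. Zform v (u i :: 'k::{real_or_complex,banach} Z2))"
  by (induction F rule: infinite_finite_induct) (auto simp: Zform_add_right)

lemma Zform_Zj_left:
  fixes v :: "'k::{real_or_complex,banach} Z2"
  assumes "x \<in> ell2"
  shows "Zform (Zj x) v = (\<Sum>n. x n * scalar_cnj (Zy v n))"
  using assms by (simp add: Zform_def Zterm_def)

text \<open>The form vanishes on the range of \<open>Zj\<close>, so only \<open>Zy v\<close> is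
  seen. Through this bound smallness of \<open>Zy (T v)\<close> will become smallness of
  \<open>Z2_star T (Zj x)\<close>.\<close>

lemma norm_Zform_Zj_le:
  fixes v :: "'k::{real_or_complex,banach} Z2"
  assumes "x \<in> ell2"
  shows "norm (Zform (Zj x) v) \<le> norm2 x * norm2 (Zy v)"
  using norm_Zform_le_norm2[of "Zj x" v] assms by simp

lemma Zform_Zj_unit: "Zform (Zj (Zunit n)) v = scalar_cnj (Zy (v :: 'k::{real_or_complex,banach} Z2) n)"
proof (rule Zform_eqI)
  have "Zterm (Zj (Zunit n)) v = (\<lambda>k. if k = n then scalar_cnj (Zy v k) else 0)"
    by (auto simp: Zterm_def Zunit_def[of n])
  then show "Zterm (Zj (Zunit n)) v sums scalar_cnj (Zy v n)"
    using sums_single[of n "\<lambda>k. scalar_cnj (Zy v k)"] by simp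
qed

lemma Zform_Zw_unit: "Zform (Zw (Zunit n)) v = - scalar_cnj (Zx (v :: 'k::{real_or_complex,banach} Z2) n)"
proof (rule Zform_eqI)
  have "Zterm (Zw (Zunit n)) v = (\<lambda>k. if k = n then - scalar_cnj (Zx v k) else 0)"
    by (auto simp: Zterm_def Zunit_def)
  then show "Zterm (Zw (Zunit n)) v sums (- scalar_cnj (Zx v n))"
    using sums_single[of n "\<lambda>k. - scalar_cnj (Zx v k)"] by simp
qed

lemma Zform_nondegenerate:
  fixes v v' :: "'k::{real_or_complex,banach} Z2"
  assumes "\<And>u. Zform u v = Zform u v'"
  shows "v = v'"
proof (rule Z2_eqI)
  show "Zy v n = Zy v' n" for n
    using assms[of "Zj (Zunit n)"] by (metis Zform_Zj_unit scalar_cnj_cnj)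
  show "Zx v n = Zx v' n" for n
    using assms[of "Zw (Zunit n)"] by (metis Zform_Zw_unit scalar_cnj_cnj neg_equal_iff_equal)
qed


section \<open>An equivalent norm\<close>

text \<open>A dual norm, tested on the quasi-norm ball. It satisfies the triangle inequality with
  constant 1, which the subadditivity of an algebra norm requires.\<close>

definition Znorm :: "'k::{real_or_complex,banach} Z2 \<Rightarrow> real" where
  "Znorm u = (SUP v\<in>{v. Z2_qnorm v \<le> 1}. norm (Zform u v))"

lemma Znorm_bdd:
  fixes u :: "'a::{real_or_complex,banach} Z2"
  shows "bdd_above ((\<lambda>v. norm (Zform u v)) ` {v. Z2_qnorm v \<le> 1})"
proof (rule bdd_aboveI2)
  fix v :: "'a Z2" assume "v \<in> {v. Z2_qnorm v \<le> 1}"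
  then have "2 * Z2_qnorm u * Z2_qnorm v \<le> 2 * Z2_qnorm u * 1"
    by (intro mult_left_mono) (auto simp: Z2_qnorm_nonneg)
  then show "norm (Zform u v) \<le> 2 * Z2_qnorm u"
    using norm_Zform_le_qnorm[of u v] by simp
qed

lemma norm_Zform_le: "norm (Zform u v) \<le> Znorm u * Z2_qnorm v"
proof (cases "v = 0")
  case False
  then have p: "Z2_qnorm v > 0" using Z2_qnorm_nonneg[of v] by (simp add: less_le)
  let ?w = "Z2_scale (of_real (inverse (Z2_qnorm v))) v"
  have "norm (Zform u ?w) \<le> Znorm u"
    unfolding Znorm_def using p by (intro cSUP_upper Znorm_bdd) (simp add: Z2_qnorm_scale norm_inverse False)
  moreover have "norm (Zform u ?w) = inverse (Z2_qnorm v) * norm (Zform u v)"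
    using p by (simp add: Zform_scale_right norm_mult norm_inverse)
  ultimately show ?thesis using p by (simp add: field_simps)
qed simp

lemma Znorm_leI:
  assumes "0 \<le> c" "\<And>v. norm (Zform u v) \<le> c * Z2_qnorm v"
  shows "Znorm u \<le> c"
  unfolding Znorm_def
proof (rule cSUP_least)
  show "{v. Z2_qnorm v \<le> 1} \<noteq> ({} :: 'a Z2 set)" by (auto intro: exI[of _ 0])
  fix v :: "'a Z2" assume "v \<in> {v. Z2_qnorm v \<le> 1}"
  then have "c * Z2_qnorm v \<le> c * 1" using assms(1) by (intro mult_left_mono) auto
  then show "norm (Zform u v) \<le> c" using assms(2)[of v] by simp
qed

lemma Znorm_le_qnorm: "Znorm u \<le> 2 * Z2_qnorm u"
  by (intro Znorm_leI norm_Zform_le_qnorm) (simp add: Z2_qnorm_nonneg)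

lemma Znorm_nonneg [simp]: "0 \<le> Znorm u"
proof -
  have "Z2_qnorm (Zj (Zunit 0) :: 'a Z2) = 1" by (simp add: Z2_qnorm_Zj)
  then show ?thesis using order_trans[OF norm_ge_zero norm_Zform_le[of u "Zj (Zunit 0)"]] by simp
qed

lemma Znorm_triangle: "Znorm (u + v) \<le> Znorm u + Znorm v"
proof (rule Znorm_leI)
  fix w
  have "norm (Zform (u + v) w) \<le> norm (Zform u w) + norm (Zform v w)"
    by (simp add: Zform_add_left norm_triangle_ineq)
  also have "\<dots> \<le> Znorm u * Z2_qnorm w + Znorm v * Z2_qnorm w"
    by (intro add_mono norm_Zform_le)
  finally show "norm (Zform (u + v) w) \<le> (Znorm u + Znorm v) * Z2_qnorm w"
    by (simp add: algebra_simps)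
qed simp

lemma Znorm_0 [simp]: "Znorm (0 :: 'a::{real_or_complex,banach} Z2) = 0"
  by (rule antisym) (use Znorm_le_qnorm[of "0 :: 'a Z2"] in simp_all)

lemma Znorm_scale_le: "Znorm (Z2_scale c u) \<le> norm c * Znorm u"
  by (rule Znorm_leI) (simp_all add: Zform_scale_left norm_mult mult.assoc mult_left_mono norm_Zform_le)

lemma Znorm_scale: "Znorm (Z2_scale c u) = norm c * Znorm u"
proof (cases "c = 0")
  case False
  have "Znorm (Z2_scale (inverse c) (Z2_scale c u)) \<le> norm (inverse c) * Znorm (Z2_scale c u)"
    by (rule Znorm_scale_le)
  then have "Znorm u \<le> inverse (norm c) * Znorm (Z2_scale c u)"
    using False by (simp add: norm_inverse)
  then have "norm c * Znorm u \<le> Znorm (Z2_scale c u)"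
    using False by (simp add: divide_simps mult.commute)
  then show ?thesis using Znorm_scale_le[of c u] by simp
qed simp

lemma Znorm_minus [simp]: "Znorm (- u) = Znorm u"
  using Znorm_scale[of "-1" u] by simp

lemma Znorm_triangle_diff: "Znorm (u - v) \<le> Znorm u + Znorm v"
  using Znorm_triangle[of u "- v"] by simp

lemma Znorm_commute: "Znorm (u - v) = Znorm (v - u)"
  using Znorm_minus[of "u - v"] by simp

lemma Znorm_le_add_diff: "Znorm u \<le> Znorm v + Znorm (u - v)"
  using Znorm_triangle[of v "u - v"] by simp

lemma Znorm_sum: "Znorm (\<Sum>i\<in>F. u i) \<le> (\<Sum>i\<in>F. Znorm (u i))"
  by (induction F rule: infinite_finite_induct) (auto intro: order_trans[OF Znorm_triangle])

lemma suminf_self: "y \<in> ell2 \<Longrightarrow> (\<Sum>n. y n * scalar_cnj (y n)) = of_real ((norm2 y)\<^sup>2)"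
  for y :: "nat \<Rightarrow> 'k::{real_or_complex,banach}"
  by (simp add: scalar_cnj_norm scaleR_conv_of_real norm2_squared suminf_of_real ell2_def
      del: of_real_power)

text \<open>Testing against \<open>Zj (Zy u)\<close> returns the square of the norm of
  \<open>Zy u\<close>.\<close>

lemma norm2_Zy_le: "norm2 (Zy u) \<le> Znorm u"
proof -
  have "(norm2 (Zy u))\<^sup>2 = norm (Zform u (Zj (Zy u)))"
    by (simp add: norm_Zform_commute[of u] Zform_Zj_left Zy_ell2 suminf_self del: of_real_power)
  also have "\<dots> \<le> Znorm u * norm2 (Zy u)"
    using norm_Zform_le[of u "Zj (Zy u)"] by (simp add: Z2_qnorm_Zj Zy_ell2)
  finally show ?thesis
    using norm2_nonneg[OF Zy_ell2, of u] Znorm_nonneg[of u]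
    by (cases "norm2 (Zy u) = 0") (auto simp: power2_eq_square)
qed

text \<open>Equality, not mere equivalence, matters: it lets an isometry of ell2 have essential size
  at most 1.\<close>

lemma Znorm_Zj: "x \<in> ell2 \<Longrightarrow> Znorm (Zj x) = norm2 x"
proof (rule antisym)
  assume x: "x \<in> ell2"
  show "Znorm (Zj x) \<le> norm2 x"
  proof (rule Znorm_leI)
    fix v
    have "norm (Zform (Zj x) v) \<le> norm2 x * norm2 (Zy v)" by (rule norm_Zform_Zj_le[OF x])
    also have "\<dots> \<le> norm2 x * Z2_qnorm v"
      by (intro mult_left_mono) (auto simp: Z2_qnorm_eq norm2_nonneg x Zd_ell2)
    finally show "norm (Zform (Zj x) v) \<le> norm2 x * Z2_qnorm v" .
  qed (simp add: norm2_nonneg x)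
  \<comment> \<open>The test vector \<open>Zw x\<close> has quasi-norm \<open>norm2 x\<close>, since
    its \<open>Zd\<close> part is 0.\<close>
  have "(norm2 x)\<^sup>2 = norm (Zform (Zj x) (Zw x))"
    using x by (simp add: Zform_Zj_left suminf_self del: of_real_power)
  also have "\<dots> \<le> Znorm (Zj x) * norm2 x"
    using norm_Zform_le[of "Zj x" "Zw x"] by (simp add: Z2_qnorm_Zw x)
  finally show "norm2 x \<le> Znorm (Zj x)"
    using norm2_nonneg[OF x] by (cases "norm2 x = 0") (auto simp: power2_eq_square)
qed

lemma Znorm_Zw_le: "y \<in> ell2 \<Longrightarrow> Znorm (Zw y) \<le> 2 * norm2 y"
  using Znorm_le_qnorm[of "Zw y"] by (simp add: Z2_qnorm_Zw)

text \<open>Subtracting \<open>Zw (Zy u)\<close> leaves a vector in the range of \<open>Zj\<close>.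
  The constant is 1 for \<open>u\<close> plus 2 for \<open>Zw (Zy u)\<close>.\<close>

lemma norm2_Zd_le: "norm2 (Zd u) \<le> 3 * Znorm u"
proof -
  have "norm2 (Zd u) = Znorm (Zj (Zd u))" by (simp add: Znorm_Zj Zd_ell2)
  also have "Zj (Zd u) = u - Zw (Zy u)" using Z2_decompose[of u] by (simp add: algebra_simps)
  also have "Znorm \<dots> \<le> Znorm u + Znorm (Zw (Zy u))" by (rule Znorm_triangle_diff)
  also have "Znorm (Zw (Zy u)) \<le> 2 * norm2 (Zy u)" by (rule Znorm_Zw_le[OF Zy_ell2])
  finally show ?thesis using norm2_Zy_le[of u] by simp
qed

lemma qnorm_le_Znorm: "Z2_qnorm u \<le> 4 * Znorm u"
  using norm2_Zd_le[of u] norm2_Zy_le[of u] by (simp add: Z2_qnorm_eq)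

lemma Znorm_eq_0_iff [simp]: "Znorm u = 0 \<longleftrightarrow> u = 0"
  using qnorm_le_Znorm[of u] Z2_qnorm_nonneg[of u] by (auto simp: order_antisym)

lemma norm_Zx_le: "norm (Zx u n) \<le> Znorm u" and norm_Zy_le: "norm (Zy u n) \<le> Znorm u"
proof -
  have "norm (Zx u n) = norm (Zform u (Zw (Zunit n)))"
    by (simp add: norm_Zform_commute[of u] Zform_Zw_unit)
  then show "norm (Zx u n) \<le> Znorm u"
    using norm_Zform_le[of u "Zw (Zunit n)"] by (simp add: Z2_qnorm_Zw)
  show "norm (Zy u n) \<le> Znorm u"
    using norm_le_norm2[OF Zy_ell2, of u n] norm2_Zy_le[of u] by linarith
qed


section \<open>Restrictions\<close>

text \<open>The bound by \<open>R - r\<close> makes restriction a contraction for the quasi-norm.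
  The bound by the geometric mean tends to 0 with \<open>r\<close> for fixed \<open>R\<close>, as
  needed for tails.\<close>

lemma mult_ln_diff_le:
  fixes r R :: real
  assumes "0 \<le> r" "r \<le> R"
  shows "0 \<le> r * (ln R - ln r)" "r * (ln R - ln r) \<le> R - r" "r * (ln R - ln r) \<le> 2 * sqrt (R * r)"
proof -
  have "0 \<le> r * (ln R - ln r) \<and> r * (ln R - ln r) \<le> R - r \<and> r * (ln R - ln r) \<le> 2 * sqrt (R * r)"
  proof (cases "r = 0")
    case False
    then have r: "r > 0" "R > 0" using assms by auto
    have *: "ln R - ln r = ln (R / r)" using r by (simp add: ln_div)
    have "ln (R / r) \<le> R / r - 1" using r by (intro ln_le_minus_one) auto
    then have 1: "r * ln (R / r) \<le> r * (R / r - 1)" using r by (intro mult_left_mono) auto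
    have "ln (R / r) = 2 * ln (sqrt (R / r))" using r by (simp add: ln_sqrt)
    also have "\<dots> \<le> 2 * sqrt (R / r)" using ln_le_minus_one[of "sqrt (R / r)"] r by simp
    finally have "r * ln (R / r) \<le> r * (2 * sqrt (R / r))" using r by (intro mult_left_mono) auto
    also have "\<dots> = 2 * sqrt R * (r / sqrt r)" by (simp add: real_sqrt_divide)
    also have "r / sqrt r = sqrt r" using r by (simp add: real_div_sqrt)
    also have "2 * sqrt R * sqrt r = 2 * sqrt (R * r)" by (simp add: real_sqrt_mult)
    finally have 2: "r * ln (R / r) \<le> 2 * sqrt (R * r)" .
    show ?thesis using 1 2 r assms by (simp add: * right_diff_distrib)
  qed (use assms in simp)
  then show "0 \<le> r * (ln R - ln r)" "r * (ln R - ln r) \<le> R - r"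
    "r * (ln R - ln r) \<le> 2 * sqrt (R * r)" by auto
qed

lemma Z2_of_coords:
  assumes "y \<in> ell2" "(\<lambda>n. x n - Omega y n) \<in> ell2"
  shows "Zx (Z2_of (x, y)) = x" "Zy (Z2_of (x, y)) = y"
  using assms by (auto simp: Zx_def Zy_def Z2_of_inverse Z2_carrier_def)

definition Zrestr :: "nat set \<Rightarrow> 'k::real_normed_field Z2 \<Rightarrow> 'k Z2" where
  "Zrestr A u = Z2_of (restr A (Zx u), restr A (Zy u))"

text \<open>Apart from the norm inside the logarithm \<open>Omega\<close> acts coordinatewise, so it
  commutes with restriction up to a scalar multiple of the restricted vector.\<close>

lemma Omega_restr:
  assumes "y \<in> ell2"
  shows "restr A (Omega y) n - Omega (restr A y) n
    = of_real (ln (norm2 y) - ln (norm2 (restr A y))) * restr A y n"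
  unfolding Omega_alt[OF ell2_restr[OF assms]] by (simp add: restr_def Omega_alt[OF assms] algebra_simps)

lemma Zrestr_aux:
  "(\<lambda>n. restr A (Zx u) n - Omega (restr A (Zy u)) n) = (\<lambda>n. restr A (Zd u) n
      + of_real (ln (norm2 (Zy u)) - ln (norm2 (restr A (Zy u)))) * restr A (Zy u) n)"
proof
  fix n
  have "restr A (Zx u) n - Omega (restr A (Zy u)) n
      = restr A (Zd u) n + (restr A (Omega (Zy u)) n - Omega (restr A (Zy u)) n)"
    by (simp add: restr_def Zx_eq)
  then show "restr A (Zx u) n - Omega (restr A (Zy u)) n = restr A (Zd u) n
      + of_real (ln (norm2 (Zy u)) - ln (norm2 (restr A (Zy u)))) * restr A (Zy u) n"
    by (simp only: Omega_restr[OF Zy_ell2])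
qed

lemma Zrestr_coords [simp]:
  "Zx (Zrestr A u) = restr A (Zx u)" "Zy (Zrestr A u) = restr A (Zy u)"
proof -
  have "(\<lambda>n. restr A (Zx u) n - Omega (restr A (Zy u)) n) \<in> ell2"
    unfolding Zrestr_aux by (intro ell2_add ell2_scale ell2_restr Zd_ell2 Zy_ell2)
  from Z2_of_coords[OF ell2_restr[OF Zy_ell2] this]
  show "Zx (Zrestr A u) = restr A (Zx u)" "Zy (Zrestr A u) = restr A (Zy u)"
    by (auto simp: Zrestr_def)
qed

lemma Zd_Zrestr: "Zd (Zrestr A u) = (\<lambda>n. restr A (Zd u) n
      + of_real (ln (norm2 (Zy u)) - ln (norm2 (restr A (Zy u)))) * restr A (Zy u) n)"
  by (rule ext) (subst Zd_def, simp only: Zrestr_coords, rule fun_cong[OF Zrestr_aux])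

lemma norm2_Zd_Zrestr:
  "norm2 (Zd (Zrestr A u)) \<le> norm2 (restr A (Zd u))
    + norm2 (restr A (Zy u)) * (ln (norm2 (Zy u)) - ln (norm2 (restr A (Zy u))))"
proof -
  let ?c = "ln (norm2 (Zy u)) - ln (norm2 (restr A (Zy u)))" and ?r = "norm2 (restr A (Zy u))"
  have *: "0 \<le> ?r * ?c"
    by (intro mult_ln_diff_le norm2_nonneg ell2_restr Zy_ell2 norm2_restr_le)
  have "norm2 (Zd (Zrestr A u)) \<le> norm2 (restr A (Zd u)) + norm2 (\<lambda>n. of_real ?c * restr A (Zy u) n)"
    unfolding Zd_Zrestr by (intro norm2_triangle ell2_scale ell2_restr Zd_ell2 Zy_ell2)
  also have "norm2 (\<lambda>n. of_real ?c * restr A (Zy u) n) = \<bar>?c\<bar> * ?r"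
    by (subst norm2_scale) (simp_all add: ell2_restr Zy_ell2 del: of_real_diff)
  also have "\<dots> = ?r * ?c"
    using * norm2_nonneg[OF ell2_restr[OF Zy_ell2], of A u]
    by (cases "?r = 0") (auto simp: zero_le_mult_iff)
  finally show ?thesis .
qed

text \<open>What \<open>Zd\<close> may gain from the smaller norm inside the logarithm is at most
  what \<open>Zy\<close> loses, so the sum does not grow.\<close>

lemma qnorm_Zrestr_le: "Z2_qnorm (Zrestr A u) \<le> Z2_qnorm u"
proof -
  have "norm2 (restr A (Zy u)) * (ln (norm2 (Zy u)) - ln (norm2 (restr A (Zy u))))
      \<le> norm2 (Zy u) - norm2 (restr A (Zy u))"
    by (intro mult_ln_diff_le norm2_nonneg ell2_restr Zy_ell2 norm2_restr_le)
  then show ?thesis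
    using norm2_Zd_Zrestr[of A u] norm2_restr_le[OF Zd_ell2, of A u] by (simp add: Z2_qnorm_eq)
qed

lemma qnorm_tail_tendsto: "(\<lambda>n. Z2_qnorm (Zrestr {n..} u)) \<longlonglongrightarrow> 0"
proof (rule tendsto_sandwich[OF _ _ tendsto_const])
  let ?r = "\<lambda>n. norm2 (restr {n..} (Zy u))"
  let ?g = "\<lambda>n. norm2 (restr {n..} (Zd u)) + 2 * sqrt (norm2 (Zy u) * ?r n) + ?r n"
  have "?r n * (ln (norm2 (Zy u)) - ln (?r n)) \<le> 2 * sqrt (norm2 (Zy u) * ?r n)" for n
    by (intro mult_ln_diff_le norm2_nonneg ell2_restr Zy_ell2 norm2_restr_le)
  then have "Z2_qnorm (Zrestr {n..} u) \<le> ?g n" for n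
    using norm2_Zd_Zrestr[of "{n..}" u] by (simp add: Z2_qnorm_eq add_mono order_trans)
  then show "\<forall>\<^sub>F n in sequentially. Z2_qnorm (Zrestr {n..} u) \<le> ?g n" by simp
  have "?g \<longlonglongrightarrow> 0 + 2 * sqrt (norm2 (Zy u) * 0) + 0"
    by (intro tendsto_intros norm2_tail_tendsto Zd_ell2 Zy_ell2)
  then show "?g \<longlonglongrightarrow> 0" by simp
qed (auto simp: Z2_qnorm_nonneg)

lemma Zrestr_split: "Zrestr {..<n} u + Zrestr {n..} u = u"
  by (rule Z2_eqI) (auto simp: restr_def)

lemma Znorm_Zrestr_le: "Znorm (Zrestr A u) \<le> 8 * Znorm u"
  using Znorm_le_qnorm[of "Zrestr A u"] qnorm_Zrestr_le[of A u] qnorm_le_Znorm[of u] by linarith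

lemma Znorm_tail_tendsto: "(\<lambda>n. Znorm (Zrestr {n..} u)) \<longlonglongrightarrow> 0"
proof (rule tendsto_sandwich[OF _ _ tendsto_const])
  show "(\<lambda>n. 2 * Z2_qnorm (Zrestr {n..} u)) \<longlonglongrightarrow> 0"
    using tendsto_mult_right_zero[OF qnorm_tail_tendsto, of 2 u] by simp
qed (auto simp: Znorm_le_qnorm)

lemma Zrestr_initial:
  "Zrestr {..<n} u = (\<Sum>i<n. Z2_scale (Zx u i) (Zj (Zunit i)) + Z2_scale (Zy u i) (Zw (Zunit i)))"
  by (rule Z2_eqI) (simp_all add: restr_def Zunit_def if_distrib[of "\<lambda>x. _ * x"] cong: if_cong)


lemma Znorm_initial_le: "Znorm (Zrestr {..<n} u) \<le> (\<Sum>i<n. norm (Zx u i) + norm (Zy u i) * 2)"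
proof -
  have "Znorm (Zj (Zunit i) :: 'a Z2) = 1" for i by (simp add: Znorm_Zj)
  moreover have "Znorm (Zw (Zunit i) :: 'a Z2) \<le> 2" for i
    using Znorm_Zw_le[OF Zunit_ell2, of i] by simp
  ultimately show ?thesis
    unfolding Zrestr_initial
    by (intro order_trans[OF Znorm_sum] sum_mono order_trans[OF Znorm_triangle] add_mono)
      (auto simp: Znorm_scale intro: mult_left_mono)
qed


section \<open>The continuous extension of the symplectic form\<close>

text \<open>The triangle inequality makes these balls open, unlike those of the quasi-norm;
  continuity for the product topology needs open neighbourhoods.\<close>

lemma open_Znorm_ball: "open {v. Znorm (v - u) < e}"
  unfolding open_Z2_def
proof (intro ballI, simp)
  fix w assume w: "Znorm (w - u) < e"
  have "Znorm (v - u) < e" if "Z2_qnorm (v - w) < (e - Znorm (w - u)) / 2" for v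
    using Znorm_triangle[of "v - w" "w - u"] Znorm_le_qnorm[of "v - w"] that by simp
  then show "\<exists>d>0. \<forall>v. Z2_qnorm (v - w) < d \<longrightarrow> Znorm (v - u) < e"
    using w by (intro exI[of _ "(e - Znorm (w - u)) / 2"]) auto
qed

lemma continuous_Zform:
  "continuous_on UNIV (\<lambda>(u, v). Zform u (v :: 'k::{real_or_complex,banach} Z2))"
proof (subst continuous_on_open_vimage[OF open_UNIV], intro allI impI)
  fix B :: "'k set" assume B: "open B"
  show "open ((\<lambda>(u, v). Zform u v) -` B \<inter> UNIV)"
    unfolding open_prod_def
  proof (intro ballI, clarsimp)
    fix u v :: "'k Z2" assume "Zform u v \<in> B"
    then obtain e where e: "e > 0" "\<And>z. dist z (Zform u v) < e \<Longrightarrow> z \<in> B"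
      using B by (auto simp: open_dist)
    define K where "K = Znorm u + Znorm v + 1"
    have K: "K > 0" by (auto simp: K_def intro: add_nonneg_pos)
    define d where "d = min 1 (e / (8 * K))"
    have d: "d > 0" "d \<le> 1" "d * K \<le> e / 8" using e(1) K by (auto simp: d_def min_def field_simps)
    have "Zform u' v' \<in> B" if u': "Znorm (u' - u) < d" and v': "Znorm (v' - v) < d" for u' v'
    proof (rule e(2))
      have n: "Znorm v' \<le> Znorm v + 1"
        using Znorm_le_add_diff[of v' v] v' d(2) by simp
      have "dist (Zform u' v') (Zform u v) = norm (Zform (u' - u) v' + Zform u (v' - v))"
        by (simp add: dist_norm Zform_diff_left Zform_diff_right)
      also have "\<dots> \<le> norm (Zform (u' - u) v') + norm (Zform u (v' - v))"
        by (rule norm_triangle_ineq)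
      also have "\<dots> \<le> Znorm (u' - u) * (4 * Znorm v') + Znorm u * (4 * Znorm (v' - v))"
        by (intro add_mono order_trans[OF norm_Zform_le] mult_left_mono qnorm_le_Znorm) auto
      also have "\<dots> \<le> d * (4 * (Znorm v + 1)) + Znorm u * (4 * d)"
        using n u' v' d(1) by (intro add_mono mult_mono) auto
      also have "\<dots> = 4 * (d * K)" by (simp add: K_def algebra_simps)
      also have "\<dots> < e" using d(3) e(1) by linarith
      finally show "dist (Zform u' v') (Zform u v) < e" .
    qed
    then show "\<exists>A. open A \<and> (\<exists>Aa. open Aa \<and> u \<in> A \<and> v \<in> Aa \<and> A \<times> Aa \<subseteq> (\<lambda>(u, v). Zform u v) -` B)"
      using d(1) by (intro exI[of _ "{u'. Znorm (u' - u) < d}"] conjI open_Znorm_ball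
          exI[of _ "{v'. Znorm (v' - v) < d}"]) auto
  qed
qed

lemma Zrestr_tendsto: "(\<lambda>n. Zrestr {..<n} u) \<longlonglongrightarrow> (u :: 'k::real_normed_field Z2)"
proof (rule topological_tendstoI)
  fix S :: "'k Z2 set" assume "open S" "u \<in> S"
  then obtain e where e: "e > 0" "\<And>v. Z2_qnorm (v - u) < e \<Longrightarrow> v \<in> S"
    unfolding open_Z2_def by blast
  have "\<forall>\<^sub>F n in sequentially. Z2_qnorm (Zrestr {n..} u) < e"
    using order_tendstoD(2)[OF qnorm_tail_tendsto e(1)] .
  then show "\<forall>\<^sub>F n in sequentially. Zrestr {..<n} u \<in> S"
  proof eventually_elim
    case (elim n)
    have "Zrestr {..<n} u - u = - Zrestr {n..} u" using Zrestr_split[of n u] by (metis diff_add_cancel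
          add_diff_cancel_left' minus_diff_eq)
    with elim show ?case by (intro e(2)) simp
  qed
qed

lemma Zform_finitely_supported:
  assumes "u \<in> Z2_finitely_supported" "v \<in> Z2_finitely_supported"
  shows "Zform u v = inner2 (Zx u) (Zy v) - inner2 (Zy u) (Zx v)"
proof -
  have f: "finite {n. Zx u n \<noteq> 0}" "finite {n. Zy u n \<noteq> 0}"
    using assms(1) by (auto simp: Z2_finitely_supported_def Zx_def Zy_def)
  have "summable (\<lambda>n. Zx u n * scalar_cnj (Zy v n))" "summable (\<lambda>n. Zy u n * scalar_cnj (Zx v n))"
    by (rule summable_finite[OF f(1)], simp, rule summable_finite[OF f(2)], simp)
  then show ?thesis unfolding Zform_def Zterm_def inner2_def by (rule suminf_diff[symmetric])
qed

lemma Zrestr_finitely_supported: "Zrestr {..<n} u \<in> Z2_finitely_supported"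
  by (auto simp: Z2_finitely_supported_def restr_def simp flip: Zx_def Zy_def
      intro: finite_subset[of _ "{..<n}"])

text \<open>Uniqueness behind the \<open>THE\<close> comes from the truncations
  \<open>Zrestr {..<n}\<close>, which are finitely supported and converge to the vector.\<close>

lemma Z2_omega_eq: "Z2_omega = (Zform :: 'k Z2 \<Rightarrow> 'k Z2 \<Rightarrow> 'k::{real_or_complex,banach})"
  unfolding Z2_omega_def
proof (rule the_equality)
  show "continuous_on UNIV (\<lambda>(u, v). Zform u (v :: 'k Z2))
     \<and> (\<forall>u\<in>Z2_finitely_supported. \<forall>v\<in>Z2_finitely_supported.
          Zform u v = inner2 (fst (Z2_coords u)) (snd (Z2_coords v))
                - inner2 (snd (Z2_coords u)) (fst (Z2_coords v)))"
    using continuous_Zform Zform_finitely_supported by (auto simp: Zx_def Zy_def)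
next
  fix w :: "'k Z2 \<Rightarrow> 'k Z2 \<Rightarrow> 'k"
  assume w: "continuous_on UNIV (\<lambda>(u, v). w u v)
     \<and> (\<forall>u\<in>Z2_finitely_supported. \<forall>v\<in>Z2_finitely_supported.
          w u v = inner2 (fst (Z2_coords u)) (snd (Z2_coords v))
                - inner2 (snd (Z2_coords u)) (fst (Z2_coords v)))"
  show "w = Zform"
  proof (intro ext)
    fix u v :: "'k Z2"
    have p: "(\<lambda>n. (Zrestr {..<n} u, Zrestr {..<n} v)) \<longlonglongrightarrow> (u, v)"
      by (intro tendsto_Pair Zrestr_tendsto)
    have "(\<lambda>n. w (Zrestr {..<n} u) (Zrestr {..<n} v)) \<longlonglongrightarrow> w u v"
      using continuous_on_tendsto_compose[OF conjunct1[OF w] p] by simp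
    moreover have "(\<lambda>n. Zform (Zrestr {..<n} u) (Zrestr {..<n} v)) \<longlonglongrightarrow> Zform u v"
      using continuous_on_tendsto_compose[OF continuous_Zform p] by simp
    moreover have "w (Zrestr {..<n} u) (Zrestr {..<n} v) = Zform (Zrestr {..<n} u) (Zrestr {..<n} v)" for n
      using w Zform_finitely_supported[OF Zrestr_finitely_supported Zrestr_finitely_supported]
        Zrestr_finitely_supported by (metis Zx_def Zy_def)
    ultimately show "w u v = Zform u v" using LIMSEQ_unique by auto
  qed
qed


section \<open>Bounded operators and adjoints\<close>

lemma Z2_operators_iff:
  "T \<in> Z2_operators \<longleftrightarrow> (\<forall>u v. T (u + v) = T u + T v) \<and> (\<forall>c u. T (Z2_scale c u) = Z2_scale c (T u))
    \<and> (\<exists>C. \<forall>u. Z2_qnorm (T u) \<le> C * Z2_qnorm u)"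
  by (auto simp: Z2_operators_def Vector_Spaces.linear_iff Z2.vector_space_axioms)

lemma Z2_operatorsI:
  assumes "\<And>u v. T (u + v) = T u + T v" "\<And>c u. T (Z2_scale c u) = Z2_scale c (T u)"
    and "\<And>u. Znorm (T u) \<le> C * Znorm u"
  shows "T \<in> Z2_operators"
proof -
  have "Z2_qnorm (T u) \<le> (8 * \<bar>C\<bar>) * Z2_qnorm u" for u
  proof -
    have "Z2_qnorm (T u) \<le> 4 * (C * Znorm u)" using qnorm_le_Znorm[of "T u"] assms(3)[of u] by simp
    also have "\<dots> \<le> 4 * (\<bar>C\<bar> * (2 * Z2_qnorm u))"
      by (intro mult_left_mono mult_mono Znorm_le_qnorm) auto
    finally show ?thesis by simp
  qed
  then show ?thesis using assms(1,2) unfolding Z2_operators_iff by blast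
qed

context
  fixes T :: "'k::{real_or_complex,banach} Z2 \<Rightarrow> 'k Z2"
  assumes T: "T \<in> Z2_operators"
begin

lemma op_add: "T (u + v) = T u + T v"
  using T by (auto simp: Z2_operators_iff)

lemma op_scale: "T (Z2_scale c u) = Z2_scale c (T u)"
  using T by (auto simp: Z2_operators_iff)

lemma op_0: "T 0 = 0"
  using op_scale[of 0 0] by simp

lemma op_minus: "T (- u) = - T u"
  using op_scale[of "-1" u] by simp

lemma op_diff: "T (u - v) = T u - T v"
  using op_add[of u "- v"] by (simp add: op_minus)

lemma op_sum: "T (\<Sum>i\<in>F. u i) = (\<Sum>i\<in>F. T (u i))"
  by (induction F rule: infinite_finite_induct) (auto simp: op_add op_0)

lemma op_bounded: "\<exists>C>0. \<forall>u. Znorm (T u) \<le> C * Znorm u"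
proof -
  obtain C where C: "\<And>u. Z2_qnorm (T u) \<le> C * Z2_qnorm u" using T by (auto simp: Z2_operators_iff)
  have "Znorm (T u) \<le> (8 * \<bar>C\<bar> + 1) * Znorm u" for u
  proof -
    have "Znorm (T u) \<le> 2 * (C * Z2_qnorm u)" using Znorm_le_qnorm[of "T u"] C[of u] by simp
    also have "\<dots> \<le> 2 * (\<bar>C\<bar> * (4 * Znorm u))"
      by (intro mult_left_mono mult_mono qnorm_le_Znorm) (auto simp: Z2_qnorm_nonneg)
    finally show ?thesis using Znorm_nonneg[of u] by (simp add: algebra_simps del: Znorm_nonneg)
  qed
  then show ?thesis by (intro exI[of _ "8 * \<bar>C\<bar> + 1"]) auto
qed

end

text \<open>The space is its own (conjugate) dual. The values of \<phi> on the coordinate vectors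
  prescribe the coordinates of \<open>v\<close>; the work is to show that they form an element of
  the space, by bounds on truncations that do not depend on their length.\<close>

lemma Zform_representation:
  fixes \<phi> :: "'k::{real_or_complex,banach} Z2 \<Rightarrow> 'k"
  assumes add: "\<And>u v. \<phi> (u + v) = \<phi> u + \<phi> v" and scale: "\<And>c u. \<phi> (Z2_scale c u) = c * \<phi> u"
    and C: "0 \<le> C" "\<And>u. norm (\<phi> u) \<le> C * Z2_qnorm u"
  shows "\<exists>v. \<forall>u. \<phi> u = Zform u v"
proof -
  have sum: "\<phi> (\<Sum>i\<in>F. u i) = (\<Sum>i\<in>F. \<phi> (u i))" for F and u :: "nat \<Rightarrow> 'k Z2"
    using add scale[of 0 0] by (induction F rule: infinite_finite_induct) auto
  define x where "x n = - scalar_cnj (\<phi> (Zw (Zunit n)))" for n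
  define y where "y n = scalar_cnj (\<phi> (Zj (Zunit n)))" for n
  have \<phi>: "\<phi> (Zrestr {..<N} u) = (\<Sum>n<N. Zx u n * scalar_cnj (y n) - Zy u n * scalar_cnj (x n))" for u N
    by (simp add: Zrestr_initial sum add scale x_def y_def)
  define v where "v N = Z2_of (restr {..<N} x, restr {..<N} y)" for N
  have fin: "finite {n. restr {..<N} z n \<noteq> 0}" for N and z :: "nat \<Rightarrow> 'k"
    by (rule finite_subset[of _ "{..<N}"]) (auto simp: restr_def)
  have v: "Zx (v N) = restr {..<N} x" "Zy (v N) = restr {..<N} y" for N
  proof -
    have "(\<lambda>n. restr {..<N} x n - Omega (restr {..<N} y) n) \<in> ell2"
      by (rule ell2_finite_support, rule finite_subset[of _ "{..<N}"])
        (auto simp: restr_def Omega_eq_0)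
    then show "Zx (v N) = restr {..<N} x" "Zy (v N) = restr {..<N} y"
      unfolding v_def by (auto simp: Z2_of_coords ell2_finite_support[OF fin])
  qed
  have form_v: "Zform u (v N) = \<phi> (Zrestr {..<N} u)" for u N
  proof (rule Zform_eqI)
    have "Zterm u (v N) sums (\<Sum>n<N. Zterm u (v N) n)"
      by (rule sums_finite) (auto simp: Zterm_def v restr_def)
    also have "(\<Sum>n<N. Zterm u (v N) n) = \<phi> (Zrestr {..<N} u)"
      unfolding \<phi> by (intro sum.cong) (auto simp: Zterm_def v restr_def)
    finally show "Zterm u (v N) sums \<phi> (Zrestr {..<N} u)" .
  qed
  \<comment> \<open>Pairing with \<open>v N\<close> is \<phi> of a truncation, and truncation
    contracts the quasi-norm; so \<open>C\<close> serves for all \<open>N\<close>.\<close>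
  have nv: "Znorm (v N) \<le> C" for N
  proof (rule Znorm_leI[OF C(1)])
    fix w
    have "norm (Zform (v N) w) \<le> C * Z2_qnorm (Zrestr {..<N} w)"
      by (simp add: norm_Zform_commute[of "v N"] form_v C)
    also have "\<dots> \<le> C * Z2_qnorm w" by (intro mult_left_mono qnorm_Zrestr_le C)
    finally show "norm (Zform (v N) w) \<le> C * Z2_qnorm w" .
  qed
  have y: "y \<in> ell2"
  proof (rule ell2_if_bounded)
    fix N
    have "L2_set (\<lambda>i. norm (y i)) {..<N} = L2_set (\<lambda>i. norm (Zy (v N) i)) {..<N}"
      by (rule L2_set_cong) (auto simp: v restr_def)
    also have "\<dots> \<le> norm2 (Zy (v N))" by (intro norm2_L2_set Zy_ell2) auto
    also have "\<dots> \<le> C" using norm2_Zy_le[of "v N"] nv[of N] by simp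
    finally show "L2_set (\<lambda>i. norm (y i)) {..<N} \<le> C" .
  qed
  have xy: "(\<lambda>n. x n - Omega y n) \<in> ell2"
  proof (rule ell2_if_bounded)
    fix N
    let ?yN = "restr {..<N} y"
    \<comment> \<open>On the segment \<open>Omega y\<close> and \<open>Omega ?yN\<close> differ only
      by the norm inside the logarithm, that is by \<open>?c\<close> times \<open>?yN\<close>. The
      product \<open>norm2 ?yN * ?c\<close> is at most \<open>norm2 y\<close>, however small
      \<open>norm2 ?yN\<close> is.\<close>
    let ?c = "ln (norm2 y) - ln (norm2 ?yN)"
    have yN: "?yN \<in> ell2" by (rule ell2_restr[OF y])
    have c: "0 \<le> norm2 ?yN * ?c" "norm2 ?yN * ?c \<le> norm2 y - norm2 ?yN"
      by (intro mult_ln_diff_le norm2_nonneg yN norm2_restr_le y)+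
    have "norm2 (\<lambda>n. of_real ?c * ?yN n) = \<bar>norm2 ?yN * ?c\<bar>"
      using norm2_nonneg[OF yN] by (subst norm2_scale[OF yN]) (simp add: abs_mult del: of_real_diff)
    then have le: "norm2 (\<lambda>n. of_real ?c * ?yN n) \<le> norm2 y"
      using c norm2_nonneg[OF yN] by linarith
    have "L2_set (\<lambda>i. norm (x i - Omega y i)) {..<N}
        = L2_set (\<lambda>i. norm (Zd (v N) i - of_real ?c * ?yN i)) {..<N}"
    proof (rule L2_set_cong[OF refl])
      fix i assume i: "i \<in> {..<N}"
      have "of_real ?c * ?yN i = Omega y i - Omega ?yN i"
        using Omega_restr[OF y, of "{..<N}" i] i by (simp add: restr_def)
      then show "norm (x i - Omega y i) = norm (Zd (v N) i - of_real ?c * ?yN i)"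
        using i by (simp only: Zd_def v) (simp add: restr_def)
    qed
    also have "\<dots> \<le> norm2 (\<lambda>i. Zd (v N) i - of_real ?c * ?yN i)"
      by (intro norm2_L2_set ell2_diff Zd_ell2 ell2_scale yN) auto
    also have "\<dots> \<le> norm2 (Zd (v N)) + norm2 (\<lambda>n. of_real ?c * ?yN n)"
      by (intro norm2_triangle_diff Zd_ell2 ell2_scale yN)
    also have "\<dots> \<le> 3 * C + norm2 y" using norm2_Zd_le[of "v N"] nv[of N] le by simp
    finally show "L2_set (\<lambda>i. norm (x i - Omega y i)) {..<N} \<le> 3 * C + norm2 y" .
  qed
  note co = Z2_of_coords[OF y xy]
  have "\<phi> u = Zform u (Z2_of (x, y))" for u
  proof (rule LIMSEQ_unique)
    have *: "(\<lambda>N. \<phi> (Zrestr {..<N} u)) = (\<lambda>N. \<Sum>n<N. Zterm u (Z2_of (x, y)) n)"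
      unfolding \<phi> by (simp add: Zterm_def co)
    show "(\<lambda>N. \<phi> (Zrestr {..<N} u)) \<longlonglongrightarrow> Zform u (Z2_of (x, y))"
      unfolding * using Zform_sums by (simp add: sums_def)
    have "(\<lambda>N. \<phi> u - \<phi> (Zrestr {..<N} u)) \<longlonglongrightarrow> 0"
    proof (rule tendsto_0_le)
      show "(\<lambda>N. Z2_qnorm (Zrestr {N..} u)) \<longlonglongrightarrow> 0" by (rule qnorm_tail_tendsto)
      have "\<phi> u - \<phi> (Zrestr {..<N} u) = \<phi> (Zrestr {N..} u)" for N
        using add[of "Zrestr {..<N} u" "Zrestr {N..} u"] by (simp add: Zrestr_split)
      then show "\<forall>\<^sub>F N in sequentially. norm (\<phi> u - \<phi> (Zrestr {..<N} u))
          \<le> norm (Z2_qnorm (Zrestr {N..} u)) * C"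
        using C(2) by (simp add: Z2_qnorm_nonneg mult.commute)
    qed
    from tendsto_diff[OF tendsto_const this, of "\<phi> u"]
    show "(\<lambda>N. \<phi> (Zrestr {..<N} u)) \<longlonglongrightarrow> \<phi> u" by simp
  qed
  then show ?thesis by blast
qed

lemma adjoint_exists:
  fixes T :: "'k::{real_or_complex,banach} Z2 \<Rightarrow> 'k Z2"
  assumes T: "T \<in> Z2_operators"
  shows "\<exists>T'\<in>Z2_operators. \<forall>u v. Zform (T u) v = Zform u (T' v)"
proof -
  obtain C where C: "C \<ge> 0" "\<And>u. Z2_qnorm (T u) \<le> C * Z2_qnorm u"
  proof -
    obtain C where C: "\<And>u. Z2_qnorm (T u) \<le> C * Z2_qnorm u" using T by (auto simp: Z2_operators_iff)
    show ?thesis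
    proof (rule that[of "\<bar>C\<bar>"])
      show "Z2_qnorm (T u) \<le> \<bar>C\<bar> * Z2_qnorm u" for u
        using C[of u] mult_right_mono[OF abs_ge_self[of C] Z2_qnorm_nonneg[of u]] by linarith
    qed simp
  qed
  have "\<exists>v'. \<forall>u. Zform (T u) v = Zform u v'" for v
  proof (rule Zform_representation)
    show "0 \<le> 2 * C * Z2_qnorm v" using C by (simp add: Z2_qnorm_nonneg)
    fix u
    have "2 * Z2_qnorm (T u) * Z2_qnorm v \<le> 2 * (C * Z2_qnorm u) * Z2_qnorm v"
      by (intro mult_left_mono mult_right_mono C) (auto simp: Z2_qnorm_nonneg)
    then show "norm (Zform (T u) v) \<le> 2 * C * Z2_qnorm v * Z2_qnorm u"
      using norm_Zform_le_qnorm[of "T u" v] by (simp add: algebra_simps)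
  qed (simp_all add: op_add[OF T] op_scale[OF T] Zform_add_left Zform_scale_left)
  then obtain T' where T': "\<And>u v. Zform (T u) v = Zform u (T' v)" by metis
  have "T' \<in> Z2_operators"
  proof (rule Z2_operatorsI)
    show "T' (u + v) = T' u + T' v" for u v
      by (rule Zform_nondegenerate) (simp add: T'[symmetric] Zform_add_right)
    show "T' (Z2_scale c u) = Z2_scale c (T' u)" for c u
      by (rule Zform_nondegenerate) (simp add: T'[symmetric] Zform_scale_right)
    \<comment> \<open>\<open>Znorm\<close> tests on quasi-norm balls, so the quasi-norm bound
      \<open>C\<close> of \<open>T\<close> carries over without loss.\<close>
    show "Znorm (T' v) \<le> C * Znorm v" for v
    proof (rule Znorm_leI)
      fix u
      have "norm (Zform (T' v) u) = norm (Zform v (T u))"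
        by (metis T' norm_Zform_commute)
      also have "\<dots> \<le> Znorm v * (C * Z2_qnorm u)"
        by (intro order_trans[OF norm_Zform_le] mult_left_mono C) auto
      finally show "norm (Zform (T' v) u) \<le> C * Znorm v * Z2_qnorm u" by (simp add: mult_ac)
    qed (use C in simp)
  qed
  with T' show ?thesis by blast
qed

lemma Z2_star_eqI:
  fixes T :: "'k::{real_or_complex,banach} Z2 \<Rightarrow> 'k Z2"
  assumes "T' \<in> Z2_operators" "\<And>u v. Zform (T u) v = Zform u (T' v)"
  shows "Z2_star T = T'"
  unfolding Z2_star_def Z2_omega_eq
proof (rule the_equality)
  fix S assume "S \<in> Z2_operators \<and> (\<forall>u v. Zform (T u) v = Zform u (S v))"
  then show "S = T'" using assms(2) by (metis Zform_nondegenerate ext)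
qed (use assms in auto)

lemma
  fixes T :: "'k::{real_or_complex,banach} Z2 \<Rightarrow> 'k Z2"
  assumes "T \<in> Z2_operators"
  shows Z2_star_op: "Z2_star T \<in> Z2_operators"
    and Zform_star: "Zform (T u) v = Zform u (Z2_star T v)"
  using adjoint_exists[OF assms] Z2_star_eqI by metis+

lemma Zform_star': "T \<in> Z2_operators \<Longrightarrow> Zform (Z2_star T u) v = Zform u (T v)"
  for T :: "'k::{real_or_complex,banach} Z2 \<Rightarrow> 'k Z2"
  by (metis Zform_star Zform_skew)

lemma Z2_star_star: "T \<in> Z2_operators \<Longrightarrow> Z2_star (Z2_star T) = T"
  for T :: "'k::{real_or_complex,banach} Z2 \<Rightarrow> 'k Z2"
  by (intro Z2_star_eqI) (auto simp: Zform_star')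

lemma op_plus: "S \<in> Z2_operators \<Longrightarrow> T \<in> Z2_operators \<Longrightarrow> (\<lambda>u. S u + T u) \<in> Z2_operators"
  for T :: "'k::{real_or_complex,banach} Z2 \<Rightarrow> 'k Z2"
proof -
  assume S: "S \<in> Z2_operators" and T: "T \<in> Z2_operators"
  obtain C D where C: "\<And>u. Znorm (S u) \<le> C * Znorm u" and D: "\<And>u. Znorm (T u) \<le> D * Znorm u"
    using op_bounded[OF S] op_bounded[OF T] by blast
  show ?thesis
  proof (rule Z2_operatorsI)
    show "Znorm (S u + T u) \<le> (C + D) * Znorm u" for u
      using Znorm_triangle[of "S u" "T u"] C[of u] D[of u] by (simp add: algebra_simps)
  qed (simp_all add: op_add[OF S] op_add[OF T] op_scale[OF S] op_scale[OF T] Z2.scale_right_distrib)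
qed

lemma op_smult: "T \<in> Z2_operators \<Longrightarrow> (\<lambda>u. Z2_scale c (T u)) \<in> Z2_operators"
  for T :: "'k::{real_or_complex,banach} Z2 \<Rightarrow> 'k Z2"
proof -
  assume T: "T \<in> Z2_operators"
  obtain D where D: "\<And>u. Znorm (T u) \<le> D * Znorm u" using op_bounded[OF T] by blast
  show ?thesis
  proof (rule Z2_operatorsI)
    show "Znorm (Z2_scale c (T u)) \<le> (norm c * D) * Znorm u" for u
      using D[of u] by (simp add: Znorm_scale mult.assoc mult_left_mono)
  qed (simp_all add: op_add[OF T] op_scale[OF T] Z2.scale_right_distrib mult.commute)
qed

lemma op_comp: "S \<in> Z2_operators \<Longrightarrow> T \<in> Z2_operators \<Longrightarrow> S \<circ> T \<in> Z2_operators"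
  for T :: "'k::{real_or_complex,banach} Z2 \<Rightarrow> 'k Z2"
proof -
  assume S: "S \<in> Z2_operators" and T: "T \<in> Z2_operators"
  obtain C D where C: "C > 0" "\<And>u. Znorm (S u) \<le> C * Znorm u" and D: "\<And>u. Znorm (T u) \<le> D * Znorm u"
    using op_bounded[OF S] op_bounded[OF T] by blast
  show ?thesis
  proof (rule Z2_operatorsI)
    show "Znorm ((S \<circ> T) u) \<le> (C * D) * Znorm u" for u
      using order_trans[OF C(2)[of "T u"] mult_left_mono[OF D[of u] less_imp_le[OF C(1)]]]
      by (simp add: mult.assoc)
  qed (simp_all add: op_add[OF S] op_add[OF T] op_scale[OF S] op_scale[OF T])
qed

lemma op_zero: "(\<lambda>_. 0) \<in> (Z2_operators :: ('k::{real_or_complex,banach} Z2 \<Rightarrow> 'k Z2) set)"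
  by (rule Z2_operatorsI[where C = 0]) auto

context
  fixes S T :: "'k::{real_or_complex,banach} Z2 \<Rightarrow> 'k Z2"
  assumes S: "S \<in> Z2_operators" and T: "T \<in> Z2_operators"
begin

lemma Z2_star_add: "Z2_star (\<lambda>u. S u + T u) = (\<lambda>u. Z2_star S u + Z2_star T u)"
  by (intro Z2_star_eqI op_plus Z2_star_op S T)
    (simp add: Zform_add_left Zform_add_right Zform_star S T)

lemma Z2_star_comp: "Z2_star (S \<circ> T) = Z2_star T \<circ> Z2_star S"
  by (intro Z2_star_eqI op_comp Z2_star_op S T) (simp add: Zform_star S T)

lemma Z2_star_smult: "Z2_star (\<lambda>u. Z2_scale c (T u)) = (\<lambda>u. Z2_scale (scalar_cnj c) (Z2_star T u))"
  by (intro Z2_star_eqI op_smult Z2_star_op T)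
    (simp add: Zform_scale_left Zform_scale_right Zform_star T)

end

lemma Z2_star_zero: "Z2_star (\<lambda>_. 0) = (\<lambda>_. 0 :: 'k::{real_or_complex,banach} Z2)"
  by (intro Z2_star_eqI op_zero) simp


section \<open>Sums of blocks\<close>

lemma disjoint_sum_apply:
  assumes F: "finite F" and A: "disjoint_family_on A F"
    and supp: "\<And>i. i \<in> F \<Longrightarrow> n \<notin> A i \<Longrightarrow> x i = 0" and h: "h 0 = 0"
  shows "h (\<Sum>i\<in>F. x i) = (\<Sum>i\<in>F. h (x i))"
proof (cases "\<exists>i\<in>F. n \<in> A i")
  case True
  then obtain i where i: "i \<in> F" "n \<in> A i" by auto
  have "x j = 0" if "j \<in> F - {i}" for j
    using A i that supp[of j] by (auto simp: disjoint_family_on_def)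
  then show ?thesis using F i h by (simp add: sum.remove)
qed (auto simp: supp h)

context
  fixes F :: "'i set" and A :: "'i \<Rightarrow> nat set" and x :: "'i \<Rightarrow> nat \<Rightarrow> 'k::real_normed_field"
  assumes F: "finite F" and A: "disjoint_family_on A F"
    and x: "\<And>i. i \<in> F \<Longrightarrow> x i \<in> ell2" and supp: "\<And>i n. i \<in> F \<Longrightarrow> n \<notin> A i \<Longrightarrow> x i n = 0"
begin

lemma norm2_disjoint_sum_le:
  assumes "\<And>i. i \<in> F \<Longrightarrow> norm2 (x i) \<le> K" "0 \<le> K"
  shows "norm2 (\<lambda>n. \<Sum>i\<in>F. x i n) \<le> sqrt (card F) * K"
proof (rule power2_le_imp_le)
  have "(norm2 (\<lambda>n. \<Sum>i\<in>F. x i n))\<^sup>2 = (\<Sum>i\<in>F. (norm2 (x i))\<^sup>2)"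
    by (rule norm2_disjoint_sum[OF F x A supp])
  also have "\<dots> \<le> (\<Sum>i\<in>F. K\<^sup>2)"
    by (intro sum_mono power_mono assms norm2_nonneg x)
  finally show "(norm2 (\<lambda>n. \<Sum>i\<in>F. x i n))\<^sup>2 \<le> (sqrt (card F) * K)\<^sup>2"
    by (simp add: power_mult_distrib)
qed (use assms in simp)

lemma norm2_disjoint_sum_ge:
  assumes "\<And>i. i \<in> F \<Longrightarrow> K \<le> norm2 (x i)" "0 \<le> K"
  shows "sqrt (card F) * K \<le> norm2 (\<lambda>n. \<Sum>i\<in>F. x i n)"
proof (rule power2_le_imp_le)
  have "(\<Sum>i\<in>F. K\<^sup>2) \<le> (\<Sum>i\<in>F. (norm2 (x i))\<^sup>2)"
    by (intro sum_mono power_mono assms)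
  also have "\<dots> = (norm2 (\<lambda>n. \<Sum>i\<in>F. x i n))\<^sup>2"
    by (rule norm2_disjoint_sum[OF F x A supp, symmetric])
  finally show "(sqrt (card F) * K)\<^sup>2 \<le> (norm2 (\<lambda>n. \<Sum>i\<in>F. x i n))\<^sup>2"
    by (simp add: power_mult_distrib)
qed (intro norm2_nonneg ell2_sum x)

end

context
  fixes F :: "'i set" and A :: "'i \<Rightarrow> nat set" and w :: "'i \<Rightarrow> 'k::{real_or_complex,banach} Z2"
  assumes F: "finite F" "F \<noteq> {}" and A: "disjoint_family_on A F"
    and suppx: "\<And>i n. i \<in> F \<Longrightarrow> n \<notin> A i \<Longrightarrow> Zx (w i) n = 0"
    and suppy: "\<And>i n. i \<in> F \<Longrightarrow> n \<notin> A i \<Longrightarrow> Zy (w i) n = 0"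
begin

lemma Zy_sum_eq: "Zy (\<Sum>i\<in>F. w i) = (\<lambda>n. \<Sum>i\<in>F. Zy (w i) n)"
  by auto

lemma suppd: "i \<in> F \<Longrightarrow> n \<notin> A i \<Longrightarrow> Zd (w i) n = 0"
  by (simp add: Zd_def suppx suppy Omega_eq_0)

text \<open>The map \<open>t * ln (norm t)\<close> vanishes at 0 and is therefore additive over
  disjoint supports. Only the norms inside the logarithms differ, and each block acquires its own
  scalar.\<close>

lemma Zd_block_sum:
  "Zd (\<Sum>i\<in>F. w i) n = (\<Sum>i\<in>F. Zd (w i) n)
    - (\<Sum>i\<in>F. of_real (ln (norm2 (Zy (\<Sum>i\<in>F. w i))) - ln (norm2 (Zy (w i)))) * Zy (w i) n)"
proof -
  have "(\<Sum>i\<in>F. Zy (w i) n) * of_real (ln (norm (\<Sum>i\<in>F. Zy (w i) n)))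
      = (\<Sum>i\<in>F. Zy (w i) n * of_real (ln (norm (Zy (w i) n))))"
    by (rule disjoint_sum_apply[OF F(1) A, where h = "\<lambda>t. t * of_real (ln (norm t))" and n = n])
      (auto simp: suppy)
  then show ?thesis
    by (simp add: Zd_def Omega_alt[OF Zy_ell2] sum_subtractf sum_distrib_right sum_distrib_left
        sum.distrib algebra_simps)
qed

text \<open>The source of the logarithm: the sum has norm at least \<open>sqrt (card F) * d\<close>
  in ell2 and each block at most \<open>C\<close>, so every scalar in \<open>Zd_block_sum\<close> is
  at least the logarithm stated. The \<open>Zd\<close> parts of the blocks cost only
  \<open>sqrt (card F) * C\<close>.\<close>

lemma block_sum_lower:
  assumes d: "0 < d" and C: "0 < C" and dC: "\<And>i. i \<in> F \<Longrightarrow> norm2 (Zd (w i)) \<le> C"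
    and y: "\<And>i. i \<in> F \<Longrightarrow> d \<le> norm2 (Zy (w i))" "\<And>i. i \<in> F \<Longrightarrow> norm2 (Zy (w i)) \<le> C"
  shows "sqrt (card F) * (d * ln (sqrt (card F) * d / C) - C) \<le> norm2 (Zd (\<Sum>i\<in>F. w i))"
proof (cases "ln (sqrt (card F) * d / C) \<le> 0")
  case True
  then have "d * ln (sqrt (card F) * d / C) - C \<le> 0"
    using d C by (smt (verit) mult_nonneg_nonpos)
  then have "sqrt (card F) * (d * ln (sqrt (card F) * d / C) - C) \<le> 0"
    by (intro mult_nonneg_nonpos) auto
  then show ?thesis using norm2_nonneg[OF Zd_ell2] by (rule order_trans)
next
  case False
  let ?L = "ln (sqrt (card F) * d / C)"
  define Y where "Y = norm2 (Zy (\<Sum>i\<in>F. w i))"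
  define l where "l i = ln Y - ln (norm2 (Zy (w i)))" for i
  have N: "card F > 0" using F by (simp add: card_gt_0_iff)
  have Y: "sqrt (card F) * d \<le> Y"
    unfolding Y_def Zy_sum_eq
    by (rule norm2_disjoint_sum_ge[OF F(1) A Zy_ell2 suppy]) (use y(1) d in auto)
  have l: "?L \<le> l i" if "i \<in> F" for i
  proof -
    have "0 < sqrt (card F) * d" using N d by simp
    then have "ln (sqrt (card F) * d) \<le> ln Y" using Y by (subst ln_le_cancel_iff) auto
    moreover have "ln (norm2 (Zy (w i))) \<le> ln C"
      using y[OF that] C d by (subst ln_le_cancel_iff) auto
    ultimately show ?thesis using N d C by (simp add: l_def ln_div)
  qed
  have 1: "sqrt (card F) * (?L * d) \<le> norm2 (\<lambda>n. \<Sum>i\<in>F. of_real (l i) * Zy (w i) n)"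
  proof (rule norm2_disjoint_sum_ge[OF F(1) A])
    fix i assume i: "i \<in> F"
    have "?L * d \<le> l i * norm2 (Zy (w i))"
      using l[OF i] y(1)[OF i] False d by (intro mult_mono) auto
    then show "?L * d \<le> norm2 (\<lambda>n. of_real (l i) * Zy (w i) n)"
      using l[OF i] False by (subst norm2_scale) (auto simp: Zy_ell2)
  qed (use False d in \<open>auto intro: ell2_scale Zy_ell2 simp: suppy\<close>)
  have 2: "norm2 (\<lambda>n. \<Sum>i\<in>F. Zd (w i) n) \<le> sqrt (card F) * C"
    by (rule norm2_disjoint_sum_le[OF F(1) A Zd_ell2 suppd]) (use dC C in auto)
  have "(\<lambda>n. \<Sum>i\<in>F. of_real (l i) * Zy (w i) n)
      = (\<lambda>n. (\<Sum>i\<in>F. Zd (w i) n) - Zd (\<Sum>i\<in>F. w i) n)"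
    by (rule ext) (simp add: Zd_block_sum l_def Y_def)
  then have "norm2 (\<lambda>n. \<Sum>i\<in>F. of_real (l i) * Zy (w i) n)
      \<le> norm2 (\<lambda>n. \<Sum>i\<in>F. Zd (w i) n) + norm2 (Zd (\<Sum>i\<in>F. w i))"
    by (simp only:) (intro norm2_triangle_diff ell2_sum Zd_ell2)
  with 1 2 show ?thesis by (simp add: algebra_simps)
qed

lemma block_sum_upper:
  assumes C: "0 \<le> C" "0 \<le> D"
    and dC: "\<And>i. i \<in> F \<Longrightarrow> norm2 (Zd (w i)) \<le> C" and yD: "\<And>i. i \<in> F \<Longrightarrow> norm2 (Zy (w i)) \<le> D"
  shows "norm2 (Zy (\<Sum>i\<in>F. w i)) \<le> sqrt (card F) * D"
    and "norm2 (Zd (\<Sum>i\<in>F. w i)) \<le> sqrt (card F) * (C + D * (ln (sqrt (card F)) + 1))"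
proof -
  define Y where "Y = norm2 (Zy (\<Sum>i\<in>F. w i))"
  define l where "l i = ln Y - ln (norm2 (Zy (w i)))" for i
  have N: "card F \<ge> 1" using F by (simp add: Suc_leI card_gt_0_iff)
  then have L: "0 \<le> ln (sqrt (card F))" by simp
  show Y: "norm2 (Zy (\<Sum>i\<in>F. w i)) \<le> sqrt (card F) * D"
    unfolding Zy_sum_eq
    by (rule norm2_disjoint_sum_le[OF F(1) A Zy_ell2 suppy]) (use yD C in auto)
  have l: "norm2 (\<lambda>n. of_real (l i) * Zy (w i) n) \<le> D * (ln (sqrt (card F)) + 1)" if "i \<in> F" for i
  proof (cases "norm2 (Zy (w i)) = 0")
    case True
    then show ?thesis using C L by (subst norm2_scale) (auto simp: Zy_ell2)
  next
    case False
    let ?r = "norm2 (Zy (w i))"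
    have r: "?r > 0" using False norm2_nonneg[OF Zy_ell2, of "w i"] by simp
    have rD: "?r \<le> D" by (rule yD[OF that])
    have rY: "?r \<le> Y"
    proof (rule power2_le_imp_le)
      have "Y\<^sup>2 = (\<Sum>i\<in>F. (norm2 (Zy (w i)))\<^sup>2)"
        unfolding Y_def Zy_sum_eq by (rule norm2_disjoint_sum[OF F(1) Zy_ell2 A suppy])
      also have "\<dots> \<ge> ?r\<^sup>2" using F(1) that by (intro member_le_sum) auto
      finally show "?r\<^sup>2 \<le> Y\<^sup>2" .
    qed (simp add: Y_def norm2_nonneg Zy_ell2)
    have "ln Y \<le> ln (sqrt (card F) * D)" using Y r rY by (simp add: Y_def)
    also have "\<dots> = ln (sqrt (card F)) + ln D" using N r rD by (simp add: ln_mult)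
    finally have "?r * l i \<le> ?r * (ln (sqrt (card F)) + (ln D - ln ?r))"
      unfolding l_def using r by (intro mult_left_mono) auto
    \<comment> \<open>For a block much smaller than \<open>D\<close> the second logarithm is large,
      but it carries the weight \<open>?r\<close>, and the product is at most
      \<open>D - ?r\<close>.\<close>
    also have "\<dots> = ?r * ln (sqrt (card F)) + ?r * (ln D - ln ?r)" by (simp add: algebra_simps)
    also have "\<dots> \<le> D * ln (sqrt (card F)) + (D - ?r)"
      using rD L r by (intro add_mono mult_right_mono mult_ln_diff_le) auto
    also have "\<dots> \<le> D * (ln (sqrt (card F)) + 1)" using r by (simp add: algebra_simps)
    finally have "?r * l i \<le> D * (ln (sqrt (card F)) + 1)" .
    moreover have "0 \<le> l i" using r rY by (simp add: l_def)
    ultimately show ?thesis by (subst norm2_scale) (auto simp: Zy_ell2 mult.commute)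
  qed
  have "norm2 (\<lambda>n. \<Sum>i\<in>F. of_real (l i) * Zy (w i) n) \<le> sqrt (card F) * (D * (ln (sqrt (card F)) + 1))"
    by (rule norm2_disjoint_sum_le[OF F(1) A])
      (use l C L in \<open>auto intro: ell2_scale Zy_ell2 simp: suppy\<close>)
  moreover have "norm2 (\<lambda>n. \<Sum>i\<in>F. Zd (w i) n) \<le> sqrt (card F) * C"
    by (rule norm2_disjoint_sum_le[OF F(1) A Zd_ell2 suppd]) (use dC C in auto)
  moreover have "Zd (\<Sum>i\<in>F. w i) = (\<lambda>n. (\<Sum>i\<in>F. Zd (w i) n) - (\<Sum>i\<in>F. of_real (l i) * Zy (w i) n))"
    by (rule ext) (simp add: Zd_block_sum l_def Y_def)
  then have "norm2 (Zd (\<Sum>i\<in>F. w i))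
      \<le> norm2 (\<lambda>n. \<Sum>i\<in>F. Zd (w i) n) + norm2 (\<lambda>n. \<Sum>i\<in>F. of_real (l i) * Zy (w i) n)"
    by (simp only:) (intro norm2_triangle_diff ell2_sum ell2_scale Zd_ell2 Zy_ell2)
  ultimately show "norm2 (Zd (\<Sum>i\<in>F. w i)) \<le> sqrt (card F) * (C + D * (ln (sqrt (card F)) + 1))"
    by (simp add: algebra_simps)
qed

end


section \<open>Gliding humps\<close>

definition ell2_tail :: "nat \<Rightarrow> (nat \<Rightarrow> 'k::real_normed_field) set" where
  "ell2_tail n = {x \<in> ell2. \<forall>i<n. x i = 0}"

definition Ztail :: "nat \<Rightarrow> 'k::real_normed_field Z2 set" where
  "Ztail n = {u. \<forall>i<n. Zx u i = 0 \<and> Zy u i = 0}"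

text \<open>Coordinatewise convergence plays the part of weak convergence to 0; it is all that the
  extraction of humps needs.\<close>

definition coord_null :: "(nat \<Rightarrow> 'k::real_normed_field Z2) \<Rightarrow> bool" where
  "coord_null u \<longleftrightarrow> (\<forall>n. (\<lambda>k. Zx (u k) n) \<longlonglongrightarrow> 0 \<and> (\<lambda>k. Zy (u k) n) \<longlonglongrightarrow> 0)"

lemma ell2_tail_ell2: "x \<in> ell2_tail n \<Longrightarrow> x \<in> ell2"
  by (simp add: ell2_tail_def)

lemma ell2_tail_scale: "x \<in> ell2_tail n \<Longrightarrow> (\<lambda>i. c * x i) \<in> ell2_tail n"
  by (simp add: ell2_tail_def ell2_scale)

lemma ell2_tail_antimono: "m \<le> n \<Longrightarrow> ell2_tail n \<subseteq> ell2_tail m"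
  by (auto simp: ell2_tail_def)

lemma Ztail_Zd: "u \<in> Ztail n \<Longrightarrow> Zd u \<in> ell2_tail n"
  by (auto simp: Ztail_def ell2_tail_def Zd_ell2 Zd_def Omega_eq_0)

lemma Ztail_Zj: "x \<in> ell2_tail n \<Longrightarrow> Zj x \<in> Ztail n"
  by (auto simp: Ztail_def ell2_tail_def)

lemma Ztail_scale: "u \<in> Ztail n \<Longrightarrow> Z2_scale c u \<in> Ztail n"
  by (simp add: Ztail_def)

lemma Ztail_antimono: "m \<le> n \<Longrightarrow> Ztail n \<subseteq> Ztail m"
  by (auto simp: Ztail_def)

lemma Zrestr_Ztail: "Zrestr {n..} u \<in> Ztail n"
  by (simp add: Ztail_def restr_def)

lemma Zform_Ztail:
  assumes "u \<in> Ztail n"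
  shows "Zform u v = Zform u (Zrestr {n..} v)"
proof -
  have "Zterm u v = Zterm u (Zrestr {n..} v)"
    using assms by (auto simp: Ztail_def Zterm_def restr_def fun_eq_iff)
  then show ?thesis by (simp add: Zform_def)
qed

lemma coord_null_Ztail:
  assumes "\<And>k. u k \<in> Ztail k"
  shows "coord_null u"
proof -
  have "\<forall>\<^sub>F k in sequentially. Zx (u k) n = 0 \<and> Zy (u k) n = 0" for n
    using assms by (auto simp: Ztail_def eventually_at_top_linorder intro!: exI[of _ "Suc n"])
  then show ?thesis
    unfolding coord_null_def eventually_conj_iff by (auto intro!: tendsto_eventually)
qed

text \<open>The adjoint moves \<open>T\<close> onto the fixed test vector \<open>v\<close>, of which
  a vector in \<open>Ztail k\<close> sees only the tail, and this tends to 0.\<close>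

lemma coord_null_op:
  assumes T: "T \<in> Z2_operators" and u: "\<And>k. u k \<in> Ztail k" "\<And>k. Znorm (u k) \<le> C"
  shows "coord_null (\<lambda>k. T (u k))"
proof -
  have form: "(\<lambda>k. norm (Zform v (T (u k)))) \<longlonglongrightarrow> 0" for v
  proof (rule tendsto_sandwich[OF _ _ tendsto_const])
    show "(\<lambda>k. C * Z2_qnorm (Zrestr {k..} (Z2_star T v))) \<longlonglongrightarrow> 0"
      using tendsto_mult_right_zero[OF qnorm_tail_tendsto, of C "Z2_star T v"] .
    have "norm (Zform v (T (u k))) \<le> C * Z2_qnorm (Zrestr {k..} (Z2_star T v))" for k
    proof -
      have "norm (Zform v (T (u k))) = norm (Zform (u k) (Zrestr {k..} (Z2_star T v)))"
        by (simp add: norm_Zform_commute[of v] Zform_star[OF T] Zform_Ztail[OF u(1), symmetric])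
      also have "\<dots> \<le> Znorm (u k) * Z2_qnorm (Zrestr {k..} (Z2_star T v))" by (rule norm_Zform_le)
      also have "\<dots> \<le> C * Z2_qnorm (Zrestr {k..} (Z2_star T v))"
        by (intro mult_right_mono u Z2_qnorm_nonneg)
      finally show ?thesis .
    qed
    then show "\<forall>\<^sub>F k in sequentially. norm (Zform v (T (u k)))
        \<le> C * Z2_qnorm (Zrestr {k..} (Z2_star T v))" by simp
  qed auto
  show ?thesis
    unfolding coord_null_def
    using form[of "Zj (Zunit n)" for n] form[of "Zw (Zunit n)" for n]
    by (auto simp: Zform_Zj_unit Zform_Zw_unit tendsto_norm_zero_iff)
qed

lemma coord_null_initial:
  fixes u :: "nat \<Rightarrow> 'k::{real_or_complex,banach} Z2"
  assumes "coord_null u"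
  shows "(\<lambda>k. Znorm (Zrestr {..<n} (u k))) \<longlonglongrightarrow> 0"
proof (rule tendsto_sandwich[OF _ _ tendsto_const])
  let ?g = "\<lambda>k. \<Sum>i<n. norm (Zx (u k) i) + norm (Zy (u k) i) * 2"
  show "\<forall>\<^sub>F k in sequentially. Znorm (Zrestr {..<n} (u k)) \<le> ?g k" by (simp add: Znorm_initial_le)
  have "?g \<longlonglongrightarrow> (\<Sum>i<n. norm (0 :: 'k) + norm (0 :: 'k) * 2)"
    using assms by (intro tendsto_intros) (auto simp: coord_null_def)
  then show "?g \<longlonglongrightarrow> 0" by simp
qed auto

text \<open>One choice of indices and cut points serves both sequences, because later
  \<open>v\<close> consists of the images of \<open>u\<close> and the two are compared block by
  block. The choice alternates: an index whose part before the present cut is small, then a cut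
  beyond which both vectors are small.\<close>

lemma gliding_hump_blocks:
  fixes u v :: "nat \<Rightarrow> 'k::{real_or_complex,banach} Z2"
  assumes "coord_null u" "coord_null v" and \<eta>: "\<And>i. \<eta> i > 0"
  obtains \<kappa> m :: "nat \<Rightarrow> nat" where "strict_mono \<kappa>" "strict_mono m"
    "\<And>i. Znorm (u (\<kappa> i) - Zrestr {m i..<m (Suc i)} (u (\<kappa> i))) < \<eta> i"
    "\<And>i. Znorm (v (\<kappa> i) - Zrestr {m i..<m (Suc i)} (v (\<kappa> i))) < \<eta> i"
proof -
  \<comment> \<open>\<open>P\<close> controls the part before the cut of the present state,
    \<open>Q\<close> the part after the next cut; half of the tolerance goes to each.\<close>
  define P where "P i s \<longleftrightarrow> (case s of (k, m) \<Rightarrow> Znorm (Zrestr {..<m} (u k)) < \<eta> i / 2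
      \<and> Znorm (Zrestr {..<m} (v k)) < \<eta> i / 2)" for i :: nat and s :: "nat \<times> nat"
  define Q where "Q i s s' \<longleftrightarrow> (case s of (k, m) \<Rightarrow> case s' of (k', m') \<Rightarrow> k < k' \<and> m < m'
      \<and> Znorm (Zrestr {m'..} (u k)) < \<eta> i / 2 \<and> Znorm (Zrestr {m'..} (v k)) < \<eta> i / 2)"
    for i :: nat and s s' :: "nat \<times> nat"
  have "\<exists>f. \<forall>i. P i (f i) \<and> Q i (f i) (f (Suc i))"
  proof (rule dependent_nat_choice)
    have "Zrestr {..<0} w = 0" for w :: "'k Z2" by (rule Z2_eqI) (auto simp: restr_def)
    then show "\<exists>s. P 0 s" by (auto simp: P_def \<eta> intro!: exI[of _ 0])
  next
    fix s i assume "P i s"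
    obtain k m where s: "s = (k, m)" by fastforce
    have "\<forall>\<^sub>F m' in sequentially. m < m' \<and> Znorm (Zrestr {m'..} (u k)) < \<eta> i / 2
        \<and> Znorm (Zrestr {m'..} (v k)) < \<eta> i / 2"
      using \<eta>[of i] by (intro eventually_conj eventually_gt_at_top order_tendstoD(2)[OF Znorm_tail_tendsto]) auto
    then obtain m' where m': "m < m'" "Znorm (Zrestr {m'..} (u k)) < \<eta> i / 2"
        "Znorm (Zrestr {m'..} (v k)) < \<eta> i / 2"
      by (auto simp: eventually_at_top_linorder)
    have "\<forall>\<^sub>F k' in sequentially. k < k' \<and> Znorm (Zrestr {..<m'} (u k')) < \<eta> (Suc i) / 2
        \<and> Znorm (Zrestr {..<m'} (v k')) < \<eta> (Suc i) / 2"
      using \<eta>[of "Suc i"] by (intro eventually_conj eventually_gt_at_top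
        order_tendstoD(2)[OF coord_null_initial] assms) auto
    then obtain k' where "k < k'" "Znorm (Zrestr {..<m'} (u k')) < \<eta> (Suc i) / 2"
        "Znorm (Zrestr {..<m'} (v k')) < \<eta> (Suc i) / 2"
      by (auto simp: eventually_at_top_linorder)
    with m' show "\<exists>s'. P (Suc i) s' \<and> Q i s s'"
      by (intro exI[of _ "(k', m')"]) (auto simp: P_def Q_def s)
  qed
  then obtain f where f: "\<And>i. P i (f i)" "\<And>i. Q i (f i) (f (Suc i))" by blast
  define \<kappa> m where "\<kappa> = fst \<circ> f" and "m = snd \<circ> f"
  have *: "Znorm (w - Zrestr {a..<b} w) < e"
    if "Znorm (Zrestr {..<a} w) < e / 2" "Znorm (Zrestr {b..} w) < e / 2" "a < b"
    for a b :: nat and e and w :: "'k Z2"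
  proof -
    have "w - Zrestr {a..<b} w = Zrestr {..<a} w + Zrestr {b..} w"
      using that by (intro Z2_eqI) (auto simp: restr_def)
    then show ?thesis using Znorm_triangle[of "Zrestr {..<a} w" "Zrestr {b..} w"] that by simp
  qed
  show thesis
  proof (rule that)
    show "strict_mono \<kappa>" "strict_mono m"
      using f(2) by (auto simp: strict_mono_Suc_iff \<kappa>_def m_def Q_def case_prod_unfold)
    show "Znorm (u (\<kappa> i) - Zrestr {m i..<m (Suc i)} (u (\<kappa> i))) < \<eta> i"
      "Znorm (v (\<kappa> i) - Zrestr {m i..<m (Suc i)} (v (\<kappa> i))) < \<eta> i" for i
      using f(1)[of i] f(2)[of i] by (auto simp: P_def Q_def \<kappa>_def m_def case_prod_unfold intro!: *)
  qed
qed

lemma disjoint_family_intervals: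
  assumes "strict_mono (m :: nat \<Rightarrow> nat)"
  shows "disjoint_family_on (\<lambda>i. {m i..<m (Suc i)}) F"
proof (rule disjoint_family_on_mono[of F UNIV], simp)
  have "{m i..<m (Suc i)} \<inter> {m j..<m (Suc j)} = {}" if "i < j" for i j
    using strict_mono_less_eq[OF assms, of "Suc i" j] that by auto
  then show "disjoint_family_on (\<lambda>i. {m i..<m (Suc i)}) UNIV"
    unfolding disjoint_family_on_def by (metis Int_commute nat_neq_iff)
qed

lemma geometric_weights:
  fixes h :: real
  assumes "h > 0"
  shows "h / 2 ^ Suc i > 0" "h / 2 ^ Suc i \<le> h" "finite F \<Longrightarrow> (\<Sum>i\<in>F. h / 2 ^ Suc i) \<le> h"
proof -
  have "1 \<le> (2 :: real) ^ Suc i" by (rule one_le_power) simp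
  then show "h / 2 ^ Suc i > 0" "h / 2 ^ Suc i \<le> h"
    using assms mult_left_mono[of 1 "2 ^ Suc i" h] by (auto simp: divide_le_eq)
  have "(\<lambda>i. h * (1 / 2) ^ Suc i) sums (h * 1)" by (intro sums_mult power_half_series)
  then have s: "(\<lambda>i. h / 2 ^ Suc i) sums h" by (simp add: power_one_over field_simps)
  show "(\<Sum>i\<in>F. h / 2 ^ Suc i) \<le> h" if "finite F"
    using sum_le_suminf[OF sums_summable[OF s] that] sums_unique[OF s] assms by simp
qed

text \<open>The constants \<open>a\<close> and \<open>b\<close> do not depend on \<open>N\<close> or
  \<open>n0\<close>. \<open>D\<close> is kept apart from \<open>C\<close> because it is the only
  factor of the logarithm in the upper bound: for \<open>D = 0\<close> the sums of \<open>u\<close>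
  grow like \<open>sqrt N\<close>, while those of \<open>v\<close> still grow like
  \<open>sqrt N * ln N\<close>.\<close>

lemma gliding_hump_sum:
  fixes u v :: "nat \<Rightarrow> 'k::{real_or_complex,banach} Z2"
  assumes null: "coord_null u" "coord_null v" and C: "0 < C" and D: "0 \<le> D" and d: "0 < d"
    and u: "\<And>k. Znorm (u k) \<le> C" "\<And>k. norm2 (Zy (u k)) \<le> D"
    and v: "\<And>k. Znorm (v k) \<le> C" "\<And>k. d \<le> norm2 (Zy (v k))"
  obtains a b where "a > 0"
    and "\<And>n0 N. N \<ge> 1 \<Longrightarrow> \<exists>F w. finite F \<and> w \<in> Ztail n0
      \<and> Znorm ((\<Sum>k\<in>F. u k) - w) \<le> 1
      \<and> norm2 (Zy w) \<le> sqrt (real N) * D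
      \<and> norm2 (Zd w) \<le> sqrt (real N) * (4 * C + D * (ln (real N) / 2 + 1))
      \<and> sqrt (real N) * (a * ln (real N) - b) \<le> Znorm (\<Sum>k\<in>F. v k)"
proof -
  \<comment> \<open>The bound 1 limits the total perturbation of a sum; the bound
    \<open>d / 2\<close> preserves half of the lower bound for \<open>Zy\<close> on each
    block.\<close>
  define h where "h = min 1 (d / 2)"
  define \<eta> where "\<eta> i = h / 2 ^ Suc i" for i :: nat
  have h: "0 < h" "h \<le> 1" "h \<le> d / 2" using d by (auto simp: h_def)
  have \<eta>: "\<eta> i > 0" "\<eta> i \<le> h" for i using geometric_weights(1,2)[OF h(1)] by (auto simp: \<eta>_def)
  have \<eta>sum: "(\<Sum>i\<in>{n0..<n0 + N}. \<eta> i) \<le> 1" for n0 N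
    using order_trans[OF geometric_weights(3)[OF h(1)] h(2)] by (simp add: \<eta>_def)
  obtain \<kappa> m :: "nat \<Rightarrow> nat" where \<kappa>: "strict_mono \<kappa>" and m: "strict_mono m"
    and ub: "\<And>i. Znorm (u (\<kappa> i) - Zrestr {m i..<m (Suc i)} (u (\<kappa> i))) < \<eta> i"
    and vb: "\<And>i. Znorm (v (\<kappa> i) - Zrestr {m i..<m (Suc i)} (v (\<kappa> i))) < \<eta> i"
    using gliding_hump_blocks[OF null, of \<eta>] \<eta> by metis
  define A where "A i = {m i..<m (Suc i)}" for i
  define uu where "uu i = Zrestr (A i) (u (\<kappa> i))" for i
  define vv where "vv i = Zrestr (A i) (v (\<kappa> i))" for i
  have A: "disjoint_family_on A F" for F unfolding A_def by (rule disjoint_family_intervals[OF m])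
  have "Z2_qnorm (Zrestr B w) \<le> 4 * C" if "Znorm w \<le> C" for B and w :: "'k Z2"
    using qnorm_Zrestr_le[of B w] qnorm_le_Znorm[of w] that by linarith
  then have q: "Z2_qnorm (uu i) \<le> 4 * C" "Z2_qnorm (vv i) \<le> 4 * C" for i
    using u(1) v(1) by (auto simp: uu_def vv_def)
  have nn: "norm2 (Zd w) \<le> Z2_qnorm w" "norm2 (Zy w) \<le> Z2_qnorm w" for w :: "'k Z2"
    by (auto simp: Z2_qnorm_eq norm2_nonneg Zd_ell2 Zy_ell2)
  have vlow: "d / 2 \<le> norm2 (Zy (vv i))" for i
  proof -
    have "Zy (v (\<kappa> i)) = (\<lambda>n. Zy (vv i) n + Zy (v (\<kappa> i) - vv i) n)" by auto
    then have "norm2 (Zy (v (\<kappa> i))) \<le> norm2 (Zy (vv i)) + norm2 (Zy (v (\<kappa> i) - vv i))"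
      by (simp only:) (intro norm2_triangle Zy_ell2)
    also have "norm2 (Zy (v (\<kappa> i) - vv i)) \<le> d / 2"
      using norm2_Zy_le[of "v (\<kappa> i) - vv i"] vb[of i] \<eta>(2)[of i] h unfolding vv_def A_def by linarith
    finally show ?thesis using v(2)[of "\<kappa> i"] by simp
  qed
  have yup: "norm2 (Zy (uu i)) \<le> D" for i
    using norm2_restr_le[OF Zy_ell2, of "A i" "u (\<kappa> i)"] u(2)[of "\<kappa> i"] by (simp add: uu_def)
  have sums: "(\<Sum>k\<in>\<kappa> ` {n0..<n0 + N}. x k) = (\<Sum>i\<in>{n0..<n0 + N}. x (\<kappa> i))"
    for n0 N and x :: "nat \<Rightarrow> 'k Z2"
    using strict_mono_imp_inj_on[OF \<kappa>] by (intro sum.reindex_cong[of \<kappa>]) (auto intro: inj_on_subset)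
  have err: "Znorm ((\<Sum>k\<in>\<kappa> ` {n0..<n0 + N}. x k) - (\<Sum>i\<in>{n0..<n0 + N}. y i)) \<le> 1"
    if "\<And>i. Znorm (x (\<kappa> i) - y i) < \<eta> i" for n0 N and x y :: "nat \<Rightarrow> 'k Z2"
  proof -
    have "Znorm ((\<Sum>k\<in>\<kappa> ` {n0..<n0 + N}. x k) - (\<Sum>i\<in>{n0..<n0 + N}. y i))
        \<le> (\<Sum>i\<in>{n0..<n0 + N}. Znorm (x (\<kappa> i) - y i))"
      unfolding sums sum_subtractf[symmetric] by (rule Znorm_sum)
    also have "\<dots> \<le> (\<Sum>i\<in>{n0..<n0 + N}. \<eta> i)" by (intro sum_mono less_imp_le that)
    finally show ?thesis using \<eta>sum order_trans by blast
  qed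
  \<comment> \<open>The slope \<open>d / 12\<close> below is 1/3 from \<open>norm2_Zd_le\<close>,
    times \<open>d / 2\<close> for the blocks, times 1/2 from \<open>ln (sqrt N)\<close>. The
    summand 1 in \<open>b\<close> absorbs the perturbation error, as
    \<open>1 \<le> sqrt N\<close>.\<close>
  define b where "b = 4 * C / 3 + 1 - d / 6 * ln (d / (8 * C))"
  show thesis
  proof (rule that[of "d / 12" b])
    fix n0 N :: nat assume N: "N \<ge> 1"
    let ?I = "{n0..<n0 + N}"
    have I: "finite ?I" "?I \<noteq> {}" "card ?I = N" using N by auto
    have supp: "Zx (uu i) n = 0" "Zy (uu i) n = 0" "Zx (vv i) n = 0" "Zy (vv i) n = 0"
      if "n \<notin> A i" for i n using that by (auto simp: uu_def vv_def restr_def)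
    have lnN: "ln (sqrt (real N)) = ln (real N) / 2" using N by (simp add: ln_sqrt)
    \<comment> \<open>A strictly increasing \<open>m\<close> has \<open>m i \<ge> i\<close>, so
      taking the blocks from number \<open>n0\<close> on puts their sum into
      \<open>Ztail n0\<close>.\<close>
    have "n \<notin> A i" if "n < n0" "i \<ge> n0" for i n
      using strict_mono_imp_increasing[OF m, of i] that by (simp add: A_def)
    then have tail: "(\<Sum>i\<in>?I. uu i) \<in> Ztail n0"
      by (auto simp: Ztail_def supp intro!: sum.neutral)
    have up: "norm2 (Zy (\<Sum>i\<in>?I. uu i)) \<le> sqrt (card ?I) * D"
      "norm2 (Zd (\<Sum>i\<in>?I. uu i)) \<le> sqrt (card ?I) * (4 * C + D * (ln (sqrt (card ?I)) + 1))"
      by (rule block_sum_upper[OF I(1,2) A, where C = "4 * C" and D = D]; use C D supp yup order_trans[OF nn(1) q(1)] in auto)+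
    have "sqrt (card ?I) * (d / 2 * ln (sqrt (card ?I) * (d / 2) / (4 * C)) - 4 * C)
        \<le> norm2 (Zd (\<Sum>i\<in>?I. vv i))"
      by (rule block_sum_lower[OF I(1,2) A])
        (use C d supp vlow order_trans[OF nn(1) q(2)] order_trans[OF nn(2) q(2)] in auto)
    also have "\<dots> \<le> 3 * Znorm (\<Sum>i\<in>?I. vv i)" by (rule norm2_Zd_le)
    also have "Znorm (\<Sum>i\<in>?I. vv i) \<le> Znorm (\<Sum>k\<in>\<kappa> ` ?I. v k) + 1"
      using Znorm_le_add_diff[of "\<Sum>i\<in>?I. vv i" "\<Sum>k\<in>\<kappa> ` ?I. v k"] err[of v vv n0 N] vb
      by (simp add: vv_def A_def Znorm_commute[of "\<Sum>i\<in>?I. _ i"])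
    finally have low: "sqrt N * (d / 2 * ln (sqrt N * (d / 2) / (4 * C)) - 4 * C)
        \<le> 3 * (Znorm (\<Sum>k\<in>\<kappa> ` ?I. v k) + 1)" using I by simp
    have "ln (sqrt N * (d / 2) / (4 * C)) = ln (sqrt N * (d / (8 * C)))" by simp
    also have "\<dots> = ln N / 2 + ln (d / (8 * C))" using N C d by (subst ln_mult) (auto simp: lnN)
    finally have "sqrt N * (d / 12 * ln N + d / 6 * ln (d / (8 * C)) - 4 * C / 3)
        \<le> Znorm (\<Sum>k\<in>\<kappa> ` ?I. v k) + 1" using low by (simp add: algebra_simps)
    moreover have "1 \<le> sqrt N" using N by simp
    moreover have "sqrt N * (d / 12 * ln N - b)
        = sqrt N * (d / 12 * ln N + d / 6 * ln (d / (8 * C)) - 4 * C / 3) - sqrt N"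
      by (simp add: b_def algebra_simps)
    ultimately have "sqrt N * (d / 12 * ln N - b) \<le> Znorm (\<Sum>k\<in>\<kappa> ` ?I. v k)" by linarith
    then show "\<exists>F w. finite F \<and> w \<in> Ztail n0 \<and> Znorm ((\<Sum>k\<in>F. u k) - w) \<le> 1
      \<and> norm2 (Zy w) \<le> sqrt (real N) * D
      \<and> norm2 (Zd w) \<le> sqrt (real N) * (4 * C + D * (ln (real N) / 2 + 1))
      \<and> sqrt (real N) * (d / 12 * ln (real N) - b) \<le> Znorm (\<Sum>k\<in>F. v k)"
      using up tail err[of u uu n0 N] ub I lnN
      by (intro exI[of _ "\<kappa> ` ?I"] exI[of _ "\<Sum>i\<in>?I. uu i"]) (auto simp: uu_def A_def)
  qed (use d in simp)
qed


section \<open>The essential size of an operator\<close>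

text \<open>Bounds the operator from ell2 obtained by composing \<open>T\<close> with
  \<open>Zj\<close>, up to finitely many coordinates. As ell2 is a Hilbert space,
  \<open>ess_zero\<close> below says that this composition is compact.\<close>

definition ess_le :: "real \<Rightarrow> ('k::{real_or_complex,banach} Z2 \<Rightarrow> 'k Z2) \<Rightarrow> bool" where
  "ess_le c T \<longleftrightarrow> (\<exists>n. \<forall>x\<in>ell2_tail n. Znorm (T (Zj x)) \<le> c * norm2 x)"

definition ess_zero :: "('k::{real_or_complex,banach} Z2 \<Rightarrow> 'k Z2) \<Rightarrow> bool" where
  "ess_zero T \<longleftrightarrow> (\<forall>e>0. ess_le e T)"

lemma sqrt_mult_ln_dominates:
  fixes a b c :: real
  assumes "a > 0"
  shows "\<exists>N\<ge>1. sqrt (real N) * (a * ln (real N) - b) > c"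
proof -
  obtain N :: nat where N: "real N \<ge> exp ((\<bar>b\<bar> + \<bar>c\<bar> + 1) / a)" using real_arch_simple by blast
  then have N1: "real N \<ge> 1" using assms by (smt (verit) one_le_exp_iff divide_nonneg_pos)
  have "(\<bar>b\<bar> + \<bar>c\<bar> + 1) / a \<le> ln (real N)" using N N1 by (subst ln_ge_iff) auto
  then have "\<bar>b\<bar> + \<bar>c\<bar> + 1 \<le> a * ln (real N)" using assms by (simp add: field_simps)
  then have *: "\<bar>c\<bar> + 1 \<le> a * ln (real N) - b" by linarith
  have "1 * (a * ln (real N) - b) \<le> sqrt (real N) * (a * ln (real N) - b)"
    using N1 * by (intro mult_right_mono) auto
  moreover have "c < \<bar>c\<bar> + 1" using abs_ge_self[of c] by (simp add: le_less_trans)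
  then have "c < 1 * (a * ln (real N) - b)" using * by simp
  ultimately have "sqrt (real N) * (a * ln (real N) - b) > c" by (rule order_less_le_trans[rotated])
  then show ?thesis using N1 by (intro exI[of _ N]) auto
qed

section \<open>Smallness of the quotient component on tails\<close>

lemma Znorm_op_le_parts:
  assumes T: "T \<in> Z2_operators" and K: "0 \<le> K" "\<And>u. Znorm (T u) \<le> K * Znorm u"
  shows "Znorm (T u) \<le> Znorm (T (Zj (Zd u))) + K * (2 * norm2 (Zy u))"
proof -
  have "T u = T (Zj (Zd u)) + T (Zw (Zy u))" by (subst Z2_decompose) (rule op_add[OF T])
  then have "Znorm (T u) \<le> Znorm (T (Zj (Zd u))) + Znorm (T (Zw (Zy u)))"
    using Znorm_triangle by metis
  also have "Znorm (T (Zw (Zy u))) \<le> K * (2 * norm2 (Zy u))"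
    using K by (intro order_trans[OF K(2)] mult_left_mono Znorm_Zw_le Zy_ell2)
  finally show ?thesis by simp
qed

text \<open>The images of hump sums would grow like \<open>sqrt N * (a * ln N)\<close>. The sums
  themselves have no logarithm if \<open>D = 0\<close>; otherwise it sits in their \<open>Zd\<close>
  part, where \<open>ess_zero T\<close> makes \<open>T\<close> as small as desired. Either way a
  large \<open>N\<close> is contradictory.\<close>

lemma no_hump:
  assumes T: "T \<in> Z2_operators"
    and u: "\<And>k. u k \<in> Ztail k" "\<And>k. Znorm (u k) \<le> C" and D: "\<And>k. norm2 (Zy (u k)) \<le> D"
    and d: "d > 0" "\<And>k. d \<le> norm2 (Zy (T (u k)))"
    and ess: "D = 0 \<or> ess_zero T"
  shows False
proof -
  obtain K where K: "K > 0" "\<And>u. Znorm (T u) \<le> K * Znorm u" using op_bounded[OF T] by blast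
  define C' where "C' = max C (K * C) + 1"
  have C0: "0 \<le> C" using order_trans[OF Znorm_nonneg u(2)] .
  have D0: "0 \<le> D" using order_trans[OF norm2_nonneg[OF Zy_ell2] D] .
  have C': "0 < C'" "C \<le> C'" "K * C \<le> C'" using C0 by (auto simp: C'_def)
  have TC: "Znorm (T (u k)) \<le> C'" for k
    using order_trans[OF K(2)[of "u k"] mult_left_mono[OF u(2)[of k] less_imp_le[OF K(1)]]] C'(3)
    by linarith
  have uC: "Znorm (u k) \<le> C'" for k using u(2)[of k] C'(2) by linarith
  obtain a b where a: "a > 0" and ab: "\<And>n0 N. N \<ge> 1 \<Longrightarrow> \<exists>F w. finite F \<and> w \<in> Ztail n0
      \<and> Znorm ((\<Sum>k\<in>F. u k) - w) \<le> 1
      \<and> norm2 (Zy w) \<le> sqrt (real N) * D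
      \<and> norm2 (Zd w) \<le> sqrt (real N) * (4 * C' + D * (ln (real N) / 2 + 1))
      \<and> sqrt (real N) * (a * ln (real N) - b) \<le> Znorm (\<Sum>k\<in>F. T (u k))"
    by (rule gliding_hump_sum[OF coord_null_Ztail[of u, OF u(1)] coord_null_op[OF T u] C'(1) D0 d(1)
        uC D TC d(2)]) blast
  \<comment> \<open>With \<open>\<theta> * D \<le> a\<close> the logarithmic part of
    \<open>T w\<close> has slope at most \<open>a / 2\<close>, half of the slope of the lower bound.
    For \<open>D = 0\<close> the plain operator bound \<open>K\<close> is good enough.\<close>
  obtain \<theta> n0 where \<theta>: "0 \<le> \<theta>" "\<theta> * D \<le> a"
    and n0: "\<And>x. x \<in> ell2_tail n0 \<Longrightarrow> Znorm (T (Zj x)) \<le> \<theta> * norm2 x"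
  proof (cases "D = 0")
    case True
    have "Znorm (T (Zj x)) \<le> K * norm2 x" if "x \<in> ell2_tail 0" for x
      using K(2)[of "Zj x"] that by (simp add: Znorm_Zj ell2_tail_ell2)
    then show ?thesis using that[of K 0] True a K(1) by auto
  next
    case False
    then have Dp: "D > 0" using D0 by simp
    have "ess_le (a / D) T" using ess False a Dp by (auto simp: ess_zero_def)
    then show ?thesis using that[of "a / D"] a Dp by (auto simp: ess_le_def)
  qed
  define c where "c = \<theta> * 4 * C' + a + K * (2 * D)"
  obtain N where N: "N \<ge> 1" "sqrt (real N) * (a / 2 * ln (real N) - (b + c)) > K"
    using sqrt_mult_ln_dominates[of "a / 2" K "b + c"] a by auto
  obtain F w where F: "finite F" and w: "w \<in> Ztail n0" and uw: "Znorm ((\<Sum>k\<in>F. u k) - w) \<le> 1"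
    and yw: "norm2 (Zy w) \<le> sqrt (real N) * D"
    and dw: "norm2 (Zd w) \<le> sqrt (real N) * (4 * C' + D * (ln (real N) / 2 + 1))"
    and low: "sqrt (real N) * (a * ln (real N) - b) \<le> Znorm (\<Sum>k\<in>F. T (u k))"
    using ab[OF N(1), of n0] by blast
  have "Znorm (T w) \<le> Znorm (T (Zj (Zd w))) + K * (2 * norm2 (Zy w))"
    by (rule Znorm_op_le_parts[OF T less_imp_le[OF K(1)] K(2)])
  also have "Znorm (T (Zj (Zd w))) \<le> \<theta> * norm2 (Zd w)" by (rule n0[OF Ztail_Zd[OF w]])
  also have "\<dots> \<le> \<theta> * (sqrt (real N) * (4 * C' + D * (ln (real N) / 2 + 1)))"
    by (intro mult_left_mono dw \<theta>)
  also have "\<dots> = sqrt (real N) * (\<theta> * 4 * C' + (\<theta> * D) * (ln (real N) / 2 + 1))"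
    by (simp add: algebra_simps)
  also have "\<dots> \<le> sqrt (real N) * (\<theta> * 4 * C' + a * (ln (real N) / 2 + 1))"
    using N(1) by (intro mult_left_mono add_left_mono mult_right_mono \<theta>) auto
  also have "K * (2 * norm2 (Zy w)) \<le> K * (2 * (sqrt (real N) * D))" using yw K by (intro mult_left_mono) auto
  finally have Tw: "Znorm (T w) \<le> sqrt (real N) * (a / 2 * ln (real N) + c)"
    by (simp add: c_def algebra_simps)
  have "(\<Sum>k\<in>F. T (u k)) = T w + T ((\<Sum>k\<in>F. u k) - w)"
    by (simp add: op_add[OF T, symmetric] op_sum[OF T, symmetric])
  then have "Znorm (\<Sum>k\<in>F. T (u k)) \<le> Znorm (T w) + Znorm (T ((\<Sum>k\<in>F. u k) - w))"
    using Znorm_triangle by metis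
  also have "Znorm (T ((\<Sum>k\<in>F. u k) - w)) \<le> K"
    using K(2)[of "(\<Sum>k\<in>F. u k) - w"] mult_left_mono[OF uw less_imp_le[OF K(1)]] by simp
  finally show False using Tw low N(2) by (simp add: algebra_simps)
qed

lemma norm2_Zy_scale: "norm2 (Zy (Z2_scale c u)) = norm c * norm2 (Zy u)"
  using norm2_scale[OF Zy_ell2, of c u] by (simp flip: Zy_scale)

lemma Z2_normalize:
  assumes "Znorm u \<noteq> 0"
  shows "u = Z2_scale (of_real (Znorm u)) (Z2_scale (of_real (inverse (Znorm u))) u)"
    and "Znorm (Z2_scale (of_real (inverse (Znorm u))) u) = 1"
  using assms by (simp_all add: Znorm_scale norm_inverse flip: of_real_mult)

lemma ell2_tail_normalize:
  fixes T :: "'a::{real_or_complex,banach} Z2 \<Rightarrow> 'a Z2"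
  assumes T: "T \<in> Z2_operators" and x: "x \<in> ell2_tail n" and nz: "T (Zj x) \<noteq> 0"
  obtains x' where "x' \<in> ell2_tail n" "norm2 x' = 1" "norm2 x > 0"
    "T (Zj x) = Z2_scale (of_real (norm2 x)) (T (Zj x'))"
proof -
  let ?c = "of_real (inverse (norm2 x)) :: 'a"
  note x2 = ell2_tail_ell2[OF x]
  have "Zj x \<noteq> 0" using nz by (auto simp: op_0[OF T])
  then have p: "Znorm (Zj x) \<noteq> 0" by simp
  note Z2_normalize[OF p, unfolded Znorm_Zj[OF x2] Zj_scale[OF x2, symmetric]]
  then show thesis
    using that[OF ell2_tail_scale[OF x, of ?c]] p norm2_nonneg[OF x2]
    by (metis Znorm_Zj ell2_scale less_eq_real_def op_scale[OF T] x2)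
qed

text \<open>Kalton and Peck's theorem that the quotient map of \<open>Z2\<close> onto \<open>ell2\<close> is strictly singular
  enters here: the diagonal compression of an operator from the subspace to the quotient is compact.\<close>

lemma Zy_op_Zj_small:
  assumes T: "T \<in> Z2_operators" and e: "e > 0"
  shows "\<exists>n. \<forall>x\<in>ell2_tail n. norm2 (Zy (T (Zj x :: 'k::{real_or_complex,banach} Z2))) \<le> e * norm2 x"
proof (rule ccontr)
  assume "\<not> ?thesis"
  then have neg: "\<exists>x\<in>ell2_tail n. e * norm2 x < norm2 (Zy (T (Zj x)))" for n by (simp add: not_le)
  have "\<forall>n. \<exists>x. x \<in> ell2_tail n \<and> norm2 x = 1 \<and> e \<le> norm2 (Zy (T (Zj x)))"
  proof
    fix n
    obtain x where x: "x \<in> ell2_tail n" "e * norm2 x < norm2 (Zy (T (Zj x)))" using neg by blast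
    have "0 \<le> e * norm2 x" using e norm2_nonneg[OF ell2_tail_ell2[OF x(1)]] by simp
    then have "norm2 (Zy (T (Zj x))) \<noteq> 0" using x(2) by linarith
    then have "T (Zj x) \<noteq> 0" using norm2_Zy_scale[of 0 "0 :: 'k Z2"] by auto
    then obtain x' where "x' \<in> ell2_tail n" "norm2 x' = 1" "norm2 x > 0"
      "T (Zj x) = Z2_scale (of_real (norm2 x)) (T (Zj x'))"
      by (rule ell2_tail_normalize[OF T x(1)])
    then show "\<exists>x. x \<in> ell2_tail n \<and> norm2 x = 1 \<and> e \<le> norm2 (Zy (T (Zj x)))"
      using x(2) by (auto simp: norm2_Zy_scale mult.commute[of e])
  qed
  then obtain x where x: "\<And>n. x n \<in> ell2_tail n" "\<And>n. norm2 (x n) = 1"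
    "\<And>n. e \<le> norm2 (Zy (T (Zj (x n))))" by metis
  show False
    by (rule no_hump[OF T, of "\<lambda>n. Zj (x n)" 1 0 e])
      (use x e ell2_tail_ell2[OF x(1)] in \<open>auto simp: Ztail_Zj Znorm_Zj\<close>)
qed

text \<open>Under \<open>ess_zero T\<close> the inputs need not lie in the range of
  \<open>Zj\<close>: hump sums then carry a logarithm too, but only in the part on which
  \<open>T\<close> is small.\<close>

lemma Zy_op_tail_small:
  fixes T :: "'k::{real_or_complex,banach} Z2 \<Rightarrow> 'k Z2"
  assumes T: "T \<in> Z2_operators" "ess_zero T" and e: "e > 0"
  shows "\<exists>n. \<forall>u\<in>Ztail n. norm2 (Zy (T u)) \<le> e * Znorm u"
proof (rule ccontr)
  assume "\<not> ?thesis"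
  then have neg: "\<exists>u\<in>Ztail n. e * Znorm u < norm2 (Zy (T u))" for n by (simp add: not_le)
  have "\<forall>n. \<exists>u. u \<in> Ztail n \<and> Znorm u = 1 \<and> e \<le> norm2 (Zy (T u))"
  proof
    fix n
    obtain u where u: "u \<in> Ztail n" "e * Znorm u < norm2 (Zy (T u))" using neg by blast
    let ?v = "Z2_scale (of_real (inverse (Znorm u))) u"
    have "u \<noteq> 0" using u(2) norm2_Zy_scale[of 0 "0 :: 'k Z2"] by (auto simp: op_0[OF T(1)])
    then have p: "Znorm u \<noteq> 0" by simp
    have "norm2 (Zy (T ?v)) = inverse (Znorm u) * norm2 (Zy (T u))"
      by (simp add: op_scale[OF T(1)] norm2_Zy_scale norm_inverse)
    moreover have "Znorm u > 0" using p Znorm_nonneg[of u] by linarith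
    ultimately have "e \<le> norm2 (Zy (T ?v))" using u(2) by (simp add: field_simps)
    then show "\<exists>u. u \<in> Ztail n \<and> Znorm u = 1 \<and> e \<le> norm2 (Zy (T u))"
      using Z2_normalize(2)[OF p] Ztail_scale[OF u(1)] by blast
  qed
  then obtain u where u: "\<And>n. u n \<in> Ztail n" "\<And>n. Znorm (u n) = 1"
    "\<And>n. e \<le> norm2 (Zy (T (u n)))" by metis
  show False
    by (rule no_hump[OF T(1), of u 1 1 e]) (use u e T(2) in \<open>auto intro: order_trans[OF norm2_Zy_le]\<close>)
qed

text \<open>Smallness for inputs far out is turned into smallness of the far part of the output,
  uniformly in the input: only finitely many coordinate vectors remain, and each of their images has
  a small tail. This is the form that the adjoint can use.\<close>

lemma Zy_tail_op_small:
  fixes T :: "'k::{real_or_complex,banach} Z2 \<Rightarrow> 'k Z2"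
  assumes T: "T \<in> Z2_operators" "ess_zero T" and e: "e > 0"
  shows "\<exists>n. \<forall>u. norm2 (restr {n..} (Zy (T u))) \<le> e * Znorm u"
proof -
  \<comment> \<open>Passing to the tail of \<open>u\<close> may cost a factor 8 in
    \<open>Znorm\<close>, so \<open>e / 16\<close> becomes \<open>e / 2\<close>.\<close>
  obtain n1 where n1: "\<And>u. u \<in> Ztail n1 \<Longrightarrow> norm2 (Zy (T u)) \<le> e / 16 * Znorm u"
    using Zy_op_tail_small[OF T, of "e / 16"] e by auto
  let ?r = "\<lambda>n w. norm2 (restr {n..} (Zy (T w)))"
  let ?g = "\<lambda>n. \<Sum>i<n1. ?r n (Zj (Zunit i) :: 'k Z2) + ?r n (Zw (Zunit i) :: 'k Z2)"
  have "?g \<longlonglongrightarrow> (\<Sum>i<n1. 0 + 0)" by (intro tendsto_intros norm2_tail_tendsto Zy_ell2)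
  then have "?g \<longlonglongrightarrow> 0" by simp
  from order_tendstoD(2)[OF this, of "e / 2"] obtain n where n: "?g n < e / 2"
    using e by (auto simp: eventually_at_top_linorder)
  have "?r n u \<le> e * Znorm u" for u
  proof -
    let ?h = "Zrestr {..<n1} u" and ?t = "Zrestr {n1..} u"
    have tri: "?r n (v + w) \<le> ?r n v + ?r n w" for v w
    proof -
      have "restr {n..} (Zy (T (v + w))) = (\<lambda>i. restr {n..} (Zy (T v)) i + restr {n..} (Zy (T w)) i)"
        by (auto simp: restr_def op_add[OF T(1)])
      then show ?thesis by (simp only:) (intro norm2_triangle ell2_restr Zy_ell2)
    qed
    have sc: "?r n (Z2_scale c w) = norm c * ?r n w" for c w
    proof -
      have "restr {n..} (Zy (T (Z2_scale c w))) = (\<lambda>i. c * restr {n..} (Zy (T w)) i)"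
        by (auto simp: restr_def op_scale[OF T(1)])
      then show ?thesis by (simp add: norm2_scale ell2_restr Zy_ell2)
    qed
    have r0: "?r n 0 = 0" using sc[of 0 0] by simp
    have sum: "?r n (\<Sum>i\<in>F. w i) \<le> (\<Sum>i\<in>F. ?r n (w i))" for F :: "nat set" and w
      by (induction F rule: infinite_finite_induct) (auto simp: r0 intro: order_trans[OF tri])
    have "?r n ?h \<le> (\<Sum>i<n1. norm (Zx u i) * ?r n (Zj (Zunit i)) + norm (Zy u i) * ?r n (Zw (Zunit i)))"
      unfolding Zrestr_initial
      by (intro order_trans[OF sum] sum_mono order_trans[OF tri]) (simp add: sc)
    also have "\<dots> \<le> (\<Sum>i<n1. Znorm u * ?r n (Zj (Zunit i)) + Znorm u * ?r n (Zw (Zunit i)))"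
      by (intro sum_mono add_mono mult_right_mono norm_Zx_le norm_Zy_le norm2_nonneg ell2_restr Zy_ell2)
    also have "\<dots> = Znorm u * ?g n" by (simp add: sum_distrib_left algebra_simps)
    also have "\<dots> \<le> Znorm u * (e / 2)" using n by (intro mult_left_mono) auto
    finally have h: "?r n ?h \<le> e / 2 * Znorm u" by (simp add: mult.commute)
    have "?r n ?t \<le> norm2 (Zy (T ?t))" by (intro norm2_restr_le Zy_ell2)
    also have "\<dots> \<le> e / 16 * Znorm ?t" by (intro n1 Zrestr_Ztail)
    also have "\<dots> \<le> e / 16 * (8 * Znorm u)" using e by (intro mult_left_mono Znorm_Zrestr_le) auto
    finally have "?r n ?t \<le> e / 2 * Znorm u" by simp
    then show ?thesis using tri[of ?h ?t] h by (simp add: Zrestr_split)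
  qed
  then show ?thesis by blast
qed

lemma Zform_Zj_tail_le:
  fixes x :: "nat \<Rightarrow> 'k::{real_or_complex,banach}"
  assumes "x \<in> ell2_tail n"
  shows "norm (Zform (Zj x) v) \<le> norm2 x * norm2 (restr {n..} (Zy v))"
  using norm_Zform_Zj_le[OF ell2_tail_ell2[OF assms], of "Zrestr {n..} v"]
  by (simp add: Zform_Ztail[OF Ztail_Zj[OF assms], symmetric])

text \<open>For \<open>x\<close> in the tail, pairing \<open>Z2_star T (Zj x)\<close> with
  \<open>v\<close> is pairing \<open>Zj x\<close> with \<open>T v\<close>, which involves only the
  tail of \<open>Zy (T v)\<close>.\<close>

theorem ess_zero_star:
  assumes T: "T \<in> Z2_operators" "ess_zero T"
  shows "ess_zero (Z2_star T)"
  unfolding ess_zero_def ess_le_def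
proof (intro allI impI)
  fix e :: real assume e: "e > 0"
  obtain n where n: "\<And>u. norm2 (restr {n..} (Zy (T u))) \<le> e / 4 * Znorm u"
    using Zy_tail_op_small[OF T, of "e / 4"] e by auto
  have "Znorm (Z2_star T (Zj x)) \<le> e * norm2 x" if x: "x \<in> ell2_tail n" for x
  proof (rule Znorm_leI)
    show "0 \<le> e * norm2 x" using e norm2_nonneg[OF ell2_tail_ell2[OF x]] by simp
    fix v
    have "norm (Zform (Z2_star T (Zj x)) v) = norm (Zform (Zj x) (T v))"
      by (simp add: Zform_star'[OF T(1)])
    also have "\<dots> \<le> norm2 x * norm2 (restr {n..} (Zy (T v)))" by (rule Zform_Zj_tail_le[OF x])
    also have "\<dots> \<le> norm2 x * (e / 4 * Znorm v)"
      by (intro mult_left_mono n norm2_nonneg ell2_tail_ell2[OF x])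
    also have "\<dots> \<le> norm2 x * (e / 4 * (2 * Z2_qnorm v))"
      using e by (intro mult_left_mono Znorm_le_qnorm norm2_nonneg ell2_tail_ell2[OF x]) auto
    also have "\<dots> \<le> e * norm2 x * Z2_qnorm v"
      using e norm2_nonneg[OF ell2_tail_ell2[OF x]] by (simp add: Z2_qnorm_nonneg)
    finally show "norm (Zform (Z2_star T (Zj x)) v) \<le> e * norm2 x * Z2_qnorm v" .
  qed
  then show "\<exists>n. \<forall>x\<in>ell2_tail n. Znorm (Z2_star T (Zj x)) \<le> e * norm2 x" by blast
qed

section \<open>Arithmetic of essential bounds\<close>

lemma ess_le_mono: "ess_le c T \<Longrightarrow> c \<le> d \<Longrightarrow> ess_le d T"
  unfolding ess_le_def
  by (meson ell2_tail_ell2 mult_right_mono norm2_nonneg order_trans)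

lemma ess_le_bounded: "(\<And>u. Znorm (T u) \<le> c * Znorm u) \<Longrightarrow> ess_le c T"
  by (metis Znorm_Zj ell2_tail_ell2 ess_le_def)

lemma ess_le_add:
  assumes "ess_le c S" "ess_le d T"
  shows "ess_le (c + d) (\<lambda>u. S u + T u)"
proof -
  obtain m n where m: "\<And>x. x \<in> ell2_tail m \<Longrightarrow> Znorm (S (Zj x)) \<le> c * norm2 x"
    and n: "\<And>x. x \<in> ell2_tail n \<Longrightarrow> Znorm (T (Zj x)) \<le> d * norm2 x"
    using assms unfolding ess_le_def by blast
  have "Znorm (S (Zj x) + T (Zj x)) \<le> (c + d) * norm2 x" if "x \<in> ell2_tail (max m n)" for x
    using Znorm_triangle[of "S (Zj x)" "T (Zj x)"] m[OF subsetD[OF ell2_tail_antimono that]]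
      n[OF subsetD[OF ell2_tail_antimono that]]
    by (simp add: algebra_simps)
  then show ?thesis unfolding ess_le_def by blast
qed

lemma ess_le_scale: "ess_le d T \<Longrightarrow> ess_le (norm c * d) (\<lambda>u. Z2_scale c (T u))"
  unfolding ess_le_def Znorm_scale mult.assoc by (meson mult_left_mono norm_ge_zero)

lemma ess_zero_add: "ess_zero S \<Longrightarrow> ess_zero T \<Longrightarrow> ess_zero (\<lambda>u. S u + T u)"
  unfolding ess_zero_def using ess_le_add[of "_ / 2" S "_ / 2" T] by (metis field_sum_of_halves half_gt_zero)

lemma ess_zero_scale: "ess_zero T \<Longrightarrow> ess_zero (\<lambda>u. Z2_scale c (T u))"
proof -
  assume T: "ess_zero T"
  show ?thesis unfolding ess_zero_def
  proof (intro allI impI)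
    fix e :: real assume e: "e > 0"
    have p: "norm c + 1 > 0" by (simp add: add_nonneg_pos)
    then have "ess_le (e / (norm c + 1)) T" using T e by (simp add: ess_zero_def)
    from ess_le_scale[OF this, of c] show "ess_le e (\<lambda>u. Z2_scale c (T u))"
      by (rule ess_le_mono) (use e p in \<open>simp add: field_simps\<close>)
  qed
qed

text \<open>Each coordinate of \<open>T (Zj x)\<close> is, up to sign and conjugation, the pairing
  of \<open>Zj x\<close> with a fixed vector \<open>Z2_star T w\<close>, of which only the tail of
  the \<open>Zy\<close> part counts.\<close>

lemma Zrestr_initial_op_Zj_small:
  fixes T :: "'k::{real_or_complex,banach} Z2 \<Rightarrow> 'k Z2"
  assumes T: "T \<in> Z2_operators" and e: "e > 0"
  shows "\<exists>n. \<forall>x\<in>ell2_tail n. Znorm (Zrestr {..<m} (T (Zj x))) \<le> e * norm2 x"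
proof -
  let ?s = "\<lambda>n w. norm2 (restr {n..} (Zy (Z2_star T w)))"
  let ?g = "\<lambda>n. \<Sum>i<m. ?s n (Zw (Zunit i)) + ?s n (Zj (Zunit i)) * 2"
  have "?g \<longlonglongrightarrow> (\<Sum>i<m. 0 + 0 * 2)" by (intro tendsto_intros norm2_tail_tendsto Zy_ell2)
  then have "?g \<longlonglongrightarrow> 0" by simp
  from order_tendstoD(2)[OF this e] obtain n where n: "?g n < e"
    by (auto simp: eventually_at_top_linorder)
  have "Znorm (Zrestr {..<m} (T (Zj x))) \<le> e * norm2 x" if x: "x \<in> ell2_tail n" for x
  proof -
    have f: "norm (Zform w (T (Zj x))) \<le> norm2 x * ?s n w" for w
      using Zform_Zj_tail_le[OF x, of "Z2_star T w"]
      by (simp add: norm_Zform_commute[of w] Zform_star[OF T])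
    have "Znorm (Zrestr {..<m} (T (Zj x)))
        \<le> (\<Sum>i<m. norm (Zx (T (Zj x)) i) + norm (Zy (T (Zj x)) i) * 2)"
      by (rule Znorm_initial_le)
    also have "\<dots> \<le> (\<Sum>i<m. norm2 x * ?s n (Zw (Zunit i)) + norm2 x * ?s n (Zj (Zunit i)) * 2)"
      using f[of "Zw (Zunit _)"] f[of "Zj (Zunit _)"]
      by (intro sum_mono add_mono mult_right_mono) (auto simp: Zform_Zj_unit Zform_Zw_unit)
    also have "\<dots> = norm2 x * ?g n" by (simp add: sum_distrib_left algebra_simps)
    also have "\<dots> \<le> norm2 x * e"
      using n by (intro mult_left_mono norm2_nonneg ell2_tail_ell2[OF x]) auto
    finally show ?thesis by (simp add: mult.commute)
  qed
  then show ?thesis by blast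
qed

text \<open>For \<open>x\<close> far out, \<open>T (Zj x)\<close> splits into a head before
  \<open>n1\<close>, a part in the range of \<open>Zj\<close> and a part on the section
  \<open>Zw\<close>. Head and section part are small, so \<open>S\<close> acts essentially on the
  range of \<open>Zj\<close>, where its bound is \<open>c\<close>. The strict inequality leaves room
  for the errors.\<close>

lemma ess_le_comp:
  assumes S: "S \<in> Z2_operators" and T: "T \<in> Z2_operators"
    and c: "ess_le c S" "0 \<le> c" and d: "ess_le d T" "0 \<le> d" and e: "c * d < e"
  shows "ess_le e (S \<circ> T)"
proof -
  obtain K where K: "K > 0" "\<And>u. Znorm (S u) \<le> K * Znorm u" using op_bounded[OF S] by blast
  \<comment> \<open>Relative to \<open>norm2 x\<close> the head costs \<open>K * t\<close>, the
    section part \<open>2 * K * t\<close>, and the excess of \<open>norm2 (Zd ?w)\<close> over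
    \<open>d * norm2 x\<close> costs \<open>3 * c * t\<close>.\<close>
  define t where "t = (e - c * d) / (3 * K + 3 * c + 1)"
  have t: "t > 0" using e K c by (auto simp: t_def intro!: divide_pos_pos add_nonneg_pos)
  have "t * (3 * K + 3 * c + 1) = e - c * d" using K c by (simp add: t_def)
  then have tK: "c * d + t * (3 * K + 3 * c) \<le> e" using t by (simp add: algebra_simps)
  obtain n1 where n1: "\<And>x. x \<in> ell2_tail n1 \<Longrightarrow> Znorm (S (Zj x)) \<le> c * norm2 x"
    using c unfolding ess_le_def by blast
  obtain n2 where n2: "\<And>x. x \<in> ell2_tail n2 \<Longrightarrow> Znorm (T (Zj x)) \<le> d * norm2 x"
    using d unfolding ess_le_def by blast
  obtain n3 where n3: "\<And>x. x \<in> ell2_tail n3 \<Longrightarrow> norm2 (Zy (T (Zj x))) \<le> t * norm2 x"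
    using Zy_op_Zj_small[OF T t] by blast
  obtain n4 where n4: "\<And>x. x \<in> ell2_tail n4 \<Longrightarrow> Znorm (Zrestr {..<n1} (T (Zj x))) \<le> t * norm2 x"
    using Zrestr_initial_op_Zj_small[OF T t, of n1] by blast
  define n where "n = max n2 (max n3 n4)"
  have "Znorm (S (T (Zj x))) \<le> e * norm2 x" if "x \<in> ell2_tail n" for x
  proof -
    have x: "x \<in> ell2_tail n2" "x \<in> ell2_tail n3" "x \<in> ell2_tail n4"
      by (rule subsetD[OF ell2_tail_antimono that]; simp add: n_def)+
    have x0: "0 \<le> norm2 x" using norm2_nonneg[OF ell2_tail_ell2[OF that]] .
    let ?v = "T (Zj x)"
    let ?h = "Zrestr {..<n1} ?v" and ?w = "Zrestr {n1..} ?v"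
    have wy: "norm2 (Zy ?w) \<le> t * norm2 x"
      using norm2_restr_le[OF Zy_ell2, of "{n1..}" ?v] n3[OF x(2)] by simp
    have Zw2: "Znorm (Zw (Zy ?w)) \<le> 2 * (t * norm2 x)"
      using Znorm_Zw_le[OF Zy_ell2, of ?w] wy by linarith
    have eq: "?w = ?v - ?h" using Zrestr_split[of n1 ?v] by (simp add: algebra_simps)
    have w: "Znorm ?w \<le> d * norm2 x + t * norm2 x"
      unfolding eq using Znorm_triangle_diff[of ?v ?h] n2[OF x(1)] n4[OF x(3)] by linarith
    have "Zj (Zd ?w) = ?w - Zw (Zy ?w)"
      using Z2_decompose[of ?w] by (simp only: eq_diff_eq)
    then have "norm2 (Zd ?w) \<le> Znorm ?w + Znorm (Zw (Zy ?w))"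
      using Znorm_triangle_diff[of ?w "Zw (Zy ?w)"] Znorm_Zj[OF Zd_ell2, of ?w] by metis
    then have wd: "norm2 (Zd ?w) \<le> (d + 3 * t) * norm2 x"
      using w Zw2 by (simp add: algebra_simps)
    have "S ?v = S ?h + (S (Zj (Zd ?w)) + S (Zw (Zy ?w)))"
      using Zrestr_split[of n1 ?v] Z2_decompose[of ?w] op_add[OF S] by metis
    then have "Znorm (S ?v) \<le> Znorm (S ?h) + (Znorm (S (Zj (Zd ?w))) + Znorm (S (Zw (Zy ?w))))"
      by (smt (verit) Znorm_triangle)
    also have "\<dots> \<le> K * (t * norm2 x) + (c * ((d + 3 * t) * norm2 x) + K * (2 * (t * norm2 x)))"
      by (intro add_mono order_trans[OF K(2)] order_trans[OF n1[OF Ztail_Zd[OF Zrestr_Ztail]]]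
          mult_left_mono n4 x wd Zw2 c less_imp_le[OF K(1)])
    also have "\<dots> = (c * d + t * (3 * K + 3 * c)) * norm2 x" by (simp add: algebra_simps)
    also have "\<dots> \<le> e * norm2 x" by (rule mult_right_mono[OF tK x0])
    finally show ?thesis .
  qed
  then show ?thesis unfolding ess_le_def by auto
qed


section \<open>Strictly singular operators\<close>

definition Z2_finite_dim :: "'k::real_normed_field Z2 set \<Rightarrow> bool" where
  "Z2_finite_dim M \<longleftrightarrow> (\<exists>B. finite B \<and> M \<subseteq> Z2.span B)"

text \<open>If the kernel lay in a finite span, adjoining a single vector of \<open>M\<close>
  outside the kernel would span all of \<open>M\<close>.\<close>

lemma not_finite_dim_kernel:
  fixes f :: "'k::real_normed_field Z2 \<Rightarrow> 'k"
  assumes M: "Z2.subspace M" "\<not> Z2_finite_dim M"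
    and f: "\<And>u v. f (u + v) = f u + f v" "\<And>c u. f (Z2_scale c u) = c * f u"
  shows "Z2.subspace (M \<inter> {u. f u = 0}) \<and> \<not> Z2_finite_dim (M \<inter> {u. f u = 0})"
proof
  have f0: "f 0 = 0" using f(2)[of 0 0] by simp
  then have "Z2.subspace {u. f u = 0}" unfolding Z2.subspace_def by (simp add: f)
  then show "Z2.subspace (M \<inter> {u. f u = 0})" by (rule Z2.subspace_inter[OF M(1)])
  show "\<not> Z2_finite_dim (M \<inter> {u. f u = 0})"
  proof
    assume "Z2_finite_dim (M \<inter> {u. f u = 0})"
    then obtain B where B: "finite B" "M \<inter> {u. f u = 0} \<subseteq> Z2.span B" by (auto simp: Z2_finite_dim_def)
    show False
    proof (cases "\<exists>a\<in>M. f a \<noteq> 0")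
      case True
      then obtain a where a: "a \<in> M" "f a \<noteq> 0" by blast
      have "M \<subseteq> Z2.span (insert a B)"
      proof
        fix u assume u: "u \<in> M"
        let ?w = "u + Z2_scale (- (f u / f a)) a"
        have "?w \<in> M" by (intro Z2.subspace_add[OF M(1)] Z2.subspace_scale[OF M(1)] u a)
        moreover have "f ?w = 0" unfolding f using a by simp
        ultimately have "?w \<in> Z2.span (insert a B)"
          using B(2) Z2.span_mono[of B "insert a B"] by blast
        moreover have "Z2_scale (f u / f a) a \<in> Z2.span (insert a B)"
          by (intro Z2.span_scale Z2.span_base) simp
        ultimately have "?w + Z2_scale (f u / f a) a \<in> Z2.span (insert a B)" by (rule Z2.span_add)
        then show "u \<in> Z2.span (insert a B)" by (simp add: Z2.scale_minus_left)
      qed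
      then show False using M(2) B(1) unfolding Z2_finite_dim_def by blast
    next
      case False
      then show False using M(2) B unfolding Z2_finite_dim_def by blast
    qed
  qed
qed

lemma not_finite_dim_tail:
  assumes M: "Z2.subspace M" "\<not> Z2_finite_dim M"
  shows "Z2.subspace (M \<inter> Ztail n) \<and> \<not> Z2_finite_dim (M \<inter> Ztail n)"
proof (induction n)
  case 0
  then show ?case using M by (simp add: Ztail_def)
next
  case (Suc n)
  from not_finite_dim_kernel[OF conjunct1[OF Suc] conjunct2[OF Suc], of "\<lambda>u. Zx u n"]
  have s: "Z2.subspace (M \<inter> Ztail n \<inter> {u. Zx u n = 0})"
    and d: "\<not> Z2_finite_dim (M \<inter> Ztail n \<inter> {u. Zx u n = 0})" by auto
  have "M \<inter> Ztail n \<inter> {u. Zx u n = 0} \<inter> {u. Zy u n = 0} = M \<inter> Ztail (Suc n)"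
    by (auto simp: Ztail_def less_Suc_eq)
  then show ?case using not_finite_dim_kernel[OF s d, of "\<lambda>u. Zy u n"] by simp
qed

lemma tail_vector_exists:
  fixes M :: "'k::{real_or_complex,banach} Z2 set"
  assumes M: "Z2.subspace M" "\<not> Z2_finite_dim M"
  shows "\<exists>u\<in>M \<inter> Ztail n. Znorm u = 1"
proof -
  note t = not_finite_dim_tail[OF M, of n]
  have "\<not> M \<inter> Ztail n \<subseteq> {0}"
    using conjunct2[OF t] Z2.span_empty unfolding Z2_finite_dim_def by blast
  then obtain u where u: "u \<in> M \<inter> Ztail n" "u \<noteq> 0" by blast
  have "Z2_scale (of_real (inverse (Znorm u))) u \<in> M \<inter> Ztail n"
    using conjunct1[OF t] u(1) by (rule Z2.subspace_scale)
  moreover have "Znorm (Z2_scale (of_real (inverse (Znorm u))) u) = 1"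
    using u(2) by (simp add: Znorm_scale norm_inverse)
  ultimately show ?thesis by blast
qed

text \<open>Otherwise \<open>Zy\<close> would be bounded below on the subspace far out. The hump
  lemma with \<open>u = v\<close> then gives sums of norm at least of order
  \<open>sqrt N * ln N\<close> whose \<open>Zy\<close> part is only of order \<open>sqrt N\<close>,
  and these sums stay in the subspace.\<close>

lemma almost_in_kernel_exists:
  fixes M :: "'k::{real_or_complex,banach} Z2 set"
  assumes M: "Z2.subspace M" "\<not> Z2_finite_dim M" and e: "e > 0"
  shows "\<exists>u\<in>M \<inter> Ztail n. u \<noteq> 0 \<and> norm2 (Zy u) \<le> e * Znorm u"
proof (rule ccontr)
  assume "\<not> ?thesis"
  then have neg: "e * Znorm u \<le> norm2 (Zy u)" if "u \<in> M \<inter> Ztail n" for u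
    using that norm2_nonneg[OF Zy_ell2] by (cases "u = 0") (auto simp: not_le intro: less_imp_le)
  have "\<forall>k. \<exists>u. u \<in> M \<inter> Ztail (k + n) \<and> Znorm u = 1" using tail_vector_exists[OF M] by blast
  then obtain u where u: "\<And>k. u k \<in> M \<inter> Ztail (k + n)" "\<And>k. Znorm (u k) = 1" by metis
  have un: "u k \<in> M \<inter> Ztail n" "u k \<in> Ztail k" for k
    using u(1)[of k] subsetD[OF Ztail_antimono[of n "k + n"], of "u k"]
      subsetD[OF Ztail_antimono[of k "k + n"], of "u k"] by auto
  have null: "coord_null u" by (rule coord_null_Ztail[OF un(2)])
  have y1: "norm2 (Zy (u k)) \<le> 1" for k using norm2_Zy_le[of "u k"] u(2) by simp
  have ye: "e \<le> norm2 (Zy (u k))" for k using neg[OF un(1)] u(2) by simp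
  obtain a b where a: "a > 0" and ab: "\<And>n0 N. N \<ge> 1 \<Longrightarrow> \<exists>F w. finite F \<and> w \<in> Ztail n0
      \<and> Znorm ((\<Sum>k\<in>F. u k) - w) \<le> 1
      \<and> norm2 (Zy w) \<le> sqrt (real N) * 1
      \<and> norm2 (Zd w) \<le> sqrt (real N) * (4 * 1 + 1 * (ln (real N) / 2 + 1))
      \<and> sqrt (real N) * (a * ln (real N) - b) \<le> Znorm (\<Sum>k\<in>F. u k)"
    by (rule gliding_hump_sum[OF null null zero_less_one zero_le_one e]) (use u(2) y1 ye in auto)
  obtain N where N: "N \<ge> 1" "sqrt (real N) * ((e * a) * ln (real N) - (e * b + 1)) > 1"
    using sqrt_mult_ln_dominates[of "e * a" 1 "e * b + 1"] a e by auto
  obtain F w where uw: "Znorm ((\<Sum>k\<in>F. u k) - w) \<le> 1" and yw: "norm2 (Zy w) \<le> sqrt (real N)"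
    and low: "sqrt (real N) * (a * ln (real N) - b) \<le> Znorm (\<Sum>k\<in>F. u k)"
    using ab[OF N(1), of 0] by auto
  let ?s = "\<Sum>k\<in>F. u k"
  have "?s \<in> M \<inter> Ztail n" using conjunct1[OF not_finite_dim_tail[OF M]] un by (intro Z2.subspace_sum) auto
  then have 1: "e * Znorm ?s \<le> norm2 (Zy ?s)" by (rule neg)
  have "Zy ?s = (\<lambda>i. Zy w i + Zy (?s - w) i)" by auto
  then have "norm2 (Zy ?s) \<le> norm2 (Zy w) + norm2 (Zy (?s - w))"
    by (simp only:) (intro norm2_triangle Zy_ell2)
  then have "norm2 (Zy ?s) \<le> sqrt (real N) + 1" using yw uw norm2_Zy_le[of "?s - w"] by linarith
  moreover have "e * (sqrt (real N) * (a * ln (real N) - b)) \<le> e * Znorm ?s"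
    using low e by (intro mult_left_mono) auto
  ultimately show False using 1 N(2) by (simp add: algebra_simps)
qed

text \<open>Every infinite dimensional subspace contains vectors far out that lie almost in the
  range of \<open>Zj\<close>, where \<open>T\<close> is small; so \<open>T\<close> is not bounded
  below on it.\<close>

lemma ess_zero_imp_strictly_singular:
  fixes T :: "'k::{real_or_complex,banach} Z2 \<Rightarrow> 'k Z2"
  assumes T: "T \<in> Z2_operators" "ess_zero T"
  shows "strictly_singular T"
  unfolding strictly_singular_def
proof (intro allI impI notI, elim conjE)
  fix M :: "'k Z2 set"
  assume M: "Z2.subspace M" "\<not> (\<exists>B. finite B \<and> M \<subseteq> Z2.span B)" and iso: "isomorphic_on T M"
  obtain K where K: "K > 0" "\<And>u. Znorm (T u) \<le> K * Znorm u" using op_bounded[OF T(1)] by blast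
  obtain C where C: "\<And>v. v \<in> T ` M \<Longrightarrow> Z2_qnorm (inv_into M T v) \<le> C * Z2_qnorm v"
    using iso by (auto simp: isomorphic_on_def)
  define L where "L = 8 * \<bar>C\<bar> + 1"
  have L: "L > 0" by (simp add: L_def add_nonneg_pos)
  have low: "Znorm u \<le> L * Znorm (T u)" if "u \<in> M" for u
  proof -
    have "Z2_qnorm u \<le> C * Z2_qnorm (T u)"
      using C[of "T u"] that iso by (auto simp: isomorphic_on_def inv_into_f_f)
    also have "\<dots> \<le> \<bar>C\<bar> * (4 * Znorm (T u))"
      by (intro mult_mono qnorm_le_Znorm) (auto simp: Z2_qnorm_nonneg)
    finally have "Znorm u \<le> 8 * \<bar>C\<bar> * Znorm (T u)" using Znorm_le_qnorm[of u] by simp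
    then show ?thesis using Znorm_nonneg[of "T u"] by (simp add: L_def algebra_simps del: Znorm_nonneg)
  qed
  \<comment> \<open>The tolerances use up 3/8 and 2/8 of the lower bound \<open>1 / L\<close>: the
    factor 3 is that of \<open>norm2_Zd_le\<close>, the factor 2 that of the section part.\<close>
  have "ess_le (1 / (8 * L)) T" using T(2) L by (simp add: ess_zero_def)
  then obtain n where n: "\<And>x. x \<in> ell2_tail n \<Longrightarrow> Znorm (T (Zj x)) \<le> 1 / (8 * L) * norm2 x"
    unfolding ess_le_def by blast
  obtain u where u: "u \<in> M" "u \<in> Ztail n" "u \<noteq> 0" "norm2 (Zy u) \<le> 1 / (8 * K * L) * Znorm u"
    using almost_in_kernel_exists[OF M(1) M(2)[folded Z2_finite_dim_def], of "1 / (8 * K * L)" n] K L by auto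
  have p: "Znorm u > 0" using u(3) Znorm_nonneg[of u] by (simp add: less_le)
  have "Znorm (T u) \<le> Znorm (T (Zj (Zd u))) + K * (2 * norm2 (Zy u))"
    by (rule Znorm_op_le_parts[OF T(1) less_imp_le[OF K(1)] K(2)])
  also have "Znorm (T (Zj (Zd u))) \<le> 1 / (8 * L) * (3 * Znorm u)"
    using L by (intro order_trans[OF n[OF Ztail_Zd[OF u(2)]]] mult_left_mono norm2_Zd_le) auto
  also have "K * (2 * norm2 (Zy u)) \<le> K * (2 * (1 / (8 * K * L) * Znorm u))"
    using K u(4) by (intro mult_left_mono) auto
  also have "1 / (8 * L) * (3 * Znorm u) + K * (2 * (1 / (8 * K * L) * Znorm u)) = 5 / (8 * L) * Znorm u"
    using K L by (simp add: field_simps)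
  finally have "L * Znorm (T u) \<le> 5 / 8 * Znorm u" using L by (simp add: field_simps)
  then show False using low[OF u(1)] p by simp
qed

section \<open>Subspaces spanned by blocks on which an operator is bounded below\<close>

lemma closed_kernel:
  fixes g :: "'k::{real_or_complex,banach} Z2 \<Rightarrow> 'k"
  assumes g: "\<And>u v. norm (g v - g u) \<le> G * Znorm (v - u)" "G > 0"
  shows "closed {u. g u = 0}"
  unfolding closed_def open_Z2_def
proof
  fix u assume "u \<in> - {u. g u = 0}"
  then have u: "norm (g u) > 0" by simp
  have "g v \<noteq> 0" if "Z2_qnorm (v - u) < norm (g u) / (2 * G)" for v
  proof
    assume "g v = 0"
    then have "norm (g u) \<le> G * Znorm (v - u)" using g(1)[of v u] by simp
    also have "\<dots> \<le> G * (2 * Z2_qnorm (v - u))" using g(2) by (intro mult_left_mono Znorm_le_qnorm) auto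
    also have "\<dots> < norm (g u)" using that g(2) by (simp add: field_simps)
    finally show False by simp
  qed
  then show "\<exists>e>0. \<forall>v. Z2_qnorm (v - u) < e \<longrightarrow> v \<in> - {u. g u = 0}"
    using u g(2) by (intro exI[of _ "norm (g u) / (2 * G)"]) auto
qed

lemma closed_coordinate_relation:
  "closed {u :: 'k::{real_or_complex,banach} Z2. Zx u n * c = Zx u n' * c'}"
  "closed {u :: 'k::{real_or_complex,banach} Z2. Zx u n = 0}"
  "closed {u :: 'k::{real_or_complex,banach} Z2. Zy u n = 0}"
proof -
  have "closed {u :: 'k Z2. Zx u n * c - Zx u n' * c' = 0}"
  proof (rule closed_kernel)
    fix u v :: "'k Z2"
    have "(Zx v n * c - Zx v n' * c') - (Zx u n * c - Zx u n' * c')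
        = Zx (v - u) n * c - Zx (v - u) n' * c'"
      by (simp add: algebra_simps)
    also have "norm \<dots> \<le> norm (Zx (v - u) n * c) + norm (Zx (v - u) n' * c')"
      by (rule norm_triangle_ineq4)
    also have "\<dots> \<le> Znorm (v - u) * norm c + Znorm (v - u) * norm c'"
      unfolding norm_mult by (intro add_mono mult_right_mono norm_Zx_le norm_ge_zero)
    also have "\<dots> \<le> (norm c + norm c' + 1) * Znorm (v - u)" by (simp add: algebra_simps)
    finally show "norm ((Zx v n * c - Zx v n' * c') - (Zx u n * c - Zx u n' * c'))
      \<le> (norm c + norm c' + 1) * Znorm (v - u)" .
  qed (simp add: add_nonneg_pos)
  then show "closed {u :: 'k Z2. Zx u n * c = Zx u n' * c'}" by simp
  show "closed {u :: 'k Z2. Zx u n = 0}"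
    by (rule closed_kernel[of _ 1]) (use norm_Zx_le[of "_ - _ :: 'k Z2"] in auto)
  show "closed {u :: 'k Z2. Zy u n = 0}"
    by (rule closed_kernel[of _ 1]) (use norm_Zy_le[of "_ - _ :: 'k Z2"] in auto)
qed

lemma isomorphic_onI:
  assumes T: "T \<in> Z2_operators" and M: "Z2.subspace M"
    and C: "0 \<le> C" "\<And>u. u \<in> M \<Longrightarrow> Znorm u \<le> C * Znorm (T u)"
  shows "isomorphic_on T M"
proof -
  have inj: "inj_on T M"
  proof (rule inj_onI)
    fix u v assume uv: "u \<in> M" "v \<in> M" "T u = T v"
    then have "Znorm (u - v) \<le> 0"
      using C(2)[OF Z2.subspace_diff[OF M uv(1,2)]] by (simp add: op_diff[OF T])
    then have "Znorm (u - v) = 0" using Znorm_nonneg[of "u - v"] by (rule antisym)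
    then show "u = v" by simp
  qed
  have "Z2_qnorm u \<le> 8 * C * Z2_qnorm (T u)" if "u \<in> M" for u
  proof -
    have "Z2_qnorm u \<le> 4 * (C * Znorm (T u))" using qnorm_le_Znorm[of u] C(2)[OF that] by simp
    also have "\<dots> \<le> 4 * (C * (2 * Z2_qnorm (T u)))"
      using C(1) by (intro mult_left_mono Znorm_le_qnorm) auto
    finally show ?thesis by simp
  qed
  then have "\<exists>C. \<forall>v\<in>T ` M. Z2_qnorm (inv_into M T v) \<le> C * Z2_qnorm v"
    using inj by (intro exI[of _ "8 * C"]) (auto simp: inv_into_f_f)
  moreover have "\<exists>C. \<forall>u\<in>M. Z2_qnorm (T u) \<le> C * Z2_qnorm u"
    using T by (auto simp: Z2_operators_iff)
  ultimately show ?thesis using inj by (simp add: isomorphic_on_def)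
qed

text \<open>Failure of \<open>ess_zero\<close> is witnessed arbitrarily far out, where
  \<open>Zy_op_Zj_small\<close> makes the \<open>Zy\<close> part of the image tiny. So the images
  are large and almost in the range of \<open>Zj\<close>.\<close>

lemma not_ess_zero_sequence:
  assumes T: "T \<in> Z2_operators" and ne: "\<not> ess_zero T"
  obtains e where "e > 0" "\<And>z n. z > 0 \<Longrightarrow>
    \<exists>x\<in>ell2_tail n. norm2 x = 1 \<and> e \<le> Znorm (T (Zj x)) \<and> norm2 (Zy (T (Zj x))) \<le> z"
proof -
  obtain e where e: "e > 0" and neg: "\<And>n. \<exists>x\<in>ell2_tail n. e * norm2 x < Znorm (T (Zj x))"
    using ne by (auto simp: ess_zero_def ess_le_def not_le)
  show thesis
  proof (rule that[OF e])
    fix z :: real and n assume z: "z > 0"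
    obtain n1 where n1: "\<And>x. x \<in> ell2_tail n1 \<Longrightarrow> norm2 (Zy (T (Zj x))) \<le> z * norm2 x"
      using Zy_op_Zj_small[OF T z] by blast
    obtain x where x: "x \<in> ell2_tail (max n n1)" "e * norm2 x < Znorm (T (Zj x))" using neg by blast
    have "0 \<le> e * norm2 x" using e norm2_nonneg[OF ell2_tail_ell2[OF x(1)]] by simp
    then have "T (Zj x) \<noteq> 0" using x(2) by auto
    then obtain x' where x': "x' \<in> ell2_tail (max n n1)" "norm2 x' = 1" "norm2 x > 0"
      "T (Zj x) = Z2_scale (of_real (norm2 x)) (T (Zj x'))"
      by (rule ell2_tail_normalize[OF T x(1)])
    have "e \<le> Znorm (T (Zj x'))" using x(2) x'(3,4) by (simp add: Znorm_scale mult.commute[of e])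
    moreover have "norm2 (Zy (T (Zj x'))) \<le> z" using n1[OF subsetD[OF ell2_tail_antimono x'(1)]] x'(2) by simp
    moreover have "x' \<in> ell2_tail n" by (rule subsetD[OF ell2_tail_antimono x'(1)]) simp
    ultimately show "\<exists>x\<in>ell2_tail n. norm2 x = 1 \<and> e \<le> Znorm (T (Zj x)) \<and> norm2 (Zy (T (Zj x))) \<le> z"
      using x'(2) by blast
  qed
qed

text \<open>Both block sequences are orthogonal in the isometric copy of ell2. With \<alpha> the
  ell2 norm of the coefficients, the source has norm at most \<alpha>, its model image at least
  \<open>3 * e * \<alpha>\<close>, and the perturbation costs at most
  \<open>e * \<alpha>\<close>.\<close>

lemma block_basis_estimate:
  fixes T :: "'k::{real_or_complex,banach} Z2 \<Rightarrow> 'k Z2"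
  assumes T: "T \<in> Z2_operators" and F: "finite F" and A: "disjoint_family_on A F"
    and b: "\<And>i. b i \<in> ell2" "\<And>i n. n \<notin> A i \<Longrightarrow> b i n = 0" "\<And>i. norm2 (b i) \<le> 1"
    and z: "\<And>i. z i \<in> ell2" "\<And>i n. n \<notin> A i \<Longrightarrow> z i n = 0" "\<And>i. 3 * e \<le> norm2 (z i)"
    and \<rho>: "\<And>i. Znorm (T (Zj (b i)) - Zj (z i)) \<le> \<rho> i" "(\<Sum>i\<in>F. \<rho> i) \<le> e" and e: "e > 0"
  shows "2 * e * Znorm (\<Sum>i\<in>F. Z2_scale (a i) (Zj (b i))) \<le> Znorm (T (\<Sum>i\<in>F. Z2_scale (a i) (Zj (b i))))"
proof -
  define \<alpha> where "\<alpha> = L2_set (\<lambda>i. norm (a i)) F"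
  have \<alpha>: "\<alpha> \<ge> 0" "\<alpha>\<^sup>2 = (\<Sum>i\<in>F. (norm (a i))\<^sup>2)"
    by (auto simp: \<alpha>_def L2_set_nonneg) (simp add: L2_set_def sum_nonneg)
  have sumZj: "(\<Sum>i\<in>F. Z2_scale (a i) (Zj (x i))) = Zj (\<lambda>n. \<Sum>i\<in>F. a i * x i n)"
    if "\<And>i. x i \<in> ell2" for x :: "_ \<Rightarrow> nat \<Rightarrow> 'k"
    by (subst Zj_sum) (auto simp: Zj_scale that ell2_scale)
  have n2: "(norm2 (\<lambda>n. \<Sum>i\<in>F. a i * x i n))\<^sup>2 = (\<Sum>i\<in>F. (norm (a i))\<^sup>2 * (norm2 (x i))\<^sup>2)"
    if "\<And>i. x i \<in> ell2" "\<And>i n. n \<notin> A i \<Longrightarrow> x i n = 0" for x :: "_ \<Rightarrow> nat \<Rightarrow> 'k"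
    by (subst norm2_disjoint_sum[OF F _ A]) (auto simp: that ell2_scale norm2_scale power_mult_distrib)
  have ell: "(\<lambda>n. \<Sum>i\<in>F. a i * x i n) \<in> ell2" if "\<And>i. x i \<in> ell2" for x :: "_ \<Rightarrow> nat \<Rightarrow> 'k"
    by (intro ell2_sum ell2_scale that)
  let ?P = "\<Sum>i\<in>F. Z2_scale (a i) (Zj (b i))" and ?Q = "\<Sum>i\<in>F. Z2_scale (a i) (Zj (z i))"
  have P: "Znorm ?P \<le> \<alpha>"
  proof (rule power2_le_imp_le)
    have "(Znorm ?P)\<^sup>2 = (\<Sum>i\<in>F. (norm (a i))\<^sup>2 * (norm2 (b i))\<^sup>2)"
      by (simp add: sumZj b Znorm_Zj ell n2)
    also have "\<dots> \<le> (\<Sum>i\<in>F. (norm (a i))\<^sup>2 * 1)"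
      using b by (intro sum_mono mult_left_mono power_le_one) (auto simp: norm2_nonneg)
    finally show "(Znorm ?P)\<^sup>2 \<le> \<alpha>\<^sup>2" by (simp add: \<alpha>)
  qed (rule \<alpha>)
  have Q: "3 * e * \<alpha> \<le> Znorm ?Q"
  proof (rule power2_le_imp_le)
    have "(3 * e * \<alpha>)\<^sup>2 = (\<Sum>i\<in>F. (norm (a i))\<^sup>2 * (3 * e)\<^sup>2)"
      by (simp add: power_mult_distrib \<alpha> sum_distrib_left mult_ac)
    also have "\<dots> \<le> (\<Sum>i\<in>F. (norm (a i))\<^sup>2 * (norm2 (z i))\<^sup>2)"
      using z e by (intro sum_mono mult_left_mono power_mono) auto
    also have "\<dots> = (Znorm ?Q)\<^sup>2" by (simp add: sumZj z Znorm_Zj ell n2)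
    finally show "(3 * e * \<alpha>)\<^sup>2 \<le> (Znorm ?Q)\<^sup>2" .
  qed simp
  have "T ?P - ?Q = (\<Sum>i\<in>F. Z2_scale (a i) (T (Zj (b i)) - Zj (z i)))"
    by (simp add: op_sum[OF T] op_scale[OF T] sum_subtractf[symmetric] Z2.scale_right_diff_distrib)
  then have "Znorm (T ?P - ?Q) \<le> (\<Sum>i\<in>F. norm (a i) * Znorm (T (Zj (b i)) - Zj (z i)))"
    using Znorm_sum[of "\<lambda>i. Z2_scale (a i) (T (Zj (b i)) - Zj (z i))" F] by (simp add: Znorm_scale)
  also have "\<dots> \<le> (\<Sum>i\<in>F. \<alpha> * \<rho> i)"
    using F \<rho>(1) \<alpha>(1) member_le_L2_set[OF F, of _ "\<lambda>i. norm (a i)"]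
    by (intro sum_mono mult_mono) (auto simp: \<alpha>_def)
  also have "\<dots> \<le> \<alpha> * e" unfolding sum_distrib_left[symmetric] by (intro mult_left_mono \<rho> \<alpha>)
  finally have "3 * e * \<alpha> \<le> Znorm (T ?P) + \<alpha> * e"
    using Q Znorm_le_add_diff[of ?Q "T ?P"] Znorm_commute[of ?Q "T ?P"] by linarith
  moreover have "2 * e * Znorm ?P \<le> 2 * e * \<alpha>" using P e by (intro mult_left_mono) auto
  ultimately show ?thesis by (simp add: algebra_simps)
qed

text \<open>If \<open>ess_zero\<close> fails, \<open>T\<close> maps a block sequence in the range of
  \<open>Zj\<close> close to another one, hence is bounded below on the closed subspace that it
  spans.\<close>

lemma strictly_singular_imp_ess_zero:
  fixes T :: "'k::{real_or_complex,banach} Z2 \<Rightarrow> 'k Z2"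
  assumes T: "T \<in> Z2_operators" and ss: "strictly_singular T"
  shows "ess_zero T"
proof (rule ccontr)
  assume ne: "\<not> ess_zero T"
  obtain e where e: "e > 0" and seq: "\<And>z n. z > 0 \<Longrightarrow>
    \<exists>x\<in>ell2_tail n. norm2 x = 1 \<and> e \<le> Znorm (T (Zj x)) \<and> norm2 (Zy (T (Zj x))) \<le> z"
    using not_ess_zero_sequence[OF T ne] by blast
  obtain K where K: "K > 0" "\<And>u. Znorm (T u) \<le> K * Znorm u" using op_bounded[OF T] by blast
  \<comment> \<open>The bound 1/2 keeps the blocks \<open>b i\<close> nonzero; the other one bounds
    the total perturbation \<open>(K + 3) * \<sigma>\<close> by \<open>e / 8\<close>.\<close>
  define \<sigma> where "\<sigma> = min (1 / 2) (e / (8 * (K + 3)))"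
  have \<sigma>: "\<sigma> > 0" "\<sigma> \<le> 1 / 2"
    using e K min.cobounded1[of "1 / 2" "e / (8 * (K + 3))"] unfolding \<sigma>_def by simp_all
  have L: "L * (e / (8 * L)) = e / 8" if "L > 0" for L using that by simp
  have "(K + 3) * \<sigma> \<le> (K + 3) * (e / (8 * (K + 3)))"
    unfolding \<sigma>_def using K by (intro mult_left_mono min.cobounded2) auto
  also have "\<dots> = e / 8" by (rule L) (use K in simp)
  finally have \<sigma>K: "(K + 3) * \<sigma> \<le> e / 8" .
  define \<eta> where "\<eta> i = \<sigma> / 2 ^ Suc i" for i :: nat
  have \<eta>: "\<eta> i > 0" "\<eta> i \<le> \<sigma>" for i
    using geometric_weights(1,2)[OF \<sigma>(1)] by (auto simp: \<eta>_def)
  have \<eta>mono: "\<eta> j \<le> \<eta> i" if "i \<le> j" for i j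
    using that \<sigma> unfolding \<eta>_def by (intro divide_left_mono power_increasing) auto
  have "\<forall>k. \<exists>x. x \<in> ell2_tail k \<and> norm2 x = 1 \<and> e \<le> Znorm (T (Zj x)) \<and> norm2 (Zy (T (Zj x))) \<le> \<eta> k"
    using seq \<eta>(1) by blast
  then obtain x where x: "\<And>k. x k \<in> ell2_tail k" "\<And>k. norm2 (x k) = 1"
    "\<And>k. e \<le> Znorm (T (Zj (x k)))" "\<And>k. norm2 (Zy (T (Zj (x k)))) \<le> \<eta> k" by metis
  have x2: "x k \<in> ell2" for k by (rule ell2_tail_ell2[OF x(1)])
  have null: "coord_null (\<lambda>k. Zj (x k))" "coord_null (\<lambda>k. T (Zj (x k)))"
    using x(2) x2 by (auto intro!: coord_null_Ztail[of "\<lambda>k. Zj (x k)"] Ztail_Zj x(1)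
        coord_null_op[OF T, where u = "\<lambda>k. Zj (x k)" and C = 1] simp: Znorm_Zj)
  obtain \<kappa> m :: "nat \<Rightarrow> nat" where \<kappa>: "strict_mono \<kappa>" and m: "strict_mono m"
    and ub: "\<And>i. Znorm (Zj (x (\<kappa> i)) - Zrestr {m i..<m (Suc i)} (Zj (x (\<kappa> i)))) < \<eta> i"
    and vb: "\<And>i. Znorm (T (Zj (x (\<kappa> i))) - Zrestr {m i..<m (Suc i)} (T (Zj (x (\<kappa> i))))) < \<eta> i"
    using gliding_hump_blocks[OF null, of \<eta>] \<eta> by metis
  define A where "A i = {m i..<m (Suc i)}" for i
  define b where "b i = restr (A i) (x (\<kappa> i))" for i
  define t where "t i = Zrestr (A i) (T (Zj (x (\<kappa> i))))" for i
  define z where "z i = Zd (t i)" for i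
  have A: "disjoint_family_on A F" for F unfolding A_def by (rule disjoint_family_intervals[OF m])
  have b: "b i \<in> ell2" "n \<notin> A i \<Longrightarrow> b i n = 0" "norm2 (b i) \<le> 1" for i n
    using norm2_restr_le[OF x2, of "A i" "\<kappa> i"] x(2) by (auto simp: b_def ell2_restr x2 restr_def)
  have z: "z i \<in> ell2" "n \<notin> A i \<Longrightarrow> z i n = 0" for i n
    by (auto simp: z_def Zd_ell2) (simp add: Zd_def t_def restr_def Omega_eq_0)
  have Zjb: "Zj (b i) = Zrestr (A i) (Zj (x (\<kappa> i)))" for i
    by (rule Z2_eqI) (auto simp: b_def ell2_restr x2 restr_def)
  have xb: "Znorm (Zj (x (\<kappa> i)) - Zj (b i)) \<le> \<eta> i" for i
    using ub[of i] by (simp add: Zjb A_def)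
  have ty: "Znorm (Zw (Zy (t i))) \<le> 2 * \<eta> i" for i
  proof -
    have "norm2 (Zy (t i)) \<le> norm2 (Zy (T (Zj (x (\<kappa> i)))))"
      by (simp add: t_def norm2_restr_le Zy_ell2)
    also have "\<dots> \<le> \<eta> (\<kappa> i)" by (rule x(4))
    also have "\<dots> \<le> \<eta> i" by (intro \<eta>mono strict_mono_imp_increasing \<kappa>)
    finally show ?thesis using Znorm_Zw_le[OF Zy_ell2, of "t i"] by linarith
  qed
  \<comment> \<open>The errors are \<open>\<eta> i\<close> for cutting the image to
    \<open>A i\<close>, \<open>2 * \<eta> i\<close> for dropping its section part and
    \<open>K * \<eta> i\<close> for replacing \<open>x (\<kappa> i)\<close> by
    \<open>b i\<close>.\<close>
  have near: "Znorm (T (Zj (b i)) - Zj (z i)) \<le> (K + 3) * \<eta> i" for i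
  proof -
    have "Zj (z i) = t i - Zw (Zy (t i))" using Z2_decompose[of "t i"] by (simp add: z_def eq_diff_eq)
    then have "T (Zj (b i)) - Zj (z i)
        = (T (Zj (x (\<kappa> i))) - t i) + Zw (Zy (t i)) - T (Zj (x (\<kappa> i)) - Zj (b i))"
      by (simp add: op_diff[OF T])
    also have "Znorm \<dots> \<le> (Znorm (T (Zj (x (\<kappa> i))) - t i) + Znorm (Zw (Zy (t i))))
        + Znorm (T (Zj (x (\<kappa> i)) - Zj (b i)))"
      by (intro order_trans[OF Znorm_triangle_diff] add_mono Znorm_triangle order_refl)
    also have "\<dots> \<le> (\<eta> i + 2 * \<eta> i) + K * \<eta> i"
      using vb[of i] K xb by (intro add_mono ty order_trans[OF K(2)] mult_left_mono) (auto simp: t_def A_def)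
    finally show ?thesis by (simp add: algebra_simps)
  qed
  \<comment> \<open>Passing to the block and to \<open>z i\<close> loses at most
    \<open>e / 8\<close> each time, which leaves \<open>e - e / 4\<close>; the estimate for blocks
    is then applied with \<open>e / 4\<close>.\<close>
  have zlow: "3 * (e / 4) \<le> norm2 (z i)" for i
  proof -
    have "T (Zj (x (\<kappa> i))) = Zj (z i) + (T (Zj (b i)) - Zj (z i)) + T (Zj (x (\<kappa> i)) - Zj (b i))"
      by (simp add: op_diff[OF T])
    then have "Znorm (T (Zj (x (\<kappa> i)))) \<le> (Znorm (Zj (z i)) + Znorm (T (Zj (b i)) - Zj (z i)))
        + Znorm (T (Zj (x (\<kappa> i)) - Zj (b i)))"
      by (simp only:) (intro order_trans[OF Znorm_triangle] add_mono Znorm_triangle order_refl)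
    also have "\<dots> \<le> (norm2 (z i) + (K + 3) * \<eta> i) + K * \<eta> i"
      using K xb by (intro add_mono near order_trans[OF K(2)] mult_left_mono) (auto simp: Znorm_Zj z)
    finally have "e \<le> norm2 (z i) + (K + 3) * \<eta> i + K * \<eta> i" using x(3)[of "\<kappa> i"] by simp
    moreover have "(K + 3) * \<eta> i \<le> e / 8"
      using K by (intro order_trans[OF mult_left_mono[OF \<eta>(2)[of i], of "K + 3"] \<sigma>K]) simp
    moreover have "K * \<eta> i \<le> (K + 3) * \<eta> i" using \<eta>(1)[of i] by (intro mult_right_mono) auto
    ultimately show ?thesis by simp
  qed
  have \<rho>sum: "(\<Sum>i\<in>F. (K + 3) * \<eta> i) \<le> e / 4" if "finite F" for F
  proof -
    have "(K + 3) * (\<Sum>i\<in>F. \<eta> i) \<le> (K + 3) * \<sigma>"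
      using geometric_weights(3)[OF \<sigma>(1) that] K by (intro mult_left_mono) (auto simp: \<eta>_def)
    then show ?thesis using \<sigma>K e by (simp add: sum_distrib_left)
  qed
  have "\<exists>n. b i n \<noteq> 0" for i
  proof (rule ccontr)
    assume "\<nexists>n. b i n \<noteq> 0"
    then have "Zj (b i) = 0" by (intro Z2_eqI) (auto simp: b)
    then have "1 \<le> \<eta> i" using xb[of i] by (simp add: Znorm_Zj x2 x)
    then show False using \<eta>(2)[of i] \<sigma> by simp
  qed
  then obtain p where p: "\<And>i. b i (p i) \<noteq> 0" by metis
  then have pA: "p i \<in> A i" for i using b(2) by blast
  \<comment> \<open>The closed span of the blocks, given by closed conditions on coordinates so that
    no closure has to be taken. The cross-multiplied relation says that on \<open>A i\<close> the
    vector is a multiple of \<open>b i\<close>, without naming the factor.\<close>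
  define M where "M = {u :: 'k Z2. (\<forall>n. Zy u n = 0) \<and> (\<forall>n. n < m 0 \<longrightarrow> Zx u n = 0)
    \<and> (\<forall>i n n'. n \<in> A i \<and> n' \<in> A i \<longrightarrow> Zx u n * b i n' = Zx u n' * b i n)}"
  have sub: "Z2.subspace M"
    unfolding Z2.subspace_def M_def by (auto simp: algebra_simps)
  have cl: "closed M"
    unfolding M_def
    by (intro closed_Collect_conj closed_Collect_all closed_Collect_imp open_Collect_const
        closed_coordinate_relation)
  have bM: "Zj (b i) \<in> M" for i
  proof -
    have "m 0 \<le> m i" using m by (simp add: strict_mono_less_eq)
    then have 1: "b i n = 0" if "n < m 0" for n using that by (intro b) (simp add: A_def)
    have 2: "b i n = 0" if "n \<in> A j" "j \<noteq> i" for j n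
      using A[of UNIV] that by (intro b) (auto simp: disjoint_family_on_def)
    show ?thesis by (auto simp: M_def b 1) (metis 2 mult.commute mult_zero_left)
  qed
  have notfd: "\<not> (\<exists>B. finite B \<and> M \<subseteq> Z2.span B)"
  proof
    assume "\<exists>B. finite B \<and> M \<subseteq> Z2.span B"
    then obtain B where B: "finite B" "M \<subseteq> Z2.span B" by blast
    have ind: "Z2.independent ((\<lambda>i. Zj (b i)) ` {..<N}) \<and> card ((\<lambda>i. Zj (b i)) ` {..<N}) = N" for N
    proof (induction N)
      case (Suc N)
      \<comment> \<open>All earlier blocks vanish at \<open>p N\<close>, while \<open>b N\<close>
        does not; so each block is independent of its predecessors.\<close>
      have "Z2.span ((\<lambda>i. Zj (b i)) ` {..<N}) \<subseteq> {u. Zx u (p N) = 0}"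
      proof (rule Z2.span_minimal)
        show "Z2.subspace {u. Zx u (p N) = 0}" by (simp add: Z2.subspace_def)
        have "p N \<notin> A i" if "i < N" for i
        proof -
          have "A i \<inter> A N = {}" using A[of UNIV] that by (simp add: disjoint_family_on_def)
          then show ?thesis using pA[of N] by blast
        qed
        then show "(\<lambda>i. Zj (b i)) ` {..<N} \<subseteq> {u. Zx u (p N) = 0}" by (auto simp: b)
      qed
      then have n: "Zj (b N) \<notin> Z2.span ((\<lambda>i. Zj (b i)) ` {..<N})" using p[of N] by (auto simp: b)
      then have "Zj (b N) \<notin> (\<lambda>i. Zj (b i)) ` {..<N}" using Z2.span_base by metis
      then show ?case using Suc n by (simp add: lessThan_Suc Z2.independent_insert)
    qed (simp add: Z2.independent_empty)
    have "(\<lambda>i. Zj (b i)) ` {..<Suc (card B)} \<subseteq> Z2.span B" using bM B by auto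
    then have "card ((\<lambda>i. Zj (b i)) ` {..<Suc (card B)}) \<le> card B"
      using Z2.independent_span_bound[OF B(1) conjunct1[OF ind]] by simp
    then show False using ind[of "Suc (card B)"] by simp
  qed
  have low: "Znorm u \<le> (2 / e) * Znorm (T u)" if u: "u \<in> M" for u
  proof -
    define a where "a i = Zx u (p i) / b i (p i)" for i
    have xa: "Zx u n = a i * b i n" if "n \<in> A i" for n i
    proof -
      have "Zx u n * b i (p i) = Zx u (p i) * b i n" using u that pA[of i] unfolding M_def by blast
      then show ?thesis using p[of i] by (simp add: a_def nonzero_eq_divide_eq)
    qed
    have P: "Zrestr {..<m N} u = (\<Sum>i<N. Z2_scale (a i) (Zj (b i)))" for N
    proof (induction N)
      case 0
      show ?case using u by (intro Z2_eqI) (auto simp: restr_def M_def)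
    next
      case (Suc N)
      have "m N < m (Suc N)" using m by (simp add: strict_mono_less)
      then have "Zrestr {..<m (Suc N)} u = Zrestr {..<m N} u + Zrestr (A N) u"
        by (intro Z2_eqI) (auto simp: restr_def A_def)
      moreover have "Zrestr (A N) u = Z2_scale (a N) (Zj (b N))"
        using u xa[of _ N] by (intro Z2_eqI) (auto simp: restr_def b M_def)
      ultimately show ?case using Suc by simp
    qed
    have est: "Znorm (Zrestr {..<m N} u) \<le> (2 / e) * Znorm (T (Zrestr {..<m N} u))" for N
      using block_basis_estimate[OF T _ A[of "{..<N}"] b z zlow near \<rho>sum, of a] e
      by (simp add: P field_simps)
    \<comment> \<open>The estimate holds for the finite block sums
      \<open>Zrestr {m N..<..}\<close>-free part \<open>?P\<close>; the remainder \<open>?R\<close>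
      tends to 0 with \<open>N\<close>, so it extends to \<open>u\<close>.\<close>
    have bound: "Znorm u \<le> (2 / e) * Znorm (T u) + (2 / e * K + 1) * Znorm (Zrestr {m N..} u)" for N
    proof -
      let ?P = "Zrestr {..<m N} u" and ?R = "Zrestr {m N..} u"
      have "?P = u - ?R" using Zrestr_split[of "m N" u] by (simp add: eq_diff_eq)
      then have "T ?P = T u - T ?R" by (simp add: op_diff[OF T])
      then have "Znorm (T ?P) \<le> Znorm (T u) + K * Znorm ?R"
        using Znorm_triangle_diff[of "T u" "T ?R"] K(2)[of ?R] by simp
      then have "(2 / e) * Znorm (T ?P) \<le> (2 / e) * (Znorm (T u) + K * Znorm ?R)"
        using e by (intro mult_left_mono) auto
      moreover have "Znorm u \<le> Znorm ?P + Znorm ?R"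
        using Znorm_triangle[of ?P ?R] by (simp add: Zrestr_split)
      ultimately show ?thesis using est[of N] by (simp add: algebra_simps)
    qed
    have "(\<lambda>N. (2 / e) * Znorm (T u) + (2 / e * K + 1) * Znorm (Zrestr {m N..} u))
        \<longlonglongrightarrow> (2 / e) * Znorm (T u) + (2 / e * K + 1) * 0"
      using LIMSEQ_subseq_LIMSEQ[OF Znorm_tail_tendsto m] by (intro tendsto_intros) (simp add: o_def)
    then show ?thesis using bound by (intro LIMSEQ_le_const) auto
  qed
  have "isomorphic_on T M" by (rule isomorphic_onI[OF T sub _ low]) (use e in auto)
  then show False using ss sub cl notfd unfolding strictly_singular_def by blast
qed

lemma strictly_singular_operators_eq:
  "Z2_strictly_singular_operators = {T \<in> Z2_operators :: ('k::{real_or_complex,banach} Z2 \<Rightarrow> 'k Z2) set. ess_zero T}"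
  using ess_zero_imp_strictly_singular strictly_singular_imp_ess_zero
  unfolding Z2_strictly_singular_operators_def by blast


section \<open>Norms on the quotient algebra\<close>

definition ss_coset :: "('k::real_normed_field Z2 \<Rightarrow> 'k Z2) \<Rightarrow> ('k Z2 \<Rightarrow> 'k Z2) set" where
  "ss_coset T = (\<lambda>h u. h u + T u) ` Z2_strictly_singular_operators"

lemma a_r_coset_eq:
  "a_r_coset Z2_operator_algebra Z2_strictly_singular_operators T = ss_coset T"
  by (auto simp: a_r_coset_def' Z2_operator_algebra_def ss_coset_def)

lemma Z2_quotient_algebra_simps:
  "carrier Z2_quotient_algebra = ss_coset ` Z2_operators"
  "\<zero>\<^bsub>Z2_quotient_algebra\<^esub> = Z2_strictly_singular_operators"
  "X \<oplus>\<^bsub>Z2_quotient_algebra\<^esub> Y = (\<Union>S\<in>X. \<Union>T\<in>Y. {\<lambda>u. S u + T u})"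
  "X \<otimes>\<^bsub>Z2_quotient_algebra\<^esub> Y = (\<Union>S\<in>X. \<Union>T\<in>Y. ss_coset (S \<circ> T))"
  "c \<odot>\<^bsub>Z2_quotient_algebra\<^esub> X = (\<Union>T\<in>X. ss_coset (\<lambda>u. Z2_scale c (T u)))"
  "star Z2_quotient_algebra X = (\<Union>T\<in>X. ss_coset (Z2_star T))"
  by (simp_all only: Z2_quotient_algebra_def quotient_star_algebra_def a_r_coset_eq
      FactRing_def A_RCOSETS_def' set_add_def' rcoset_mult_def star_algebra.simps module.simps
      ring.simps monoid.simps partial_object.simps)
    (auto simp: Z2_operator_algebra_def)

lemma ss_op_iff: "T \<in> Z2_strictly_singular_operators \<longleftrightarrow> T \<in> Z2_operators \<and> ess_zero T"
  for T :: "'k::{real_or_complex,banach} Z2 \<Rightarrow> 'k Z2"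
  by (simp add: strictly_singular_operators_eq)

lemma ss_op_0: "(\<lambda>_. 0 :: 'k::{real_or_complex,banach} Z2) \<in> Z2_strictly_singular_operators"
  by (auto simp: ss_op_iff op_zero ess_zero_def ess_le_def norm2_nonneg ell2_tail_def)

context
  fixes S T :: "'k::{real_or_complex,banach} Z2 \<Rightarrow> 'k Z2"
begin

lemma ss_op_add: "S \<in> Z2_strictly_singular_operators \<Longrightarrow> T \<in> Z2_strictly_singular_operators
    \<Longrightarrow> (\<lambda>u. S u + T u) \<in> Z2_strictly_singular_operators"
  by (simp add: ss_op_iff op_plus ess_zero_add)

lemma ss_op_smult: "T \<in> Z2_strictly_singular_operators
    \<Longrightarrow> (\<lambda>u. Z2_scale c (T u)) \<in> Z2_strictly_singular_operators"
  by (simp add: ss_op_iff op_smult ess_zero_scale)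

lemma ss_op_star: "T \<in> Z2_strictly_singular_operators \<Longrightarrow> Z2_star T \<in> Z2_strictly_singular_operators"
  by (simp add: ss_op_iff Z2_star_op ess_zero_star)

lemma self_in_ss_coset: "T \<in> ss_coset T"
  using ss_op_0 by (auto simp: ss_coset_def image_iff intro!: bexI[of _ "\<lambda>_. 0"])

end

lemma ss_op_minus: "T \<in> Z2_strictly_singular_operators \<Longrightarrow> (\<lambda>u. - T u) \<in> Z2_strictly_singular_operators"
  for T :: "'k::{real_or_complex,banach} Z2 \<Rightarrow> 'k Z2"
  using ss_op_smult[of T "-1"] by simp

lemma ss_coset_eqI:
  fixes S T :: "'k::{real_or_complex,banach} Z2 \<Rightarrow> 'k Z2"
  assumes "S \<in> ss_coset T"
  shows "ss_coset S = ss_coset T"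
proof -
  obtain h where h: "h \<in> Z2_strictly_singular_operators" "S = (\<lambda>u. h u + T u)"
    using assms by (auto simp: ss_coset_def)
  have 1: "(\<lambda>u. g u + S u) \<in> ss_coset T" if "g \<in> Z2_strictly_singular_operators" for g
    using ss_op_add[OF that h(1)] unfolding ss_coset_def h(2)
    by (intro image_eqI[of _ _ "\<lambda>u. g u + h u"]) (auto simp: add.assoc)
  have 2: "(\<lambda>u. g u + T u) \<in> ss_coset S" if "g \<in> Z2_strictly_singular_operators" for g
    using ss_op_add[OF that ss_op_minus[OF h(1)]] unfolding ss_coset_def h(2)
    by (intro image_eqI[of _ _ "\<lambda>u. g u + - h u"]) (auto simp: add.assoc)
  show ?thesis
  proof
    show "ss_coset S \<subseteq> ss_coset T" using 1 by (auto simp: ss_coset_def[of S])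
    show "ss_coset T \<subseteq> ss_coset S" using 2 by (auto simp: ss_coset_def[of T])
  qed
qed

lemma ss_coset_op: "S \<in> ss_coset T \<Longrightarrow> T \<in> Z2_operators \<Longrightarrow> S \<in> Z2_operators"
  for T :: "'k::{real_or_complex,banach} Z2 \<Rightarrow> 'k Z2"
  by (auto simp: ss_coset_def ss_op_iff op_plus)

lemma ss_coset_of_ss_op:
  fixes T :: "'k::{real_or_complex,banach} Z2 \<Rightarrow> 'k Z2"
  assumes "T \<in> Z2_strictly_singular_operators"
  shows "ss_coset T = Z2_strictly_singular_operators"
proof -
  have "ss_coset (\<lambda>_. 0) = Z2_strictly_singular_operators" by (auto simp: ss_coset_def image_def)
  moreover have "T \<in> ss_coset (\<lambda>_. 0)" using assms by (simp add: calculation)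
  ultimately show ?thesis using ss_coset_eqI by metis
qed

text \<open>\<open>G c T\<close> is read as "\<open>T\<close> has size at most \<open>c\<close>".
  Working with a relation instead of a function lets one proof treat both norms and avoids defining
  the essential size of an operator as an infimum of its own.\<close>

definition coset_size ::
  "(real \<Rightarrow> ('k::real_normed_field Z2 \<Rightarrow> 'k Z2) \<Rightarrow> bool) \<Rightarrow> ('k Z2 \<Rightarrow> 'k Z2) set \<Rightarrow> real" where
  "coset_size G X = Inf {c. 0 \<le> c \<and> (\<exists>T\<in>X. G c T)}"

lemma coset_size_le: "0 \<le> c \<Longrightarrow> T \<in> X \<Longrightarrow> G c T \<Longrightarrow> coset_size G X \<le> c"
  unfolding coset_size_def by (intro cInf_lower) (auto intro: bdd_belowI[of _ 0])

lemma coset_size_ge: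
  assumes "\<exists>c\<ge>0. \<exists>T\<in>X. G c T" "\<And>c T. 0 \<le> c \<Longrightarrow> T \<in> X \<Longrightarrow> G c T \<Longrightarrow> b \<le> c"
  shows "b \<le> coset_size G X"
  unfolding coset_size_def using assms by (intro cInf_greatest) auto

lemma coset_size_lessE:
  assumes "coset_size G X < b" "\<exists>c\<ge>0. \<exists>T\<in>X. G c T"
  obtains c T where "0 \<le> c" "c < b" "T \<in> X" "G c T"
  using assms cInf_lessD[of "{c. 0 \<le> c \<and> (\<exists>T\<in>X. G c T)}" b] unfolding coset_size_def by blast

text \<open>The slack \<open>c * d < e\<close> in \<open>mult\<close> is what
  \<open>ess_le_comp\<close> provides, and it disappears in the infimum. The assumption
  \<open>ess\<close> yields definiteness: representatives of arbitrarily small size make the whole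
  coset strictly singular.\<close>

lemma coset_size_star_algebra_norm:
  fixes G :: "real \<Rightarrow> ('k::{real_or_complex,banach} Z2 \<Rightarrow> 'k Z2) \<Rightarrow> bool"
  assumes ex: "\<And>T. T \<in> Z2_operators \<Longrightarrow> \<exists>c\<ge>0. G c T"
    and zero: "G 0 (\<lambda>_. 0)"
    and add: "\<And>c d S T. S \<in> Z2_operators \<Longrightarrow> T \<in> Z2_operators \<Longrightarrow> G c S \<Longrightarrow> G d T
      \<Longrightarrow> G (c + d) (\<lambda>u. S u + T u)"
    and smult: "\<And>a d T. T \<in> Z2_operators \<Longrightarrow> G d T \<Longrightarrow> G (norm a * d) (\<lambda>u. Z2_scale a (T u))"
    and mult: "\<And>c d e S T. S \<in> Z2_operators \<Longrightarrow> T \<in> Z2_operators \<Longrightarrow> 0 \<le> c \<Longrightarrow> 0 \<le> d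
      \<Longrightarrow> G c S \<Longrightarrow> G d T \<Longrightarrow> c * d < e \<Longrightarrow> G e (S \<circ> T)"
    and star: "\<And>c T. T \<in> Z2_operators \<Longrightarrow> G c T \<Longrightarrow> G c (Z2_star T)"
    and ess: "\<And>c T. T \<in> Z2_operators \<Longrightarrow> G c T \<Longrightarrow> ess_le c T"
  shows "star_algebra_norm Z2_quotient_algebra (coset_size G)"
proof -
  let ?Q = "Z2_quotient_algebra :: ('k, ('k Z2 \<Rightarrow> 'k Z2) set) star_algebra"
  let ?I = "Z2_strictly_singular_operators :: ('k Z2 \<Rightarrow> 'k Z2) set"
  let ?N = "coset_size G"
  have op: "T \<in> Z2_operators" "X = ss_coset T" if X: "X \<in> carrier ?Q" and T: "T \<in> X" for X T
  proof -
    obtain T' where T': "T' \<in> Z2_operators" "X = ss_coset T'"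
      using X by (auto simp: Z2_quotient_algebra_simps)
    show "T \<in> Z2_operators" using ss_coset_op T T' by blast
    show "X = ss_coset T" using ss_coset_eqI[of T T'] T T'(2) by simp
  qed
  have nonempty: "\<exists>c\<ge>0. \<exists>T\<in>X. G c T" if X: "X \<in> carrier ?Q" for X
  proof -
    obtain T where "T \<in> Z2_operators" "X = ss_coset T" using X by (auto simp: Z2_quotient_algebra_simps)
    then show ?thesis using ex self_in_ss_coset by blast
  qed
  have near: "\<exists>c T. 0 \<le> c \<and> c < ?N X + e \<and> T \<in> X \<and> G c T"
    if "X \<in> carrier ?Q" "e > 0" for X e
  proof -
    have "?N X < ?N X + e" using that by simp
    then show ?thesis using nonempty[OF that(1)] by (rule coset_size_lessE) blast
  qed
  have pos: "0 \<le> ?N X" if "X \<in> carrier ?Q" for X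
    by (rule coset_size_ge[of X G, OF nonempty[OF that]])
  have N0: "?N X = 0 \<longleftrightarrow> X = ?I" if X: "X \<in> carrier ?Q" for X
  proof
    assume "X = ?I"
    then have "?N X \<le> 0" using zero ss_op_0 by (intro coset_size_le) auto
    then show "?N X = 0" using pos[OF X] by simp
  next
    assume N: "?N X = 0"
    obtain T where T: "T \<in> Z2_operators" "X = ss_coset T" using X by (auto simp: Z2_quotient_algebra_simps)
    \<comment> \<open>The small representative \<open>S\<close> changes with \<open>e\<close>; the
      fixed \<open>T\<close> differs from it by a strictly singular \<open>h\<close>, which is
      essentially small as well.\<close>
    have "ess_zero T" unfolding ess_zero_def
    proof (intro allI impI)
      fix e :: real assume e: "e > 0"
      then have "?N X < e / 2" using N by simp
      then obtain c S where S: "c < e / 2" "S \<in> X" "G c S"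
        using nonempty[OF X] by (rule coset_size_lessE)
      have "T \<in> ss_coset S" using self_in_ss_coset op(2)[OF X S(2)] T(2) by metis
      then obtain h where h: "h \<in> ?I" "T = (\<lambda>u. h u + S u)" by (auto simp: ss_coset_def)
      have "ess_le (e / 2) h" using h(1) e by (simp add: ss_op_iff ess_zero_def)
      moreover have "ess_le (e / 2) S" using ess_le_mono[OF ess[OF op(1)[OF X S(2)] S(3)]] S(1) by simp
      ultimately show "ess_le e T" using ess_le_add[of "e / 2" h "e / 2" S] h(2) by simp
    qed
    then show "X = ?I" using T ss_coset_of_ss_op[of T] by (simp add: ss_op_iff)
  qed
  have Nadd: "?N (X \<oplus>\<^bsub>?Q\<^esub> Y) \<le> ?N X + ?N Y" if X: "X \<in> carrier ?Q" and Y: "Y \<in> carrier ?Q" for X Y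
  proof (rule field_le_epsilon)
    fix e :: real assume e: "e > 0"
    then have e2: "e / 2 > 0" by simp
    obtain c S where S: "0 \<le> c" "c < ?N X + e / 2" "S \<in> X" "G c S"
      using near[OF X e2] by blast
    obtain d T where T: "0 \<le> d" "d < ?N Y + e / 2" "T \<in> Y" "G d T"
      using near[OF Y e2] by blast
    have "?N (X \<oplus>\<^bsub>?Q\<^esub> Y) \<le> c + d"
    proof (rule coset_size_le)
      show "(\<lambda>u. S u + T u) \<in> X \<oplus>\<^bsub>?Q\<^esub> Y" using S T by (auto simp: Z2_quotient_algebra_simps)
      show "G (c + d) (\<lambda>u. S u + T u)" by (rule add[OF op(1)[OF X S(3)] op(1)[OF Y T(3)] S(4) T(4)])
    qed (use S T in simp)
    then show "?N (X \<oplus>\<^bsub>?Q\<^esub> Y) \<le> ?N X + ?N Y + e" using S T by simp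
  qed
  have Nmult: "?N (X \<otimes>\<^bsub>?Q\<^esub> Y) \<le> ?N X * ?N Y" if X: "X \<in> carrier ?Q" and Y: "Y \<in> carrier ?Q" for X Y
  proof (rule field_le_epsilon)
    fix e :: real assume e: "e > 0"
    define K where "K = ?N X + ?N Y + 2"
    have K: "K > 0" using pos[OF X] pos[OF Y] by (simp add: K_def)
    \<comment> \<open>Chosen so that \<open>(?N X + t) * (?N Y + t)\<close> exceeds
      \<open>?N X * ?N Y\<close> by at most \<open>t * K \<le> e\<close>.\<close>
    define t where "t = min 1 (e / K)"
    have t: "t > 0" "t \<le> 1" "t * K \<le> e" using e K by (auto simp: t_def min_def field_simps)
    obtain c S where S: "0 \<le> c" "c < ?N X + t" "S \<in> X" "G c S"
      using near[OF X t(1)] by blast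
    obtain d T where T: "0 \<le> d" "d < ?N Y + t" "T \<in> Y" "G d T"
      using near[OF Y t(1)] by blast
    have cd: "c * d < (?N X + t) * (?N Y + t)" using S T by (intro mult_strict_mono') auto
    have "?N (X \<otimes>\<^bsub>?Q\<^esub> Y) \<le> (?N X + t) * (?N Y + t)"
    proof (rule coset_size_le)
      show "S \<circ> T \<in> X \<otimes>\<^bsub>?Q\<^esub> Y" using S T self_in_ss_coset by (auto simp: Z2_quotient_algebra_simps)
      show "G ((?N X + t) * (?N Y + t)) (S \<circ> T)"
        by (rule mult[OF op(1)[OF X S(3)] op(1)[OF Y T(3)] S(1) T(1) S(4) T(4) cd])
    qed (use pos[OF X] pos[OF Y] t in simp)
    also have "\<dots> = ?N X * ?N Y + t * (?N X + ?N Y + t)" by (simp add: algebra_simps)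
    also have "t * (?N X + ?N Y + t) \<le> t * K" using t by (intro mult_left_mono) (auto simp: K_def)
    finally show "?N (X \<otimes>\<^bsub>?Q\<^esub> Y) \<le> ?N X * ?N Y + e" using t by simp
  qed
  have sc_in: "(\<lambda>u. Z2_scale a (T u)) \<in> a \<odot>\<^bsub>?Q\<^esub> X" if "T \<in> X" for a X T
    using that self_in_ss_coset by (auto simp: Z2_quotient_algebra_simps)
  have Nsc: "?N (a \<odot>\<^bsub>?Q\<^esub> X) = norm a * ?N X" if X: "X \<in> carrier ?Q" for a X
  proof (cases "a = 0")
    case True
    obtain T where T: "T \<in> X" using nonempty[OF X] by blast
    have "?N (a \<odot>\<^bsub>?Q\<^esub> X) \<le> 0" using zero sc_in[OF T, of a] True by (intro coset_size_le) auto
    moreover have "0 \<le> ?N (a \<odot>\<^bsub>?Q\<^esub> X)"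
      using zero sc_in[OF T, of a] True by (intro coset_size_ge) (auto intro!: exI[of _ 0])
    ultimately show ?thesis using True by simp
  next
    case False
    \<comment> \<open>Besides the multiples \<open>a * T\<close> the coset contains their strictly
      singular perturbations; division by \<open>a\<close> brings all of them back into
      \<open>X\<close>, which gives the lower bound.\<close>
    have inverse_in: "(\<lambda>u. Z2_scale (inverse a) (S u)) \<in> X" "S \<in> Z2_operators" if S: "S \<in> a \<odot>\<^bsub>?Q\<^esub> X" for S
    proof -
      obtain T h where T: "T \<in> X" and h: "h \<in> ?I" "S = (\<lambda>u. h u + Z2_scale a (T u))"
        using S by (auto simp: Z2_quotient_algebra_simps ss_coset_def)
      have "(\<lambda>u. Z2_scale (inverse a) (S u)) = (\<lambda>u. Z2_scale (inverse a) (h u) + T u)"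
        using False by (simp add: h Z2.scale_right_distrib)
      then show "(\<lambda>u. Z2_scale (inverse a) (S u)) \<in> X"
        using ss_op_smult[OF h(1), of "inverse a"] op(2)[OF X T] by (auto simp: ss_coset_def)
      show "S \<in> Z2_operators" using h op(1)[OF X T] by (auto simp: ss_op_iff intro: op_plus op_smult)
    qed
    have ne: "\<exists>c\<ge>0. \<exists>T\<in>a \<odot>\<^bsub>?Q\<^esub> X. G c T"
      using nonempty[OF X] sc_in smult op(1)[OF X] by (meson mult_nonneg_nonneg norm_ge_zero)
    have "?N (a \<odot>\<^bsub>?Q\<^esub> X) / norm a \<le> ?N X"
    proof (rule coset_size_ge[OF nonempty[OF X]])
      fix c T assume "0 \<le> c" "T \<in> X" "G c T"
      then have "?N (a \<odot>\<^bsub>?Q\<^esub> X) \<le> norm a * c"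
        using op(1)[OF X] by (intro coset_size_le[OF _ sc_in] smult) auto
      then show "?N (a \<odot>\<^bsub>?Q\<^esub> X) / norm a \<le> c" using False by (simp add: field_simps)
    qed
    moreover have "norm a * ?N X \<le> ?N (a \<odot>\<^bsub>?Q\<^esub> X)"
    proof (rule coset_size_ge[OF ne])
      fix c S assume c: "0 \<le> c" "S \<in> a \<odot>\<^bsub>?Q\<^esub> X" "G c S"
      then have "?N X \<le> norm (inverse a) * c"
        using inverse_in by (intro coset_size_le[OF _ inverse_in(1)] smult) auto
      then have "?N X \<le> inverse (norm a) * c" using False by (simp add: norm_inverse)
      then show "norm a * ?N X \<le> c" using False by (simp add: field_simps)
    qed
    ultimately show ?thesis using False by (simp add: field_simps)
  qed
  have star_in: "Z2_star T \<in> star ?Q X" if "T \<in> X" for X T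
    using that self_in_ss_coset by (auto simp: Z2_quotient_algebra_simps)
  have Nstar: "?N (star ?Q X) = ?N X" if X: "X \<in> carrier ?Q" for X
  proof (rule antisym)
    show "?N (star ?Q X) \<le> ?N X"
    proof (rule coset_size_ge[OF nonempty[OF X]])
      fix c T assume "0 \<le> c" "T \<in> X" "G c T"
      then show "?N (star ?Q X) \<le> c" using op(1)[OF X] by (intro coset_size_le[OF _ star_in] star) auto
    qed
    have inverse_in: "Z2_star S \<in> X" "S \<in> Z2_operators" if S: "S \<in> star ?Q X" for S
    proof -
      obtain T h where T: "T \<in> X" and h: "h \<in> ?I" "S = (\<lambda>u. h u + Z2_star T u)"
        using S by (auto simp: Z2_quotient_algebra_simps ss_coset_def)
      note T' = op(1)[OF X T]
      have h': "h \<in> Z2_operators" using h by (simp add: ss_op_iff)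
      have "Z2_star S = (\<lambda>u. Z2_star h u + T u)"
        by (simp add: h Z2_star_add[OF h' Z2_star_op[OF T']] Z2_star_star[OF T'])
      then show "Z2_star S \<in> X" using ss_op_star[OF h(1)] op(2)[OF X T] by (auto simp: ss_coset_def)
      show "S \<in> Z2_operators" unfolding h(2) by (intro op_plus h' Z2_star_op T')
    qed
    show "?N X \<le> ?N (star ?Q X)"
    proof (rule coset_size_ge)
      show "\<exists>c\<ge>0. \<exists>T\<in>star ?Q X. G c T" using nonempty[OF X] star_in star op(1)[OF X] by meson
      fix c S assume "0 \<le> c" "S \<in> star ?Q X" "G c S"
      then show "?N X \<le> c" using inverse_in by (intro coset_size_le[OF _ inverse_in(1)] star) auto
    qed
  qed
  show ?thesis
    unfolding star_algebra_norm_def algebra_norm_def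
    using pos N0 Nadd Nsc Nmult Nstar by (simp add: Z2_quotient_algebra_simps(2))
qed

section \<open>The two norms\<close>

definition op_size :: "real \<Rightarrow> ('k::{real_or_complex,banach} Z2 \<Rightarrow> 'k Z2) \<Rightarrow> bool" where
  "op_size c T \<longleftrightarrow> (\<forall>u. Znorm (T u) \<le> c * Znorm u \<and> Znorm (Z2_star T u) \<le> c * Znorm u)"

definition ess_size :: "real \<Rightarrow> ('k::{real_or_complex,banach} Z2 \<Rightarrow> 'k Z2) \<Rightarrow> bool" where
  "ess_size c T \<longleftrightarrow> ess_le c T \<and> ess_le c (Z2_star T)"

lemma op_size_exists:
  fixes T :: "'k::{real_or_complex,banach} Z2 \<Rightarrow> 'k Z2"
  assumes T: "T \<in> Z2_operators"
  shows "\<exists>c\<ge>0. op_size c T"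
proof -
  obtain C where C: "C > 0" "\<And>u. Znorm (T u) \<le> C * Znorm u" using op_bounded[OF T] by blast
  obtain D where D: "D > 0" "\<And>u. Znorm (Z2_star T u) \<le> D * Znorm u"
    using op_bounded[OF Z2_star_op[OF T]] by blast
  have "C * Znorm u \<le> max C D * Znorm u" "D * Znorm u \<le> max C D * Znorm u" for u :: "'k Z2"
    by (auto intro: mult_right_mono)
  then have "op_size (max C D) T" unfolding op_size_def using C(2) D(2) order_trans by blast
  then show ?thesis using C by (intro exI[of _ "max C D"]) auto
qed

lemma op_size_imp_ess_size: "op_size c T \<Longrightarrow> ess_size c T"
  by (simp add: op_size_def ess_size_def ess_le_bounded)

theorem op_size_norm:
  "star_algebra_norm (Z2_quotient_algebra :: ('k::{real_or_complex,banach}, _) star_algebra)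
    (coset_size op_size)"
proof (rule coset_size_star_algebra_norm)
  show "op_size 0 (\<lambda>_. 0 :: 'k Z2)" by (simp add: op_size_def Z2_star_zero)
next
  fix c d and S T :: "'k Z2 \<Rightarrow> 'k Z2"
  assume "S \<in> Z2_operators" "T \<in> Z2_operators" "op_size c S" "op_size d T"
  then show "op_size (c + d) (\<lambda>u. S u + T u)"
    by (auto simp: op_size_def Z2_star_add distrib_right intro!: order_trans[OF Znorm_triangle] add_mono)
next
  fix d a and T :: "'k Z2 \<Rightarrow> 'k Z2"
  assume "T \<in> Z2_operators" "op_size d T"
  then show "op_size (norm a * d) (\<lambda>u. Z2_scale a (T u))"
    by (auto simp: op_size_def Z2_star_smult Znorm_scale mult.assoc intro!: mult_left_mono)
next
  fix c d e and S T :: "'k Z2 \<Rightarrow> 'k Z2"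
  assume S: "S \<in> Z2_operators" and T: "T \<in> Z2_operators" and c: "0 \<le> c" "0 \<le> d"
    and G: "op_size c S" "op_size d T" and e: "c * d < e"
  have "Znorm (S (T u)) \<le> e * Znorm u \<and> Znorm (Z2_star T (Z2_star S u)) \<le> e * Znorm u" for u
  proof -
    have "Znorm (S (T u)) \<le> c * (d * Znorm u)" "Znorm (Z2_star T (Z2_star S u)) \<le> d * (c * Znorm u)"
      using G c by (meson mult_left_mono op_size_def order_trans)+
    moreover have "c * d * Znorm u \<le> e * Znorm u" using e by (intro mult_right_mono) auto
    ultimately show ?thesis by (simp add: mult_ac)
  qed
  then show "op_size e (S \<circ> T)" by (simp add: op_size_def Z2_star_comp[OF S T])
next
  fix c and T :: "'k Z2 \<Rightarrow> 'k Z2"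
  assume T: "T \<in> Z2_operators" and G: "op_size c T"
  show "op_size c (Z2_star T)" using G by (simp add: op_size_def Z2_star_star[OF T])
  show "ess_le c T" using op_size_imp_ess_size[OF G] by (simp add: ess_size_def)
qed (rule op_size_exists)

theorem ess_size_norm:
  "star_algebra_norm (Z2_quotient_algebra :: ('k::{real_or_complex,banach}, _) star_algebra)
    (coset_size ess_size)"
proof (rule coset_size_star_algebra_norm)
  fix T :: "'k Z2 \<Rightarrow> 'k Z2" assume "T \<in> Z2_operators"
  then show "\<exists>c\<ge>0. ess_size c T" using op_size_exists op_size_imp_ess_size by blast
next
  show "ess_size 0 (\<lambda>_. 0 :: 'k Z2)" by (simp add: ess_size_def ess_le_def Z2_star_zero)
next
  fix c d and S T :: "'k Z2 \<Rightarrow> 'k Z2"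
  assume "S \<in> Z2_operators" "T \<in> Z2_operators" "ess_size c S" "ess_size d T"
  then show "ess_size (c + d) (\<lambda>u. S u + T u)" by (simp add: ess_size_def Z2_star_add ess_le_add)
next
  fix d a and T :: "'k Z2 \<Rightarrow> 'k Z2"
  assume "T \<in> Z2_operators" "ess_size d T"
  then show "ess_size (norm a * d) (\<lambda>u. Z2_scale a (T u))"
    using ess_le_scale[of d "Z2_star T" "scalar_cnj a"] by (simp add: ess_size_def Z2_star_smult ess_le_scale)
next
  fix c d e and S T :: "'k Z2 \<Rightarrow> 'k Z2"
  assume S: "S \<in> Z2_operators" and T: "T \<in> Z2_operators" and "0 \<le> c" "0 \<le> d"
    and "ess_size c S" "ess_size d T" and "c * d < e"
  then show "ess_size e (S \<circ> T)"
    using ess_le_comp[OF S T, of c d e] ess_le_comp[OF Z2_star_op[OF T] Z2_star_op[OF S], of d c e]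
    by (simp add: ess_size_def Z2_star_comp[OF S T] mult.commute)
next
  fix c and T :: "'k Z2 \<Rightarrow> 'k Z2"
  assume T: "T \<in> Z2_operators" and G: "ess_size c T"
  show "ess_size c (Z2_star T)" "ess_le c T" using G by (simp_all add: ess_size_def Z2_star_star[OF T])
qed


section \<open>Block operators\<close>

lemma sum_lessThan_add: "(\<Sum>n<a + d. f n) = (\<Sum>n<a. f n) + (\<Sum>j<d. f (a + j))"
  for f :: "nat \<Rightarrow> 'a::comm_monoid_add"
  by (induction d) (auto simp: add.assoc)

lemma sum_blocks: "(\<Sum>n<d * N. f n) = (\<Sum>q<N. \<Sum>j<d. f (d * q + j))"
  for f :: "nat \<Rightarrow> 'a::comm_monoid_add"
  by (induction N) (auto simp: sum_lessThan_add add.commute[of d])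

section \<open>The logarithmic map on linear combinations\<close>

definition xlog :: "'k::real_normed_field \<Rightarrow> 'k" where "xlog t = t * of_real (ln (norm t))"

lemma xlog_0 [simp]: "xlog 0 = 0"
  by (simp add: xlog_def)

lemma Omega_xlog: "x \<in> ell2 \<Longrightarrow> Omega x n = x n * of_real (ln (norm2 x)) - xlog (x n)"
  by (simp add: Omega_alt xlog_def)

lemma xlog_scale:
  fixes t :: "'k::real_normed_field"
  assumes "\<bar>r\<bar> \<le> 1"
  shows "norm (xlog (of_real r * t) - of_real r * xlog t) \<le> 2 * norm t"
proof (cases "r = 0 \<or> t = 0")
  case False
  then have "xlog (of_real r * t) - of_real r * xlog t = of_real (r * ln \<bar>r\<bar>) * t"
    by (simp add: xlog_def norm_mult ln_mult algebra_simps)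
  then have "norm (xlog (of_real r * t) - of_real r * xlog t) = \<bar>\<bar>r\<bar> * ln \<bar>r\<bar>\<bar> * norm t"
    by (simp add: norm_mult abs_mult del: of_real_mult)
  also have "\<dots> \<le> 2 * norm t" using assms by (intro mult_right_mono abs_mult_ln_le) auto
  finally show ?thesis .
qed auto

text \<open>Each induction step loses 4 by \<open>quasi_additive\<close> and 2 by
  \<open>xlog_scale\<close>. The growth with \<open>card F\<close> is harmless, since only
  boundedness of the block operator depends on it.\<close>

lemma xlog_combination:
  fixes y :: "'i \<Rightarrow> 'k::real_normed_field"
  assumes "finite F" "\<And>k. k \<in> F \<Longrightarrow> \<bar>c k\<bar> \<le> 1"
  shows "norm (xlog (\<Sum>k\<in>F. of_real (c k) * y k) - (\<Sum>k\<in>F. of_real (c k) * xlog (y k)))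
    \<le> 6 * card F * (\<Sum>k\<in>F. norm (y k))"
  using assms
proof (induction F)
  case (insert a F)
  let ?s = "of_real (c a) * y a" and ?t = "\<Sum>k\<in>F. of_real (c k) * y k"
  let ?r = "\<Sum>k\<in>F. of_real (c k) * xlog (y k)" and ?Y = "\<Sum>k\<in>F. norm (y k)"
  have s: "norm ?s \<le> norm (y a)"
    using insert.prems[of a] mult_right_mono[of "\<bar>c a\<bar>" 1 "norm (y a)"] by (simp add: norm_mult)
  have t: "norm ?t \<le> ?Y"
  proof (rule sum_norm_le)
    fix k assume "k \<in> F"
    then show "norm (of_real (c k) * y k) \<le> norm (y k)"
      using insert.prems[of k] mult_right_mono[of "\<bar>c k\<bar>" 1 "norm (y k)"] by (simp add: norm_mult)
  qed
  have Y: "0 \<le> ?Y" by (simp add: sum_nonneg)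
  have "xlog (?s + ?t) - (of_real (c a) * xlog (y a) + ?r)
      = (xlog (?s + ?t) - xlog ?s - xlog ?t) + (xlog ?s - of_real (c a) * xlog (y a)) + (xlog ?t - ?r)"
    by simp
  also have "norm \<dots> \<le> (4 * norm ?s + 4 * norm ?t) + 2 * norm (y a) + 6 * card F * ?Y"
    by (intro norm_triangle_mono xlog_scale insert.IH insert.prems)
      (use quasi_additive[of ?s ?t] in \<open>auto simp: xlog_def\<close>)
  also have "\<dots> \<le> 6 * (norm (y a) + ?Y) + 6 * card F * (norm (y a) + ?Y)"
    using s t Y by (intro add_mono mult_left_mono) auto
  also have "\<dots> = 6 * (Suc (card F)) * (norm (y a) + ?Y)" by (simp add: algebra_simps)
  finally show ?case using insert.hyps by simp
qed simp

section \<open>Block diagonal operators\<close>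

definition blk :: "nat \<Rightarrow> (nat \<Rightarrow> nat \<Rightarrow> real) \<Rightarrow> (nat \<Rightarrow> 'k) \<Rightarrow> nat \<Rightarrow> 'k::real_normed_field" where
  "blk d b x n = (\<Sum>k<d. of_real (b (n mod d) k) * x (d * (n div d) + k))"

definition Zblk :: "nat \<Rightarrow> (nat \<Rightarrow> nat \<Rightarrow> real) \<Rightarrow> 'k::real_normed_field Z2 \<Rightarrow> 'k Z2" where
  "Zblk d b u = Z2_of (blk d b (Zx u), blk d b (Zy u))"

lemma blk_add: "blk d b (\<lambda>n. x n + y n) n = blk d b x n + blk d b y n"
  by (simp add: blk_def sum.distrib algebra_simps)

lemma blk_cnj: "blk d b (\<lambda>n. scalar_cnj (x n)) n = scalar_cnj (blk d b x n)"
  for x :: "nat \<Rightarrow> 'k::{real_or_complex,banach}"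
proof -
  have "scalar_cnj (\<Sum>k\<in>F. f k) = (\<Sum>k\<in>F. scalar_cnj (f k))" for F and f :: "nat \<Rightarrow> 'k"
    by (induction F rule: infinite_finite_induct) (auto simp: scalar_cnj_add)
  then show ?thesis by (simp add: blk_def scalar_cnj_mult)
qed

context
  fixes d :: nat and b :: "nat \<Rightarrow> nat \<Rightarrow> real"
  assumes d: "d > 0" and sym: "\<And>j k. b j k = b k j" and b1: "\<And>j k. \<bar>b j k\<bar> \<le> 1"
    and orth: "\<And>j l. j < d \<Longrightarrow> l < d \<Longrightarrow> (\<Sum>k<d. b j k * b k l) = (if j = l then 1 else 0)"
begin

lemma blk_index: "j < d \<Longrightarrow> blk d b x (d * q + j) = (\<Sum>k<d. of_real (b j k) * x (d * q + k))"
  by (simp add: blk_def)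

lemma blk_blk: "blk d b (blk d b x) n = (x n :: 'k::real_normed_field)"
proof -
  define q j where "q = n div d" and "j = n mod d"
  have n: "n = d * q + j" and j: "j < d" using d by (auto simp: q_def j_def)
  have "blk d b (blk d b x) n = (\<Sum>k<d. \<Sum>l<d. of_real (b j k * b k l) * x (d * q + l))"
    by (simp add: n blk_index j sum_distrib_left mult.assoc)
  also have "\<dots> = (\<Sum>l<d. of_real (\<Sum>k<d. b j k * b k l) * x (d * q + l))"
    by (subst sum.swap) (simp add: sum_distrib_right)
  also have "\<dots> = (\<Sum>l<d. if l = j then x (d * q + l) else 0)"
    by (intro sum.cong refl) (auto simp: orth[OF j] simp del: of_real_sum)
  also have "\<dots> = x n" using j by (simp add: n)
  finally show ?thesis .
qed

lemma blk_symmetric: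
  "(\<Sum>n<d * N. blk d b x n * y n) = (\<Sum>n<d * N. x n * blk d b y n :: 'k::real_normed_field)"
proof -
  have "(\<Sum>j<d. blk d b x (d * q + j) * y (d * q + j)) = (\<Sum>j<d. x (d * q + j) * blk d b y (d * q + j))" for q
  proof -
    have "(\<Sum>j<d. blk d b x (d * q + j) * y (d * q + j))
        = (\<Sum>j<d. \<Sum>k<d. of_real (b j k) * x (d * q + k) * y (d * q + j))"
      by (simp add: blk_index sum_distrib_right)
    also have "\<dots> = (\<Sum>k<d. \<Sum>j<d. of_real (b k j) * x (d * q + k) * y (d * q + j))"
      by (subst sum.swap) (simp add: sym)
    also have "\<dots> = (\<Sum>k<d. x (d * q + k) * blk d b y (d * q + k))"
      by (simp add: blk_index sum_distrib_left mult_ac)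
    finally show ?thesis .
  qed
  then show ?thesis unfolding sum_blocks by simp
qed

text \<open>A symmetric matrix that is its own inverse is an isometry: one factor is moved across by
  \<open>blk_symmetric\<close> and cancelled by \<open>blk_blk\<close>. Conjugation commutes with
  \<open>blk\<close> because the entries are real.\<close>

lemma blk_sum_norm:
  fixes x :: "nat \<Rightarrow> 'k::{real_or_complex,banach}"
  shows "(\<Sum>n<d * N. (norm (blk d b x n))\<^sup>2) = (\<Sum>n<d * N. (norm (x n))\<^sup>2)"
proof -
  have sq: "(of_real ((norm t)\<^sup>2) :: 'k) = t * scalar_cnj t" for t :: 'k
    by (simp add: scalar_cnj_norm scaleR_conv_of_real)
  have "(of_real (\<Sum>n<d * N. (norm (blk d b x n))\<^sup>2) :: 'k)
      = (\<Sum>n<d * N. blk d b x n * blk d b (\<lambda>n. scalar_cnj (x n)) n)"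
    unfolding of_real_sum sq by (simp add: blk_cnj)
  also have "\<dots> = (\<Sum>n<d * N. x n * scalar_cnj (x n))"
    by (simp add: blk_symmetric blk_blk)
  also have "\<dots> = of_real (\<Sum>n<d * N. (norm (x n))\<^sup>2)" unfolding of_real_sum sq by simp
  finally show ?thesis by (simp only: of_real_eq_iff)
qed

lemma L2_set_initial_le: "L2_set (f :: nat \<Rightarrow> real) {..<N} \<le> L2_set f {..<d * N}"
  unfolding L2_set_def using d by (intro real_sqrt_le_mono sum_mono2) auto

context
  fixes x :: "nat \<Rightarrow> 'k::{real_or_complex,banach}"
  assumes x: "x \<in> ell2"
begin

lemma blk_L2_set: "L2_set (\<lambda>i. norm (blk d b x i)) {..<N} \<le> norm2 x"
proof -
  have "L2_set (\<lambda>i. norm (blk d b x i)) {..<N} \<le> L2_set (\<lambda>i. norm (blk d b x i)) {..<d * N}"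
    by (rule L2_set_initial_le)
  also have "\<dots> = L2_set (\<lambda>i. norm (x i)) {..<d * N}" by (simp add: L2_set_def blk_sum_norm)
  also have "\<dots> \<le> norm2 x" by (intro norm2_L2_set x) simp
  finally show ?thesis .
qed

lemma blk_ell2: "blk d b x \<in> ell2" and norm2_blk_le: "norm2 (blk d b x) \<le> norm2 x"
  using blk_L2_set by (rule ell2_if_bounded, rule norm2_le)

end

lemma norm2_blk:
  fixes x :: "nat \<Rightarrow> 'k::{real_or_complex,banach}"
  assumes x: "x \<in> ell2"
  shows "norm2 (blk d b x) = norm2 x"
proof (rule antisym[OF norm2_blk_le[OF x]])
  have "blk d b (blk d b x) = x" by (rule ext) (rule blk_blk)
  then show "norm2 x \<le> norm2 (blk d b x)" using norm2_blk_le[OF blk_ell2[OF x]] by simp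
qed

context
  fixes y :: "nat \<Rightarrow> 'k::{real_or_complex,banach}"
  assumes y: "y \<in> ell2"
begin

text \<open>Since \<open>blk\<close> preserves the norm, the logarithms of the norms agree on both
  sides and only the defect of \<open>xlog\<close> on a combination of \<open>d\<close> entries
  remains.\<close>

lemma blk_Omega_pointwise:
  "norm (blk d b (Omega y) n - Omega (blk d b y) n) \<le> 6 * d * (\<Sum>k<d. norm (y (d * (n div d) + k)))"
proof -
  have "blk d b (Omega y) n = blk d b y n * of_real (ln (norm2 y))
      - (\<Sum>k<d. of_real (b (n mod d) k) * xlog (y (d * (n div d) + k)))"
    by (simp add: blk_def Omega_xlog[OF y] right_diff_distrib sum_subtractf sum_distrib_left
        sum_distrib_right mult_ac)
  then have "blk d b (Omega y) n - Omega (blk d b y) n = xlog (blk d b y n)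
      - (\<Sum>k<d. of_real (b (n mod d) k) * xlog (y (d * (n div d) + k)))"
    by (simp add: Omega_xlog[OF blk_ell2[OF y]] norm2_blk[OF y])
  then show ?thesis
    using xlog_combination[of "{..<d}" "b (n mod d)" "\<lambda>k. y (d * (n div d) + k)"] b1
    by (simp add: blk_def)
qed

text \<open>A crude count; any finite constant serves, as it only shows that \<open>Zblk d b\<close>
  is bounded.\<close>

lemma blk_Omega_L2_set:
  "L2_set (\<lambda>n. norm (blk d b (Omega y) n - Omega (blk d b y) n)) {..<N} \<le> 6 * real d ^ 4 * norm2 y"
proof -
  define Y where "Y n = (\<Sum>k<d. norm (y (d * (n div d) + k)))" for n
  have "Y n \<le> d * L2_set (\<lambda>k. norm (y (d * (n div d) + k))) {..<d}" for n
    using sum_bounded_above[of "{..<d}" "\<lambda>k. norm (y (d * (n div d) + k))"] member_le_L2_set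
    unfolding Y_def by (metis card_lessThan finite_lessThan)
  then have "(Y n)\<^sup>2 \<le> (d * L2_set (\<lambda>k. norm (y (d * (n div d) + k))) {..<d})\<^sup>2" for n
    by (intro power_mono) (auto simp: Y_def sum_nonneg)
  then have Y: "(Y n)\<^sup>2 \<le> d\<^sup>2 * (\<Sum>k<d. (norm (y (d * (n div d) + k)))\<^sup>2)" for n
    by (simp add: power_mult_distrib L2_set_def sum_nonneg)
  have "(\<Sum>n<d * N. (Y n)\<^sup>2) \<le> (\<Sum>n<d * N. d\<^sup>2 * (\<Sum>k<d. (norm (y (d * (n div d) + k)))\<^sup>2))"
    by (intro sum_mono) (use Y in simp)
  also have "\<dots> = (\<Sum>q<N. \<Sum>j<d. d\<^sup>2 * (\<Sum>k<d. (norm (y (d * q + k)))\<^sup>2))"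
    by (simp add: sum_blocks)
  also have "\<dots> = (\<Sum>q<N. real d ^ 3 * (\<Sum>k<d. (norm (y (d * q + k)))\<^sup>2))"
    by (simp add: power3_eq_cube power2_eq_square mult.assoc)
  also have "\<dots> = real d ^ 3 * (\<Sum>n<d * N. (norm (y n))\<^sup>2)"
    by (simp only: sum_blocks sum_distrib_left)
  also have "\<dots> \<le> (real d ^ 3)\<^sup>2 * (\<Sum>n<d * N. (norm (y n))\<^sup>2)"
    using d by (intro mult_right_mono self_le_power one_le_power) (auto simp: sum_nonneg)
  finally have "L2_set Y {..<d * N} \<le> sqrt ((real d ^ 3)\<^sup>2 * (\<Sum>n<d * N. (norm (y n))\<^sup>2))"
    unfolding L2_set_def by (rule real_sqrt_le_mono)
  also have "\<dots> = real d ^ 3 * L2_set (\<lambda>n. norm (y n)) {..<d * N}"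
    unfolding L2_set_def by (simp only: real_sqrt_mult real_sqrt_abs) simp
  also have "\<dots> \<le> real d ^ 3 * norm2 y" by (intro mult_left_mono norm2_L2_set y) auto
  finally have Y3: "L2_set Y {..<d * N} \<le> real d ^ 3 * norm2 y" .
  have "L2_set (\<lambda>n. norm (blk d b (Omega y) n - Omega (blk d b y) n)) {..<N}
      \<le> L2_set (\<lambda>n. 6 * real d * Y n) {..<N}"
    using blk_Omega_pointwise by (intro L2_set_mono) (auto simp: Y_def)
  also have "\<dots> = 6 * real d * L2_set Y {..<N}"
    by (simp add: L2_set_right_distrib)
  also have "\<dots> \<le> 6 * real d * (real d ^ 3 * norm2 y)"
    by (intro mult_left_mono order_trans[OF L2_set_initial_le Y3]) auto
  finally show ?thesis by (simp add: power3_eq_cube power4_eq_xxxx mult_ac)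
qed

lemma blk_Omega_ell2: "(\<lambda>n. blk d b (Omega y) n - Omega (blk d b y) n) \<in> ell2"
  and norm2_blk_Omega: "norm2 (\<lambda>n. blk d b (Omega y) n - Omega (blk d b y) n) \<le> 6 * real d ^ 4 * norm2 y"
  using blk_Omega_L2_set by (rule ell2_if_bounded, rule norm2_le)

end

context
  fixes u :: "'k::{real_or_complex,banach} Z2"
begin

lemma Zblk_aux: "blk d b (Zx u) n - Omega (blk d b (Zy u)) n
    = blk d b (Zd u) n + (blk d b (Omega (Zy u)) n - Omega (blk d b (Zy u)) n)"
proof -
  have "Zx u = (\<lambda>n. Zd u n + Omega (Zy u) n)" by (auto simp: Zx_eq)
  then show ?thesis by (simp add: blk_add)
qed

lemma Zblk_coords: "Zx (Zblk d b u) = blk d b (Zx u)" "Zy (Zblk d b u) = blk d b (Zy u)"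
proof -
  have "(\<lambda>n. blk d b (Zx u) n - Omega (blk d b (Zy u)) n) \<in> ell2"
    unfolding Zblk_aux by (intro ell2_add blk_ell2 Zd_ell2 blk_Omega_ell2 Zy_ell2)
  from Z2_of_coords[OF blk_ell2[OF Zy_ell2] this]
  show "Zx (Zblk d b u) = blk d b (Zx u)" "Zy (Zblk d b u) = blk d b (Zy u)"
    by (auto simp: Zblk_def)
qed

lemma qnorm_Zblk: "Z2_qnorm (Zblk d b u) \<le> (1 + 6 * real d ^ 4) * Z2_qnorm u"
proof -
  have "norm2 (Zd (Zblk d b u)) \<le> norm2 (blk d b (Zd u))
      + norm2 (\<lambda>n. blk d b (Omega (Zy u)) n - Omega (blk d b (Zy u)) n)"
    unfolding Zd_def[of "Zblk d b u", abs_def] Zblk_coords Zblk_aux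
    by (intro norm2_triangle blk_ell2 Zd_ell2 blk_Omega_ell2 Zy_ell2)
  also have "\<dots> \<le> norm2 (Zd u) + 6 * real d ^ 4 * norm2 (Zy u)"
    by (intro add_mono norm2_blk_le norm2_blk_Omega Zd_ell2 Zy_ell2)
  finally have "norm2 (Zd (Zblk d b u)) \<le> norm2 (Zd u) + 6 * real d ^ 4 * norm2 (Zy u)" .
  moreover have "norm2 (Zy (Zblk d b u)) = norm2 (Zy u)" by (simp add: Zblk_coords norm2_blk Zy_ell2)
  moreover have "0 \<le> 6 * real d ^ 4 * norm2 (Zd u)" by (simp add: norm2_nonneg Zd_ell2)
  ultimately show ?thesis by (simp add: Z2_qnorm_eq algebra_simps)
qed

end

lemma Zblk_op: "Zblk d b \<in> (Z2_operators :: ('k::{real_or_complex,banach} Z2 \<Rightarrow> 'k Z2) set)"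
  unfolding Z2_operators_iff
proof (intro conjI allI exI)
  show "Zblk d b (u + v) = Zblk d b u + Zblk d b v" for u v :: "'k Z2"
    by (rule Z2_eqI) (simp_all add: Zblk_coords blk_def sum.distrib algebra_simps)
  show "Zblk d b (Z2_scale c u) = Z2_scale c (Zblk d b u)" for c and u :: "'k Z2"
    by (rule Z2_eqI) (simp_all add: Zblk_coords blk_def sum_distrib_left mult_ac)
  show "Z2_qnorm (Zblk d b u) \<le> (1 + 6 * real d ^ 4) * Z2_qnorm u" for u :: "'k Z2"
    by (rule qnorm_Zblk)
qed

lemma Zform_Zblk: "Zform (Zblk d b u) v = Zform u (Zblk d b v :: 'k::{real_or_complex,banach} Z2)"
proof (rule LIMSEQ_unique)
  \<comment> \<open>Partial sums respect the blocks only at multiples of \<open>d\<close>, so the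
    limit is taken along this subsequence.\<close>
  have m: "strict_mono (\<lambda>N. d * N)" using d by (auto simp: strict_mono_def)
  have lim: "(\<lambda>N. \<Sum>n<d * N. Zterm u v n) \<longlonglongrightarrow> Zform u v" for u v :: "'k Z2"
    using LIMSEQ_subseq_LIMSEQ[OF Zform_sums[unfolded sums_def] m] by (simp add: o_def)
  have "(\<Sum>n<d * N. Zterm (Zblk d b u) v n) = (\<Sum>n<d * N. Zterm u (Zblk d b v) n)" for N
    by (simp add: Zterm_def Zblk_coords sum_subtractf blk_symmetric flip: blk_cnj)
  then show "(\<lambda>N. \<Sum>n<d * N. Zterm (Zblk d b u) v n) \<longlonglongrightarrow> Zform u (Zblk d b v)"
    using lim by simp
  show "(\<lambda>N. \<Sum>n<d * N. Zterm (Zblk d b u) v n) \<longlonglongrightarrow> Zform (Zblk d b u) v"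
    by (rule lim)
qed

lemma Z2_star_Zblk: "Z2_star (Zblk d b) = (Zblk d b :: 'k::{real_or_complex,banach} Z2 \<Rightarrow> 'k Z2)"
  by (intro Z2_star_eqI Zblk_op Zform_Zblk)

text \<open>On the range of \<open>Zj\<close> there is no twist and the operator is the isometry
  \<open>blk d b\<close>, so the large bound for its action on the section does not enter.\<close>

lemma ess_size_Zblk: "ess_size 1 (Zblk d b :: 'k::{real_or_complex,banach} Z2 \<Rightarrow> 'k Z2)"
proof -
  have "Zblk d b (Zj x) = Zj (blk d b x)" if "x \<in> ell2" for x :: "nat \<Rightarrow> 'k"
    by (rule Z2_eqI) (simp_all add: Zblk_coords that blk_ell2, simp add: blk_def)
  then show ?thesis
    by (auto simp: ess_size_def Z2_star_Zblk ess_le_def Znorm_Zj blk_ell2 norm2_blk ell2_tail_ell2)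
qed

text \<open>Linear operators cannot follow the logarithmic twist when a basis of a block is mapped to
  flat vectors: for an arbitrary operator the alternating sum below vanishes up to the twist, and the
  twist has opposite signs for the unit vectors and for the flat ones.\<close>

lemma op_size_flat_lower_bound:
  fixes h :: "'k::{real_or_complex,banach} Z2 \<Rightarrow> 'k Z2"
  assumes flat: "\<And>j k. \<bar>b j k\<bar> = 1 / sqrt (real d)"
    and h: "h \<in> Z2_strictly_singular_operators" and c: "op_size c (\<lambda>u. h u + Zblk d b u)"
  shows "ln (real d) \<le> 8 * c"
proof -
  have hop: "h \<in> Z2_operators" and hz: "ess_zero h" "ess_zero (Z2_star h)"
    using h by (auto simp: ss_op_iff ess_zero_star)
  \<comment> \<open>With the tolerance 1/2 for \<open>h\<close> and for its adjoint each
    \<open>?X k\<close> below has norm at most 1, half of the coefficient 2 of the main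
    term.\<close>
  obtain n1 n2 where n1: "\<And>x. x \<in> ell2_tail n1 \<Longrightarrow> Znorm (h (Zj x)) \<le> 1 / 2 * norm2 x"
    and n2: "\<And>x. x \<in> ell2_tail n2 \<Longrightarrow> Znorm (Z2_star h (Zj x)) \<le> 1 / 2 * norm2 x"
  proof -
    have "ess_le (1 / 2) h" "ess_le (1 / 2) (Z2_star h)" using hz by (auto simp: ess_zero_def)
    then show ?thesis using that unfolding ess_le_def by blast
  qed
  \<comment> \<open>Block number \<open>q\<close> begins at \<open>d * q \<ge> q\<close>, beyond
    both tails.\<close>
  define q where "q = max n1 n2"
  define L where "L = ln (real d) / 2"
  have L: "0 \<le> L" using d by (simp add: L_def)
  define e where "e k = (Zunit (d * q + k) :: nat \<Rightarrow> 'k)" for k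
  define f where "f k = blk d b (e k)" for k
  define u where "u k = Zw (e k)" for k
  define w where "w k = Zblk d b (u k)" for k
  define v where "v k = Zw (f k)" for k
  have e2: "e k \<in> ell2" "norm2 (e k) = 1" for k by (auto simp: e_def)
  have f2: "f k \<in> ell2" "norm2 (f k) = 1" for k by (auto simp: f_def e2 blk_ell2 norm2_blk)
  have f_eq: "f k n = (if n div d = q then of_real (b (n mod d) k) else 0)" if "k < d" for k n
  proof -
    have "d * (n div d) + l = d * q + k \<longleftrightarrow> n div d = q \<and> l = k" if "l < d" for l
      using that \<open>k < d\<close> by (metis add_left_cancel div_mult_self4 div_less add.right_neutral d less_not_refl
          mult.commute add.commute div_mult_self1)
    then have "f k n = (\<Sum>l<d. if l = k then (if n div d = q then of_real (b (n mod d) k) else 0) else 0)"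
      unfolding f_def blk_def e_def Zunit_def by (intro sum.cong) auto
    then show ?thesis using that by simp
  qed
  have ftail: "f k \<in> ell2_tail q" if "k < d" for k
  proof -
    have "f k i = 0" if "i < q" for i
    proof -
      have "i div d \<noteq> q" using that div_le_dividend[of i d] by linarith
      then show ?thesis by (simp add: f_eq[OF \<open>k < d\<close>])
    qed
    then show ?thesis by (simp add: ell2_tail_def f2)
  qed
  \<comment> \<open>All nonzero entries of the unit vector \<open>f k\<close> have modulus
    \<open>1 / sqrt d\<close>, so the logarithm is constant on its support.\<close>
  have Of: "Omega (f k) n = of_real L * f k n" if "k < d" for k n
  proof (cases "f k n = 0")
    case False
    then have "norm (f k n) = 1 / sqrt (real d)" using that flat by (simp add: f_eq split: if_splits)
    then show ?thesis using False d by (simp add: Omega_def f2 L_def ln_sqrt)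
  qed (simp add: Omega_def)
  have uc: "Zx (u k) = (\<lambda>_. 0)" "Zy (u k) = e k" for k
    by (auto simp: u_def e2) (auto simp: e_def)
  have wc: "Zx (w k) n = 0" "Zy (w k) = f k" for k n
    by (auto simp: w_def Zblk_coords uc f_def) (simp add: blk_def)
  have w_eq: "w k = (\<Sum>l<d. Z2_scale (of_real (b l k)) (u l))" if k: "k < d" for k
  proof (rule Z2_eqI)
    fix n
    have "n = d * q + l \<longleftrightarrow> n div d = q \<and> l = n mod d" if "l < d" for l using that by auto
    then have "(\<Sum>l<d. of_real (b l k) * e l n)
        = (\<Sum>l<d. if l = n mod d then (if n div d = q then of_real (b l k) else 0) else 0)"
      unfolding e_def Zunit_def by (intro sum.cong) auto
    also have "\<dots> = f k n" using d by (simp add: f_eq[OF k])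
    finally show "Zy (w k) n = Zy (\<Sum>l<d. Z2_scale (of_real (b l k)) (u l)) n" by (simp add: wc uc)
  qed (simp add: wc uc)
  \<comment> \<open>The defect itself: \<open>v k\<close> is the section at \<open>f k\<close>,
    \<open>w k\<close> the image of the section at \<open>e k\<close>, and the twist
    \<open>L\<close> is all that separates them.\<close>
  have v_eq: "v k = Z2_scale (of_real L) (Zj (f k)) + w k" if "k < d" for k
    by (rule Z2_eqI) (simp_all add: v_def f2 Of[OF that] wc)
  have vw: "Zform (v k) (w k) = of_real L" if "k < d" for k
  proof -
    have "Zform (w k) (w k) = 0" by (simp add: Zform_def Zterm_def wc)
    moreover have "Zform (Zj (f k)) (w k) = 1"
      by (simp add: Zform_Zj_left[OF f2(1)] wc suminf_self f2)
    ultimately show ?thesis by (simp add: v_eq[OF that] Zform_add_left Zform_scale_left)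
  qed
  let ?R = "\<lambda>u. h u + Zblk d b u"
  let ?X = "\<lambda>k. Zform (h (Zj (f k))) (u k) - Zform (h (u k)) (Zj (f k))"
  have qn: "Z2_qnorm (u k) = 1" "Z2_qnorm (v k) = 1" for k
    by (auto simp: u_def v_def Z2_qnorm_Zw e2 f2)
  \<comment> \<open>The trace argument. Both sides of \<open>cancel\<close> are the sum of the
    entries \<open>Zform (h (u l)) (u k)\<close> weighted with the matrix \<open>b\<close>, and
    symmetry of \<open>b\<close> identifies them.\<close>
  have "(\<Sum>k<d. Zform (h (w k)) (u k)) = (\<Sum>k<d. \<Sum>l<d. of_real (b l k) * Zform (h (u l)) (u k))"
    by (intro sum.cong) (auto simp: w_eq op_sum[OF hop] op_scale[OF hop] Zform_sum_left Zform_scale_left)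
  also have "\<dots> = (\<Sum>l<d. \<Sum>k<d. of_real (b k l) * Zform (h (u l)) (u k))"
    by (subst sum.swap) (simp add: sym)
  also have "\<dots> = (\<Sum>l<d. Zform (h (u l)) (w l))"
    by (intro sum.cong) (auto simp: w_eq Zform_sum_right Zform_scale_right)
  finally have cancel: "(\<Sum>k<d. Zform (h (w k)) (u k)) = (\<Sum>k<d. Zform (h (u k)) (w k))" .
  have "(\<Sum>k<d. Zform (?R (v k)) (u k) - Zform (?R (u k)) (v k))
      = (\<Sum>k<d. of_real (2 * L) + of_real L * ?X k + (Zform (h (w k)) (u k) - Zform (h (u k)) (w k)))"
  proof (intro sum.cong refl)
    fix k assume "k \<in> {..<d}"
    then have k: "k < d" by simp
    \<comment> \<open>Self-adjointness reduces this to \<open>Zform (v k) (w k)\<close>. In 2 the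
      arguments are exchanged and the sign changes, so the difference is \<open>2 * L\<close>
      instead of 0.\<close>
    have 1: "Zform (Zblk d b (v k)) (u k) = of_real L" using vw[OF k] by (simp add: Zform_Zblk w_def)
    have 2: "Zform (Zblk d b (u k)) (v k) = - of_real L"
      using vw[OF k] by (simp add: Zform_skew[of _ "v k"] flip: w_def)
    have 3: "Zform (h (v k)) (u k) = of_real L * Zform (h (Zj (f k))) (u k) + Zform (h (w k)) (u k)"
      by (simp add: v_eq[OF k] op_add[OF hop] op_scale[OF hop] Zform_add_left Zform_scale_left)
    have 4: "Zform (h (u k)) (v k) = of_real L * Zform (h (u k)) (Zj (f k)) + Zform (h (u k)) (w k)"
      by (simp add: v_eq[OF k] Zform_add_right Zform_scale_right)
    show "Zform (?R (v k)) (u k) - Zform (?R (u k)) (v k)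
        = of_real (2 * L) + of_real L * ?X k + (Zform (h (w k)) (u k) - Zform (h (u k)) (w k))"
      by (simp add: Zform_add_left 1 2 3 4 algebra_simps)
  qed
  also have "\<dots> = of_real (d * (2 * L)) + of_real L * (\<Sum>k<d. ?X k)"
  proof -
    have "(\<Sum>k<d. Zform (h (w k)) (u k) - Zform (h (u k)) (w k)) = 0"
      by (simp add: sum_subtractf cancel)
    then show ?thesis by (simp add: sum.distrib sum_distrib_left[symmetric])
  qed
  finally have eq: "of_real (d * (2 * L)) = (\<Sum>k<d. Zform (?R (v k)) (u k) - Zform (?R (u k)) (v k))
      - of_real L * (\<Sum>k<d. ?X k)" by simp
  have X: "norm (?X k) \<le> 1" if k: "k < d" for k
  proof -
    have t: "f k \<in> ell2_tail n1" "f k \<in> ell2_tail n2"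
      by (rule subsetD[OF ell2_tail_antimono ftail[OF k]]; simp add: q_def)+
    have "norm (Zform (h (Zj (f k))) (u k)) \<le> 1 / 2"
      using norm_Zform_le[of "h (Zj (f k))" "u k"] n1[OF t(1)] by (simp add: qn f2)
    moreover have "norm (Zform (h (u k)) (Zj (f k))) \<le> 1 / 2"
      using norm_Zform_le[of "Z2_star h (Zj (f k))" "u k"] n2[OF t(2)]
      by (simp add: qn f2 Zform_star[OF hop] norm_Zform_commute[of "u k"])
    ultimately show ?thesis
      using norm_triangle_ineq4[of "Zform (h (Zj (f k))) (u k)" "Zform (h (u k)) (Zj (f k))"] by linarith
  qed
  have R: "norm (Zform (?R (v k)) (u k) - Zform (?R (u k)) (v k)) \<le> 4 * c" if "k < d" for k
  proof -
    have c0: "0 \<le> c"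
    proof -
      have "0 \<le> c * Znorm (Zj (Zunit 0) :: 'k Z2)"
        using c Znorm_nonneg order_trans unfolding op_size_def by blast
      then show ?thesis by (simp add: Znorm_Zj)
    qed
    have Rle: "Znorm (?R x) \<le> 2 * c" if "Z2_qnorm x = 1" for x
    proof -
      have "Znorm (?R x) \<le> c * Znorm x" using c by (simp add: op_size_def)
      also have "\<dots> \<le> c * 2" using Znorm_le_qnorm[of x] that c0 by (intro mult_left_mono) auto
      finally show ?thesis by simp
    qed
    have "norm (Zform (?R (v k)) (u k)) \<le> 2 * c" "norm (Zform (?R (u k)) (v k)) \<le> 2 * c"
      using norm_Zform_le[of "?R (v k)" "u k"] norm_Zform_le[of "?R (u k)" "v k"]
        Rle[OF qn(1), of k] Rle[OF qn(2), of k] by (auto simp: qn)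
    then show ?thesis
      using norm_triangle_ineq4[of "Zform (?R (v k)) (u k)" "Zform (?R (u k)) (v k)"] by linarith
  qed
  have "d * (2 * L) = norm (of_real (d * (2 * L)) :: 'k)" using L by (simp only: norm_of_real) simp
  also have "\<dots> \<le> norm (\<Sum>k<d. Zform (?R (v k)) (u k) - Zform (?R (u k)) (v k))
      + norm (of_real L * (\<Sum>k<d. ?X k))" unfolding eq by (rule norm_triangle_ineq4)
  also have "\<dots> \<le> d * (4 * c) + L * (d * 1)"
  proof (intro add_mono)
    show "norm (\<Sum>k<d. Zform (?R (v k)) (u k) - Zform (?R (u k)) (v k)) \<le> d * (4 * c)"
      using sum_norm_bound[of "{..<d}" "\<lambda>k. Zform (?R (v k)) (u k) - Zform (?R (u k)) (v k)" "4 * c"] R by simp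
    have "norm (\<Sum>k<d. ?X k) \<le> d * 1" using sum_norm_bound[of "{..<d}" ?X 1] X by simp
    then show "norm (of_real L * (\<Sum>k<d. ?X k)) \<le> L * (d * 1)"
      unfolding norm_mult using L by (intro mult_mono) auto
  qed
  \<comment> \<open>The main term \<open>2 * L * d\<close> loses \<open>L * d\<close> to
    \<open>h\<close>; each of the \<open>d\<close> differences is at most \<open>4 * c\<close>,
    because \<open>u k\<close> and \<open>v k\<close> have quasi-norm 1 and \<open>Znorm\<close> is
    at most twice the quasi-norm.\<close>
  finally have "real d * L \<le> real d * (4 * c)" by (simp add: algebra_simps)
  then show ?thesis using d by (simp add: L_def)
qed

end


section \<open>Hadamard matrices\<close>

text \<open>Sylvester's matrices without normalisation: the sign is given by the parity of the
  number of common binary digits 1 of \<open>j\<close> and \<open>k\<close> among the lowest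
  \<open>m\<close>.\<close>

fun hadamard :: "nat \<Rightarrow> nat \<Rightarrow> nat \<Rightarrow> real" where
  "hadamard 0 j k = 1"
| "hadamard (Suc m) j k = hadamard m (j div 2) (k div 2) * (if odd j \<and> odd k then -1 else 1)"

lemma hadamard_sym: "hadamard m j k = hadamard m k j"
  by (induction m arbitrary: j k) auto

lemma hadamard_abs: "\<bar>hadamard m j k\<bar> = 1"
  by (induction m arbitrary: j k) (auto simp: abs_mult)

lemma sum_even_odd: "(\<Sum>k<2 * n. f k) = (\<Sum>k<n. f (2 * k) + f (2 * k + 1))"
  for f :: "nat \<Rightarrow> 'a::comm_monoid_add"
  by (induction n) (auto simp: add.assoc)

text \<open>Splitting \<open>k\<close> by its last binary digit yields the factor
  \<open>1 + ?s j * ?s l\<close>. It vanishes exactly when \<open>j\<close> and \<open>l\<close>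
  differ in parity, the case that the halves \<open>j div 2\<close> and \<open>l div 2\<close>
  cannot detect.\<close>

lemma hadamard_orthogonal:
  "j < 2 ^ m \<Longrightarrow> l < 2 ^ m \<Longrightarrow>
    (\<Sum>k<2 ^ m. hadamard m j k * hadamard m k l) = (if j = l then 2 ^ m else 0)"
proof (induction m arbitrary: j l)
  case (Suc m)
  let ?s = "\<lambda>i. if odd i then -1 else 1 :: real"
  have jl: "j div 2 < 2 ^ m" "l div 2 < 2 ^ m" using Suc.prems by auto
  have "(\<Sum>k<2 ^ Suc m. hadamard (Suc m) j k * hadamard (Suc m) k l)
      = (\<Sum>k<2 ^ m. hadamard m (j div 2) k * hadamard m k (l div 2) * (1 + ?s j * ?s l))"
    unfolding power_Suc sum_even_odd by (intro sum.cong) (auto simp: algebra_simps)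
  also have "\<dots> = (if j div 2 = l div 2 then 2 ^ m else 0) * (1 + ?s j * ?s l)"
    unfolding sum_distrib_right[symmetric] Suc.IH[OF jl] ..
  also have "\<dots> = (if j = l then 2 ^ Suc m else 0)"
  proof (cases "j = l")
    case False
    then have "j div 2 \<noteq> l div 2 \<or> odd j \<noteq> odd l"
      by (metis dvd_mult_div_cancel odd_two_times_div_two_succ)
    then show ?thesis using False by auto
  qed auto
  finally show ?case .
qed simp

section \<open>Comparison of the two norms\<close>

lemma norms_inequivalent:
  "\<not> equivalent_norms (Z2_quotient_algebra :: ('k::{real_or_complex,banach}, _) star_algebra)
    (coset_size op_size) (coset_size ess_size)"
proof
  let ?Q = "Z2_quotient_algebra :: ('k, ('k Z2 \<Rightarrow> 'k Z2) set) star_algebra"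
  assume "equivalent_norms ?Q (coset_size op_size) (coset_size ess_size)"
  then obtain C where C: "\<And>X. X \<in> carrier ?Q \<Longrightarrow> coset_size op_size X \<le> C * coset_size ess_size X"
    unfolding equivalent_norms_def by blast
  \<comment> \<open>This makes \<open>ln d = m * ln 2\<close> larger than
    \<open>8 * \<bar>C\<bar>\<close>, against the lower bound \<open>ln d / 8\<close> for one norm
    and the upper bound 1 for the other.\<close>
  obtain m :: nat where m: "real m > 8 * \<bar>C\<bar> / ln 2" using reals_Archimedean2 by blast
  define d :: nat where "d = 2 ^ m"
  define b where "b j k = hadamard m j k / sqrt d" for j k
  have d: "d > 0" by (simp add: d_def)
  have sym: "b j k = b k j" for j k by (simp add: b_def hadamard_sym)
  have flat: "\<bar>b j k\<bar> = 1 / sqrt (real d)" for j k by (simp add: b_def hadamard_abs)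
  have b1: "\<bar>b j k\<bar> \<le> 1" for j k unfolding flat using d by (simp add: divide_le_eq)
  have orth: "(\<Sum>k<d. b j k * b k l) = (if j = l then 1 else 0)" if "j < d" "l < d" for j l
  proof -
    have "(\<Sum>k<d. b j k * b k l) = (\<Sum>k<d. hadamard m j k * hadamard m k l) / d"
      using d by (simp add: b_def sum_divide_distrib)
    also have "\<dots> = (if j = l then 1 else 0)"
      using hadamard_orthogonal[of j m l] that d by (simp add: d_def)
    finally show ?thesis .
  qed
  let ?T = "Zblk d b :: 'k Z2 \<Rightarrow> 'k Z2"
  let ?X = "ss_coset ?T"
  have T: "?T \<in> Z2_operators" by (rule Zblk_op[OF d sym b1]) (rule orth)
  have E: "ess_size 1 ?T" by (rule ess_size_Zblk[OF d sym b1]) (rule orth)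
  have X: "?X \<in> carrier ?Q" using T by (simp add: Z2_quotient_algebra_simps)
  have "coset_size ess_size ?X \<le> 1"
    using E self_in_ss_coset by (intro coset_size_le[where T = ?T]) auto
  moreover have "0 \<le> coset_size ess_size ?X"
    using E self_in_ss_coset
    by (intro coset_size_ge) (auto intro!: exI[of _ 1])
  ultimately have "C * coset_size ess_size ?X \<le> \<bar>C\<bar> * 1" by (intro mult_mono) auto
  moreover have "ln (real d) / 8 \<le> coset_size op_size ?X"
  proof (rule coset_size_ge)
    show "\<exists>c\<ge>0. \<exists>T\<in>?X. op_size c T" using op_size_exists[OF T] self_in_ss_coset by blast
    fix c S assume "S \<in> ?X" "op_size c S"
    then obtain h where h: "h \<in> Z2_strictly_singular_operators" "op_size c (\<lambda>u. h u + ?T u)"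
      by (auto simp: ss_coset_def)
    have "ln (real d) \<le> 8 * c"
      by (rule op_size_flat_lower_bound[where d = d and b = b]) (fact d sym b1 orth flat h)+
    then show "ln (real d) / 8 \<le> c" by simp
  qed
  moreover have "ln (real d) = m * ln 2" by (simp add: d_def ln_realpow)
  ultimately show False using C[OF X] m by (simp add: field_simps)
qed

theorem theorem1p7:
  shows "(\<exists>N N'. star_algebra_norm
              (Z2_quotient_algebra :: (real, (real Z2 \<Rightarrow> real Z2) set) star_algebra) N
            \<and> star_algebra_norm
              (Z2_quotient_algebra :: (real, (real Z2 \<Rightarrow> real Z2) set) star_algebra) N'
            \<and> \<not> equivalent_norms
              (Z2_quotient_algebra :: (real, (real Z2 \<Rightarrow> real Z2) set) star_algebra) N N')
       \<and> (\<exists>N N'. star_algebra_norm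
              (Z2_quotient_algebra :: (complex, (complex Z2 \<Rightarrow> complex Z2) set) star_algebra) N
            \<and> star_algebra_norm
              (Z2_quotient_algebra :: (complex, (complex Z2 \<Rightarrow> complex Z2) set) star_algebra) N'
            \<and> \<not> equivalent_norms
              (Z2_quotient_algebra :: (complex, (complex Z2 \<Rightarrow> complex Z2) set) star_algebra) N N')"
  by (intro conjI exI[of _ "coset_size op_size"] exI[of _ "coset_size ess_size"] op_size_norm
      ess_size_norm norms_inequivalent)

end
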